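(* Let $\mathfrak X=(X,\{R_i\}_{0\le i\le d})$ be a Q-polynomial symmetric association scheme with respect to an ordering $E_0,E_1,\dots,E_d$ of its primitive idempotents, and suppose $\mathfrak X$ is spherically embedded in $\mathbb R^3$ with respect to $E_1$, i.e. $m_1=\operatorname{rank}E_1=3$. Then the embedded point set $\overline X=\{\overline x:x\in X\}\subset S^2\subset\mathbb R^3$ is, up to an orthogonal transformation of $\mathbb R^3$, the vertex set (inscribed in the unit sphere $S^2$) of one of the following polyhedra: the regular tetrahedron ($|X|=4$), the regular octahedron ($|X|=6$), the cube ($|X|=8$), the regular icosahedron ($|X|=12$), the quasi-regular polyhedron of type $[3,4,3,4]$ ($|X|=12$), the regular dodecahedron ($|X|=20$), or the quasi-regular polyhedron of type $[3,5,3,5]$ ($|X|=30$).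
   Context: A symmetric association scheme $\mathfrak X=(X,\{R_i\}_{0\le i\le d})$ consists of a finite nonempty set $X$ and a partition of $X\times X$ into nonempty symmetric relations $R_0,\dots,R_d$ with $R_0=\{(x,x):x\in X\}$, such that for all $i,j,k$ there is a constant $p_{ij}^k$ with $|\{z\in X:(x,z)\in R_i,(z,y)\in R_j\}|=p_{ij}^k$ for every $(x,y)\in R_k$. Let $A_i$ be the adjacency matrix of $R_i$. The real span of $A_0,\dots,A_d$ (the Bose-Mesner algebra) is a commutative algebra of symmetric matrices; its primitive idempotents are denoted $E_0=\frac1{|X|}J,E_1,\dots,E_d$, where $J$ is the all-ones matrix, and $m_i=\operatorname{rank}E_i$. The scheme is Q-polynomial with respect to the ordering $E_0,E_1,\dots,E_d$ if for each $i$ there is a real polynomial $v_i^*$ of degree exactly $i$ such that $|X|E_i$ is obtained by applying $v_i^*$ entrywise to $|X|E_1$. The spherical embedding of $\mathfrak X$ with respect to a primitive idempotent $E_i$ is the map $X\to\mathbb R^{m_i}$, $x\mapsto\overline x=\sqrt{|X|/m_i}\,E_i\phi_x$, where $\phi_x\in\mathbb R^X$ is the characteristic (column) vector of $x$ and the column space of $E_i$ is identified isometrically with $\mathbb R^{m_i}$. All $\overline x$ lie on the unit sphere $S^{m_i-1}$. The quasi-regular polyhedron of type $[3,4,3,4]$ (cuboctahedron) is the Archimedean solid in which a triangle, a square, a triangle, a square meet in cyclic order at each vertex; the one of type $[3,5,3,5]$ (icosidodecahedron) is the Archimedean solid in which a triangle, a regular pentagon, a triangle, a regular pentagon meet in cyclic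 order at each vertex. *)

theory Defs
  imports "HOL-Analysis.Analysis" "HOL-Computational_Algebra.Polynomial"
begin

section \<open>Symmetric association schemes\<close>

text \<open>
  The point set is the universe of a type of class finite (finite and nonempty), so that
  matrices indexed by points are of type \<open>real ^ 'x ^ 'x\<close>.
\<close>

definition symmetric_association_scheme :: "nat \<Rightarrow> (nat \<Rightarrow> ('x::finite \<times> 'x) set) \<Rightarrow> bool" where
  "symmetric_association_scheme d R \<longleftrightarrow>
     (\<Union>i\<le>d. R i) = UNIV \<and> disjoint_family_on R {..d} \<and>
     (\<forall>i\<le>d. R i \<noteq> {} \<and> sym (R i)) \<and>
     R 0 = Id \<and>
     (\<forall>i\<le>d. \<forall>j\<le>d. \<forall>k\<le>d. \<exists>p. \<forall>(x, y) \<in> R k. card {z. (x, z) \<in> R i \<and> (z, y) \<in> R j} = p)"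

definition adjacency_matrix :: "('x::finite \<times> 'x) set \<Rightarrow> real ^ 'x ^ 'x" where
  "adjacency_matrix r = (\<chi> x y. if (x, y) \<in> r then 1 else 0)"

definition bose_mesner_algebra :: "nat \<Rightarrow> (nat \<Rightarrow> ('x::finite \<times> 'x) set) \<Rightarrow> (real ^ 'x ^ 'x) set" where
  "bose_mesner_algebra d R = span ((\<lambda>i. adjacency_matrix (R i)) ` {..d})"

definition primitive_idempotent_in :: "(real ^ 'x ^ 'x::finite) set \<Rightarrow> real ^ 'x ^ 'x \<Rightarrow> bool" where
  "primitive_idempotent_in \<A> E \<longleftrightarrow>
     E \<in> \<A> \<and> E ** E = E \<and> E \<noteq> 0 \<and>
     (\<forall>F\<in>\<A>. \<forall>G\<in>\<A>. F ** F = F \<and> G ** G = G \<and> F ** G = 0 \<and> G ** F = 0 \<and> E = F + G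
        \<longrightarrow> F = 0 \<or> G = 0)"

definition primitive_idempotent_ordering ::
  "nat \<Rightarrow> (nat \<Rightarrow> ('x::finite \<times> 'x) set) \<Rightarrow> (nat \<Rightarrow> real ^ 'x ^ 'x) \<Rightarrow> bool" where
  "primitive_idempotent_ordering d R E \<longleftrightarrow>
     bij_betw E {..d} {M. primitive_idempotent_in (bose_mesner_algebra d R) M} \<and>
     E 0 = (1 / real CARD('x)) *\<^sub>R (\<chi> x y. 1)"

definition Q_polynomial_ordering :: "nat \<Rightarrow> (nat \<Rightarrow> real ^ 'x ^ 'x::finite) \<Rightarrow> bool" where
  "Q_polynomial_ordering d E \<longleftrightarrow>
     (\<forall>i\<le>d. \<exists>v :: real poly. degree v = i \<and>
        (\<forall>x y. real CARD('x) * E i $ x $ y = poly v (real CARD('x) * E 1 $ x $ y)))"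

section \<open>Spherical embedding\<close>

definition column_space :: "real ^ 'x ^ 'x::finite \<Rightarrow> (real ^ 'x) set" where
  "column_space M = span (columns M)"

definition spherical_embedding :: "real ^ 'x ^ 'x::finite \<Rightarrow> 'x \<Rightarrow> real ^ 'x" where
  "spherical_embedding M x = sqrt (real CARD('x) / real (rank M)) *\<^sub>R (M *v axis x 1)"

text \<open>
  Identification of a subspace with another Euclidean space. The values of the map outside the
  subspace are immaterial, since every linear map on a subspace extends to the whole space.
\<close>

definition isometric_identification ::
  "'a::euclidean_space set \<Rightarrow> ('a \<Rightarrow> 'b::euclidean_space) \<Rightarrow> bool" where
  "isometric_identification V T \<longleftrightarrow>
     linear T \<and> (\<forall>u\<in>V. norm (T u) = norm u) \<and> T ` V = UNIV"

lemma isometric_identification_exists: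
  fixes M :: "real ^ 'x ^ 'x::finite"
  assumes "rank M = 3"
  shows "\<exists>T :: real ^ 'x \<Rightarrow> real ^ 3. isometric_identification (column_space M) T"
proof -
  have "dim (column_space M) = dim (UNIV :: (real ^ 3) set)"
    using assms by (simp add: column_space_def column_rank_def)
  then obtain T :: "real ^ 'x \<Rightarrow> real ^ 3" where
    "linear T" "T ` column_space M = UNIV" "\<And>u. u \<in> column_space M \<Longrightarrow> norm (T u) = norm u"
    using isometries_subspaces[of "column_space M" "UNIV :: (real ^ 3) set"]
    by (metis column_space_def subspace_UNIV subspace_span)
  then show ?thesis
    unfolding isometric_identification_def by blast
qed

section \<open>Convex polyhedra\<close>

definition polyhedron_vertices :: "(real ^ 3) set \<Rightarrow> (real ^ 3) set" where
  "polyhedron_vertices P = {v. v extreme_point_of P}"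

text \<open>
  \<open>regular_polygon n \<rho> F\<close>: \<open>F\<close> is the (filled) regular \<open>n\<close>-gon with circumradius \<open>\<rho>\<close> in some plane;
  hence two regular polygons are congruent iff they agree in \<open>n\<close> and \<open>\<rho>\<close>.
\<close>

definition regular_polygon :: "nat \<Rightarrow> real \<Rightarrow> (real ^ 3) set \<Rightarrow> bool" where
  "regular_polygon n \<rho> F \<longleftrightarrow>
     n \<ge> 3 \<and> \<rho> > 0 \<and>
     (\<exists>c u w. norm u = 1 \<and> norm w = 1 \<and> u \<bullet> w = 0 \<and>
        F = convex hull ((\<lambda>k. c + (\<rho> * cos (2 * pi * real k / real n)) *\<^sub>R u
                                + (\<rho> * sin (2 * pi * real k / real n)) *\<^sub>R w) ` {..<n}))"

definition convex_polyhedron :: "(real ^ 3) set \<Rightarrow> bool" where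
  "convex_polyhedron P \<longleftrightarrow> polytope P \<and> aff_dim P = 3"

text \<open>Platonic solids in terms of their Schlaefli symbol: congruent regular \<open>p\<close>-gons, \<open>q\<close> at each vertex.\<close>

definition regular_polyhedron :: "nat \<Rightarrow> nat \<Rightarrow> (real ^ 3) set \<Rightarrow> bool" where
  "regular_polyhedron p q P \<longleftrightarrow>
     convex_polyhedron P \<and>
     (\<exists>\<rho>. \<forall>F. F facet_of P \<longrightarrow> regular_polygon p \<rho> F) \<and>
     (\<forall>v \<in> polyhedron_vertices P. card {F. F facet_of P \<and> v \<in> F} = q)"

abbreviation "regular_tetrahedron \<equiv> regular_polyhedron 3 3"
abbreviation "regular_octahedron \<equiv> regular_polyhedron 3 4"
abbreviation "regular_cube \<equiv> regular_polyhedron 4 3"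
abbreviation "regular_icosahedron \<equiv> regular_polyhedron 3 5"
abbreviation "regular_dodecahedron \<equiv> regular_polyhedron 5 3"

definition vertex_transitive :: "(real ^ 3) set \<Rightarrow> bool" where
  "vertex_transitive P \<longleftrightarrow>
     (\<forall>u \<in> polyhedron_vertices P. \<forall>v \<in> polyhedron_vertices P.
        \<exists>g. (\<forall>x y. dist (g x) (g y) = dist x y) \<and> g ` P = P \<and> g u = v)"

text \<open>
  \<open>ns\<close> lists the numbers of sides of all the faces at \<open>v\<close> in cyclic order, i.e. such that
  consecutive faces meet in an edge through \<open>v\<close>.
\<close>

definition vertex_configuration :: "(real ^ 3) set \<Rightarrow> real ^ 3 \<Rightarrow> nat list \<Rightarrow> bool" where
  "vertex_configuration P v ns \<longleftrightarrow>
     (\<exists>Fs. length Fs = length ns \<and> distinct Fs \<and> set Fs = {F. F facet_of P \<and> v \<in> F} \<and>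
        (\<forall>i < length ns.
           (\<exists>\<rho>. regular_polygon (ns ! i) \<rho> (Fs ! i)) \<and>
           Fs ! i \<inter> Fs ! (Suc i mod length ns) edge_of P \<and>
           v \<in> Fs ! i \<inter> Fs ! (Suc i mod length ns)))"

text \<open>
  A vertex-transitive convex polyhedron all of whose faces are regular polygons is a Platonic or
  Archimedean solid, a prism or an antiprism. For the two configurations below it is Archimedean,
  as the others have configurations \<open>[p, \<dots>, p]\<close>, \<open>[4, 4, n]\<close> and \<open>[3, 3, 3, n]\<close>.
\<close>

definition uniform_polyhedron :: "nat list \<Rightarrow> (real ^ 3) set \<Rightarrow> bool" where
  "uniform_polyhedron ns P \<longleftrightarrow>
     convex_polyhedron P \<and> vertex_transitive P \<and>
     (\<forall>F. F facet_of P \<longrightarrow> (\<exists>n \<rho>. regular_polygon n \<rho> F)) \<and>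
     (\<forall>v \<in> polyhedron_vertices P. vertex_configuration P v ns)"

abbreviation "cuboctahedron \<equiv> uniform_polyhedron [3, 4, 3, 4]"
abbreviation "icosidodecahedron \<equiv> uniform_polyhedron [3, 5, 3, 5]"

end

theory Submission
  imports Defs
begin

text \<open>
  The embedded points form a finite set \<open>X\<close> on the unit sphere. Since they come from an idempotent
  of rank 3 they are centred and form a tight frame (\<open>embedding_tight\<close>), and the Q-polynomial
  property says that for every inner product \<open>t\<close> the operator that sums a function over the points
  at inner product \<open>t\<close> maps \<open>p (y \<bullet> z)\<close> to \<open>q (x \<bullet> z)\<close>, where the polynomial \<open>q\<close> has at most the degree
  of \<open>p\<close> (\<open>embedding_adjacency_polynomial\<close>). Everything is deduced from the cases of degree
  at most 3 of this statement, which are strong restrictions on the surroundings of a point.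

  Degree 2 provides a constant \<open>\<beta>\<close> with \<open>(\<Sum>y\<in>X. (y \<bullet> x)\<^sup>2 * (y \<bullet> a)) = \<beta> * card X / 3 * (x \<bullet> a)\<close> for
  \<open>x\<close> in \<open>X\<close>. The third moments of \<open>X\<close> are the structure constants of a commutative algebra on
  the 3-space in which, by this identity, the points of \<open>X\<close> are multiples of idempotents. If \<open>\<beta> \<noteq> 0\<close>, the
  trace form of that algebra forces all inner products of distinct points to be \<open>-1/3\<close>
  (\<open>simplex_if_cubic_nonzero\<close>), so \<open>X\<close> is a regular tetrahedron.

  Now let \<open>\<beta> = 0\<close> and let \<open>\<alpha>\<close> be the largest inner product of two distinct points. The directions
  in which the nearest neighbours of a point lie have vanishing first and second moments, and they are
  more than 60 degrees apart; this makes them a regular triangle, square or pentagon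
  (\<open>tangent_regular_polygon\<close>). Hence the set of neighbours of a point is invariant under a rotation
  about that point.
  With four or five neighbours, two rotations produce points that are too close together unless
  consecutive neighbours are themselves at inner product \<open>\<alpha>\<close> (\<open>consecutive_neighbours_adjacent\<close>).
  This determines \<open>\<alpha>\<close>, and \<open>X\<close> is a regular octahedron or icosahedron.
  With three neighbours there are two cases. If a nonzero traceless quadratic
  form vanishes on \<open>X\<close>, then \<open>\<alpha> = 1/3\<close> (\<open>cube_distance_if_quadric\<close>) and \<open>X\<close> is a cube. Otherwise the fourth moments
  of \<open>X\<close> are those of the sphere, and degree 3 leaves only \<open>\<alpha>\<^sup>2 = 1/3\<close>, for which there are again
  two points that are too close together (\<open>alpha_valency_3\<close>). So of the seven polyhedra the first four
  are the ones that arise.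

  The faces are found from inner products. A facet of the convex hull of \<open>X\<close> is cut out by a supporting
  plane, and in the three solids with triangular faces the points of \<open>X\<close> in such a plane are mutually
  nearest neighbours (\<open>triangular_facet_iff\<close>); the cube is treated in coordinates.
\<close>

section \<open>Orthonormal frames of three-dimensional space\<close>

definition orthonormal_frame :: "real ^ 3 \<Rightarrow> real ^ 3 \<Rightarrow> real ^ 3 \<Rightarrow> bool" where
  "orthonormal_frame x u w \<longleftrightarrow>
     x \<bullet> x = 1 \<and> u \<bullet> u = 1 \<and> w \<bullet> w = 1 \<and> x \<bullet> u = 0 \<and> x \<bullet> w = 0 \<and> u \<bullet> w = 0"

lemma frame_expansion:
  assumes "orthonormal_frame x u w"
  shows "v = (v \<bullet> x) *\<^sub>R x + (v \<bullet> u) *\<^sub>R u + (v \<bullet> w) *\<^sub>R w"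
proof -
  let ?B = "{x, u, w}"
  note F = assms[unfolded orthonormal_frame_def]
  have ne: "x \<noteq> u" "x \<noteq> w" "u \<noteq> w" "0 \<notin> ?B"
    using F by auto
  have "pairwise orthogonal ?B"
    using F by (auto simp: pairwise_def orthogonal_def inner_commute)
  then have "independent ?B"
    using ne(4) by (rule pairwise_orthogonal_independent)
  moreover have "card ?B = DIM(real ^ 3)"
    using ne by simp
  ultimately have "UNIV \<subseteq> span ?B"
    by (intro card_ge_dim_independent) auto
  then have span: "r \<in> span ?B" for r :: "real ^ 3"
    by blast
  define r where "r = v - ((v \<bullet> x) *\<^sub>R x + (v \<bullet> u) *\<^sub>R u + (v \<bullet> w) *\<^sub>R w)"
  have "orthogonal r b" if "b \<in> ?B" for b
    using that F by (auto simp: r_def orthogonal_def inner_diff_left inner_diff_right inner_add_left inner_add_right inner_commute)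
  then have "orthogonal r r"
    by (rule orthogonal_to_span[OF span])
  then show ?thesis
    by (simp add: orthogonal_def r_def)
qed

lemma frame_inner:
  assumes "orthonormal_frame x u w"
  shows "v \<bullet> v' = (v \<bullet> x) * (v' \<bullet> x) + (v \<bullet> u) * (v' \<bullet> u) + (v \<bullet> w) * (v' \<bullet> w)"
proof -
  have "v \<bullet> v' = ((v \<bullet> x) *\<^sub>R x + (v \<bullet> u) *\<^sub>R u + (v \<bullet> w) *\<^sub>R w) \<bullet> v'"
    by (rule arg_cong[where f = "\<lambda>r. r \<bullet> v'", OF frame_expansion[OF assms]])
  then show ?thesis
    by (simp only: inner_add_left inner_scaleR_left inner_commute[of x v'] inner_commute[of u v'] inner_commute[of w v'])
qed

lemma cross_frame:
  assumes "x \<bullet> x = 1" "u \<bullet> u = 1" "x \<bullet> u = 0"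
  shows "orthonormal_frame x u (cross3 x u)"
  using assms by (simp add: orthonormal_frame_def dot_cross_self dot_cross inner_commute)

lemma cross_frame_exists:
  assumes "x \<bullet> x = 1"
  obtains u where "orthonormal_frame x u (cross3 x u)"
proof -
  obtain v :: "real ^ 3" where v: "v \<noteq> 0" "orthogonal x v"
    using orthogonal_to_vector_exists[of x] by auto
  then have "orthonormal_frame x (sgn v) (cross3 x (sgn v))"
    using assms by (intro cross_frame) (auto simp: sgn_div_norm orthogonal_def dot_square_norm power2_eq_square)
  then show thesis by (rule that)
qed


section \<open>Tight point sets on the sphere\<close>

text \<open>
  The last two conditions express that the Gram matrix of \<open>X\<close> annihilates the constants and is
  \<open>card X / 3\<close> times a projection.
\<close>

locale tight_sphere_set =
  fixes X :: "(real ^ 3) set"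
  assumes finite_X: "finite X"
    and nonempty: "X \<noteq> {}"
    and unit: "x \<in> X \<Longrightarrow> x \<bullet> x = 1"
    and centred: "(\<Sum>x\<in>X. x) = 0"
    and tight: "(\<Sum>x\<in>X. (x \<bullet> a) *\<^sub>R x) = (real (card X) / 3) *\<^sub>R a"
begin

lemma card_pos: "real (card X) > 0"
  using finite_X nonempty by (simp add: card_gt_0_iff)

lemma sum_inner: "(\<Sum>x\<in>X. x \<bullet> a) = 0"
  using arg_cong[OF centred, of "\<lambda>v. v \<bullet> a"] by (simp add: inner_sum_left)

lemma sum_inner_mult: "(\<Sum>x\<in>X. (x \<bullet> a) * (x \<bullet> b)) = real (card X) / 3 * (a \<bullet> b)"
proof -
  have "(\<Sum>x\<in>X. (x \<bullet> a) * (x \<bullet> b)) = (\<Sum>x\<in>X. (x \<bullet> a) *\<^sub>R x) \<bullet> b"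
    by (simp add: inner_sum_left)
  then show ?thesis
    by (simp add: tight)
qed

lemma sum_inner_square: "(\<Sum>x\<in>X. (x \<bullet> a)\<^sup>2) = real (card X) / 3 * (a \<bullet> a)"
  using sum_inner_mult[of a a] by (simp add: power2_eq_square)

text \<open>
  A tight frame spans the space. This is how vector identities are verified below: it suffices
  to test them against the points of \<open>X\<close>, where the polynomial identities of the scheme apply.
\<close>

lemma orthogonal_all_zero:
  assumes "\<And>x. x \<in> X \<Longrightarrow> x \<bullet> a = 0"
  shows "a = 0"
proof -
  have "(\<Sum>x\<in>X. (x \<bullet> a) *\<^sub>R x) = 0"
    using assms by (intro sum.neutral) simp
  then show ?thesis
    using tight[of a] card_pos by simp
qed

lemma inner_le_1: "x \<in> X \<Longrightarrow> y \<in> X \<Longrightarrow> x \<bullet> y \<le> 1"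
  using norm_cauchy_schwarz[of x y] unit by (simp add: norm_eq_sqrt_inner)

lemma inner_ge_minus_1: "x \<in> X \<Longrightarrow> y \<in> X \<Longrightarrow> - 1 \<le> x \<bullet> y"
  using norm_cauchy_schwarz[of "- x" y] unit by (simp add: norm_eq_sqrt_inner)

lemma inner_1_imp_eq:
  assumes "x \<bullet> x = 1" "y \<bullet> y = 1" "x \<bullet> y = 1"
  shows "x = y"
proof -
  have "(x - y) \<bullet> (x - y) = 0"
    using assms by (simp add: inner_diff_left inner_diff_right inner_commute)
  then show ?thesis by simp
qed

end

text \<open>
  For an embedded scheme this holds because squaring the entries of \<open>E 1\<close> gives an element of
  the Bose-Mesner algebra, whose product with \<open>E 1\<close> is a multiple of \<open>E 1\<close>.
\<close>

locale cubic_tight_set = tight_sphere_set +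
  fixes \<beta> :: real
  assumes cubic_on_X: "x \<in> X \<Longrightarrow> a \<in> X \<Longrightarrow>
    (\<Sum>y\<in>X. (y \<bullet> x)\<^sup>2 * (y \<bullet> a)) = \<beta> * (real (card X) / 3) * (x \<bullet> a)"
begin

lemma cubic:
  assumes x: "x \<in> X"
  shows "(\<Sum>y\<in>X. (y \<bullet> x)\<^sup>2 * (y \<bullet> a)) = \<beta> * (real (card X) / 3) * (x \<bullet> a)"
proof -
  define w where "w = (\<Sum>y\<in>X. (y \<bullet> x)\<^sup>2 *\<^sub>R y) - (\<beta> * (real (card X) / 3)) *\<^sub>R x"
  have w: "b \<bullet> w = (\<Sum>y\<in>X. (y \<bullet> x)\<^sup>2 * (y \<bullet> b)) - \<beta> * (real (card X) / 3) * (x \<bullet> b)" for b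
    by (simp add: w_def inner_diff_right inner_sum_right inner_commute)
  have "w = 0"
    by (rule orthogonal_all_zero) (simp add: w cubic_on_X x)
  with w[of a] show ?thesis by simp
qed

definition third_moment :: "real ^ 3 \<Rightarrow> real ^ 3 \<Rightarrow> real ^ 3 \<Rightarrow> real" where
  "third_moment a b c = (\<Sum>y\<in>X. (y \<bullet> a) * (y \<bullet> b) * (y \<bullet> c))"

text \<open>
  The left-hand side is the trace of the product of the multiplications by \<open>a\<close> and by \<open>b\<close> in
  the algebra whose structure constants are the third moments. It involves the vectors of \<open>X\<close> only
  through \<open>(\<Sum>y\<in>X. \<Sum>z\<in>X. (y \<bullet> a) * (z \<bullet> b) * (y \<bullet> z)\<^sup>2)\<close>, which the cubic identity evaluates.
\<close>

lemma third_moment_contraction: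
  assumes F: "orthonormal_frame x u w"
  shows "third_moment a x x * third_moment b x x + third_moment a u u * third_moment b u u
       + third_moment a w w * third_moment b w w
       + 2 * (third_moment a x u * third_moment b x u + third_moment a x w * third_moment b x w
              + third_moment a u w * third_moment b u w)
       = \<beta> * (real (card X) / 3)\<^sup>2 * (a \<bullet> b)" (is "?L = ?R")
proof -
  have "?L = (\<Sum>y\<in>X. \<Sum>z\<in>X. (y \<bullet> a) * (z \<bullet> b) * (y \<bullet> z)\<^sup>2)"
  proof -
    have "(y \<bullet> a) * (z \<bullet> b) * (y \<bullet> z)\<^sup>2 =
        ((y \<bullet> a) * (y \<bullet> x) * (y \<bullet> x)) * ((z \<bullet> b) * (z \<bullet> x) * (z \<bullet> x))
      + ((y \<bullet> a) * (y \<bullet> u) * (y \<bullet> u)) * ((z \<bullet> b) * (z \<bullet> u) * (z \<bullet> u))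
      + ((y \<bullet> a) * (y \<bullet> w) * (y \<bullet> w)) * ((z \<bullet> b) * (z \<bullet> w) * (z \<bullet> w))
      + 2 * (((y \<bullet> a) * (y \<bullet> x) * (y \<bullet> u)) * ((z \<bullet> b) * (z \<bullet> x) * (z \<bullet> u))
           + ((y \<bullet> a) * (y \<bullet> x) * (y \<bullet> w)) * ((z \<bullet> b) * (z \<bullet> x) * (z \<bullet> w))
           + ((y \<bullet> a) * (y \<bullet> u) * (y \<bullet> w)) * ((z \<bullet> b) * (z \<bullet> u) * (z \<bullet> w)))" for y z
      unfolding frame_inner[OF F, of y z] by (simp add: algebra_simps power2_eq_square)
    then show ?thesis
      unfolding third_moment_def sum_product
      by (simp only: sum.distrib sum_distrib_left distrib_left)
  qed
  also have "\<dots> = (\<Sum>z\<in>X. (z \<bullet> b) * (\<Sum>y\<in>X. (y \<bullet> z)\<^sup>2 * (y \<bullet> a)))"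
    by (subst sum.swap) (simp add: sum_distrib_left mult_ac)
  also have "\<dots> = (\<Sum>z\<in>X. \<beta> * (real (card X) / 3) * ((z \<bullet> b) * (z \<bullet> a)))"
    by (intro sum.cong refl) (simp add: cubic)
  also have "\<dots> = ?R"
    by (simp only: sum_distrib_left[symmetric] sum_inner_mult) (simp add: power2_eq_square inner_commute)
  finally show ?thesis .
qed

lemma third_moment_trace:
  assumes F: "orthonormal_frame x u w"
  shows "third_moment a x x + third_moment a u u + third_moment a w w = 0"
proof -
  have "third_moment a x x + third_moment a u u + third_moment a w w
      = (\<Sum>y\<in>X. (y \<bullet> a) * (y \<bullet> y))"
  proof -
    have "(y \<bullet> a) * (y \<bullet> y) = (y \<bullet> a) * (y \<bullet> x) * (y \<bullet> x) + (y \<bullet> a) * (y \<bullet> u) * (y \<bullet> u)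
        + (y \<bullet> a) * (y \<bullet> w) * (y \<bullet> w)" for y
      unfolding frame_inner[OF F, of y y] by (simp add: algebra_simps)
    then show ?thesis
      unfolding third_moment_def by (simp add: sum.distrib)
  qed
  also have "\<dots> = (\<Sum>y\<in>X. y \<bullet> a)"
    by (simp add: unit)
  finally show ?thesis
    by (simp add: sum_inner)
qed

lemma third_moment_X: "x \<in> X \<Longrightarrow> third_moment x x a = \<beta> * (real (card X) / 3) * (x \<bullet> a)"
  using cubic[of x a] by (simp add: third_moment_def power2_eq_square)

text \<open>
  In a frame \<open>(x, u, w)\<close> the trace form has equal values at \<open>(u, u)\<close> and \<open>(w, w)\<close> and vanishes at
  \<open>(u, w)\<close>. As the third moments \<open>a\<close> and \<open>b\<close> have the nonzero sum \<open>- \<beta> * g\<close>, this forces multiplication by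
  \<open>x\<close> to be a scalar on the plane orthogonal to \<open>x\<close>. The third moments \<open>third_moment x y y\<close> can then be
  computed in two ways, which leaves a quadratic equation for \<open>x \<bullet> y\<close> with roots 1 and \<open>-1/3\<close>.
\<close>

lemma simplex_if_cubic_nonzero:
  assumes "\<beta> \<noteq> 0" and x: "x \<in> X" and y: "y \<in> X" and ne: "x \<noteq> y"
  shows "x \<bullet> y = - 1 / 3"
proof -
  define g where "g = real (card X) / 3"
  have g: "g > 0" using card_pos by (simp add: g_def)
  obtain u where F: "orthonormal_frame x u (cross3 x u)"
    using cross_frame_exists[OF unit[OF x]] by blast
  define w where "w = cross3 x u"
  note F = F[folded w_def]
  note F' = F[unfolded orthonormal_frame_def]
  define a b q r s where "a = third_moment x u u" and "b = third_moment x w w"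
    and "q = third_moment x u w" and "r = third_moment u u u" and "s = third_moment w w w"
  have "third_moment u x x = third_moment x x u" "third_moment w x x = third_moment x x w"
    by (simp_all add: third_moment_def mult_ac)
  then have xx: "third_moment x x x = \<beta> * g" "third_moment u x x = 0" "third_moment w x x = 0"
    using third_moment_X[OF x] F' by (simp_all add: g_def)
  have tr: "\<beta> * g + a + b = 0"
    using third_moment_trace[OF F, of x] xx by (simp add: a_def b_def)
\<comment> \<open>The cubic form restricted to the plane is harmonic, so two numbers describe it.\<close>
  have uww: "third_moment u w w = - r" and wuu: "third_moment w u u = - s"
    using third_moment_trace[OF F, of u] third_moment_trace[OF F, of w] xx
    by (simp_all add: r_def s_def)
  have comm: "third_moment u x u = a" "third_moment u x w = q" "third_moment w x u = q"
    "third_moment w x w = b" "third_moment u u w = - s" "third_moment w u w = - r"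
    using uww wuu unfolding a_def b_def q_def by (simp_all add: third_moment_def mult_ac)
  note T = third_moment_contraction[OF F, folded g_def]
  have uu: "2 * r\<^sup>2 + 2 * (a\<^sup>2 + q\<^sup>2 + s\<^sup>2) = \<beta> * g\<^sup>2"
    using T[of u u] F' by (simp add: xx uww wuu comm flip: r_def) (simp add: power2_eq_square)
  have ww: "2 * s\<^sup>2 + 2 * (q\<^sup>2 + b\<^sup>2 + r\<^sup>2) = \<beta> * g\<^sup>2"
    using T[of w w] F' by (simp add: xx uww wuu comm flip: s_def) (simp add: power2_eq_square)
  have "2 * (a * q) + 2 * (q * b) = 0"
    using T[of u w] F' by (simp add: xx uww wuu comm flip: r_def s_def)
  then have uw: "q * (a + b) = 0" by algebra
  have "a + b \<noteq> 0"
  proof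
    assume "a + b = 0"
    then have "\<beta> * g = 0" using tr by linarith
    then show False using g \<open>\<beta> \<noteq> 0\<close> by simp
  qed
  then have "q = 0" using uw by simp
  have "(a - b) * (a + b) = 0"
    using uu ww by algebra
  then have "a = b" using \<open>a + b \<noteq> 0\<close> by simp
  then have ab: "a = - (\<beta> * g) / 2" "b = - (\<beta> * g) / 2" using tr by auto
  define t where "t = x \<bullet> y"
  have "third_moment x y y = (\<beta> * g) * (y \<bullet> x)\<^sup>2 + a * (y \<bullet> u)\<^sup>2 + b * (y \<bullet> w)\<^sup>2"
  proof -
    have "third_moment x y y = (\<Sum>z\<in>X. (z \<bullet> x) * (z \<bullet> x) * (z \<bullet> x) * (y \<bullet> x)\<^sup>2
       + (z \<bullet> x) * (z \<bullet> u) * (z \<bullet> u) * (y \<bullet> u)\<^sup>2 + (z \<bullet> x) * (z \<bullet> w) * (z \<bullet> w) * (y \<bullet> w)\<^sup>2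
       + (z \<bullet> x) * (z \<bullet> x) * (z \<bullet> u) * (2 * (y \<bullet> x) * (y \<bullet> u))
       + (z \<bullet> x) * (z \<bullet> x) * (z \<bullet> w) * (2 * (y \<bullet> x) * (y \<bullet> w))
       + (z \<bullet> x) * (z \<bullet> u) * (z \<bullet> w) * (2 * (y \<bullet> u) * (y \<bullet> w)))"
      unfolding third_moment_def
    proof (intro sum.cong refl)
      fix z
      show "(z \<bullet> x) * (z \<bullet> y) * (z \<bullet> y) = (z \<bullet> x) * (z \<bullet> x) * (z \<bullet> x) * (y \<bullet> x)\<^sup>2
       + (z \<bullet> x) * (z \<bullet> u) * (z \<bullet> u) * (y \<bullet> u)\<^sup>2 + (z \<bullet> x) * (z \<bullet> w) * (z \<bullet> w) * (y \<bullet> w)\<^sup>2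
       + (z \<bullet> x) * (z \<bullet> x) * (z \<bullet> u) * (2 * (y \<bullet> x) * (y \<bullet> u))
       + (z \<bullet> x) * (z \<bullet> x) * (z \<bullet> w) * (2 * (y \<bullet> x) * (y \<bullet> w))
       + (z \<bullet> x) * (z \<bullet> u) * (z \<bullet> w) * (2 * (y \<bullet> u) * (y \<bullet> w))"
        unfolding frame_inner[OF F, of z y] by (simp add: algebra_simps power2_eq_square)
    qed
    also have "\<dots> = third_moment x x x * (y \<bullet> x)\<^sup>2 + third_moment x u u * (y \<bullet> u)\<^sup>2
       + third_moment x w w * (y \<bullet> w)\<^sup>2 + third_moment x x u * (2 * (y \<bullet> x) * (y \<bullet> u))
       + third_moment x x w * (2 * (y \<bullet> x) * (y \<bullet> w)) + third_moment x u w * (2 * (y \<bullet> u) * (y \<bullet> w))"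
      unfolding third_moment_def sum.distrib sum_distrib_right ..
    finally show ?thesis
      using \<open>q = 0\<close> third_moment_X[OF x] F' by (simp add: a_def b_def q_def g_def xx)
  qed
  moreover have "third_moment x y y = \<beta> * g * t"
    using third_moment_X[OF y, of x] by (simp add: third_moment_def g_def t_def mult_ac inner_commute)
  moreover have "(y \<bullet> u)\<^sup>2 + (y \<bullet> w)\<^sup>2 = 1 - t\<^sup>2"
    using frame_inner[OF F, of y y] unit[OF y] by (simp add: t_def power2_eq_square inner_commute)
  ultimately have "\<beta> * g * t = \<beta> * g * t\<^sup>2 - \<beta> * g / 2 * (1 - t\<^sup>2)"
    unfolding ab t_def inner_commute[of y x] by algebra
  then have "(\<beta> * g) * ((t - 1) * (3 * t + 1)) = 0"
    by algebra
  then have "t = 1 \<or> t = - 1 / 3"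
    using g \<open>\<beta> \<noteq> 0\<close> by auto
  then show ?thesis
    using inner_1_imp_eq[of x y] unit x y ne by (auto simp: t_def)
qed

end

section \<open>Points on a circle with vanishing first and second moments\<close>

text \<open>
  The hypothesis \<open>sep\<close> says that two points are more than 60 degrees apart. Measured from one of
  them, the arguments of the others lie in four sectors of 60 degrees, each of which contains
  at most one.
\<close>

lemma card_le_5_if_separated:
  fixes Z :: "complex set"
  assumes fin: "finite Z" and r: "r > 0" and circle: "\<And>z. z \<in> Z \<Longrightarrow> cmod z = r"
    and sep: "\<And>z w. z \<in> Z \<Longrightarrow> w \<in> Z \<Longrightarrow> z \<noteq> w \<Longrightarrow> Re (z * cnj w) < r\<^sup>2 / 2"
  shows "card Z \<le> 5"
proof (rule ccontr)
  assume "\<not> card Z \<le> 5"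
  then have c: "card Z \<ge> 6" by simp
  then have "Z \<noteq> {}" by auto
  then obtain z0 where z0: "z0 \<in> Z" by blast
  have "z0 \<noteq> 0" using circle[OF z0] r by auto
  define A where "A z = Arg2pi (z / z0)" for z
  have polar: "z = z0 * cis (A z)" if "z \<in> Z" for z
  proof -
    have "z / z0 = of_real (cmod (z / z0)) * cis (A z)"
      using Arg2pi_eq[of "z / z0"] by (simp add: A_def cis_conv_exp)
    also have "cmod (z / z0) = 1"
      using circle[OF that] circle[OF z0] r by (simp add: norm_divide)
    finally show ?thesis
      using \<open>z0 \<noteq> 0\<close> by (simp add: field_simps)
  qed
  have re: "Re (z * cnj w) = r\<^sup>2 * cos (A z - A w)" if "z \<in> Z" "w \<in> Z" for z w
  proof -
    have "z * cnj w = (z0 * cnj z0) * (cis (A z) * cnj (cis (A w)))"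
      by (subst polar[OF that(1)], subst polar[OF that(2)]) (simp add: mult_ac)
    also have "z0 * cnj z0 = of_real (r\<^sup>2)"
      using circle[OF z0] by (simp add: complex_norm_square[symmetric])
    also have "cis (A z) * cnj (cis (A w)) = cis (A z - A w)"
      by (simp add: cis_cnj cis_mult)
    finally show ?thesis by simp
  qed
  have cos_lt: "cos (A z - A w) < 1 / 2" if "z \<in> Z" "w \<in> Z" "z \<noteq> w" for z w
  proof -
    have "r\<^sup>2 * cos (A z - A w) < r\<^sup>2 * (1 / 2)"
      using sep[OF that] unfolding re[OF that(1,2)] by simp
    then show ?thesis using r by (simp only: mult_less_cancel_left_pos zero_less_power)
  qed
  have A0: "A z0 = 0" using \<open>z0 \<noteq> 0\<close> by (simp add: A_def Arg2pi_eq_0)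
  have cos_ge: "cos t \<ge> 1 / 2" if "\<bar>t\<bar> \<le> pi / 3" for t
  proof -
    have "cos (pi / 3) \<le> cos \<bar>t\<bar>"
      using that pi_gt_zero by (intro cos_monotone_0_pi_le) auto
    then show ?thesis by (simp add: cos_60)
  qed
  have range: "pi / 3 < A z \<and> A z < 5 * pi / 3" if "z \<in> Z - {z0}" for z
  proof -
    have lt: "cos (A z) < 1 / 2" using cos_lt[of z z0] that z0 A0 by auto
    have b: "0 \<le> A z" "A z < 2 * pi" by (simp_all add: A_def Arg2pi_ge_0 Arg2pi_lt_2pi)
    have "pi / 3 < A z"
      using cos_ge[of "A z"] lt b by force
    moreover have "A z < 5 * pi / 3"
    proof (rule ccontr)
      assume "\<not> ?thesis"
      then have "cos (2 * pi - A z) \<ge> 1 / 2" using b by (intro cos_ge) (auto simp: abs_if)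
      then show False using lt by (simp add: cos_2pi_minus)
    qed
    ultimately show ?thesis ..
  qed
  define s where "s z = \<lfloor>A z / (pi / 3)\<rfloor>" for z
  have "s ` (Z - {z0}) \<subseteq> {1..4}"
  proof
    fix i assume "i \<in> s ` (Z - {z0})"
    then obtain z where z: "z \<in> Z - {z0}" "i = \<lfloor>A z / (pi / 3)\<rfloor>" by (auto simp: s_def)
    have "1 \<le> A z / (pi / 3)" "A z / (pi / 3) < 5"
      using range[OF z(1)] pi_gt_zero by (simp_all add: field_simps)
    then have "1 \<le> i" "i < 5" unfolding z(2) by linarith+
    then show "i \<in> {1..4}" by simp
  qed
  then have "card (s ` (Z - {z0})) \<le> card {1..4::int}"
    by (intro card_mono) auto
  moreover have "card (Z - {z0}) \<ge> 5" using c fin z0 by simp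
  ultimately have "\<not> inj_on s (Z - {z0})"
    by (auto dest: card_image)
  then obtain z w where zw: "z \<in> Z" "w \<in> Z" "z \<noteq> w" "s z = s w"
    by (auto simp: inj_on_def)
  have "\<bar>A z / (pi / 3) - A w / (pi / 3)\<bar> < 1"
    using zw(4) unfolding s_def by linarith
  then have "\<bar>A z - A w\<bar> < pi / 3"
    by (simp add: field_simps abs_if split: if_splits)
  then show False
    using cos_ge[of "A z - A w"] cos_lt[OF zw(1-3)] by auto
qed

text \<open>
  By Newton's identities the first two elementary symmetric functions of the points vanish. On a
  circle about 0 complex conjugation is inversion up to scaling, so it exchanges the elementary
  symmetric functions from the two ends, and for at most five points all of them vanish except the
  last. Thus the points are the roots of \<open>z ^ card Z = c\<close>.
\<close>

lemma regular_polygon_if_moments_vanish: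
  fixes Z :: "complex set"
  assumes fin: "finite Z" and ne: "Z \<noteq> {}" and r: "r > 0"
    and circle: "\<And>z. z \<in> Z \<Longrightarrow> cmod z = r"
    and sep: "\<And>z w. z \<in> Z \<Longrightarrow> w \<in> Z \<Longrightarrow> z \<noteq> w \<Longrightarrow> Re (z * cnj w) < r\<^sup>2 / 2"
    and m1: "(\<Sum>z\<in>Z. z) = 0" and m2: "(\<Sum>z\<in>Z. z\<^sup>2) = 0"
  shows "card Z \<in> {3, 4, 5} \<and> (\<exists>c. c \<noteq> 0 \<and> Z = {z. z ^ card Z = c})"
proof -
  have nz: "z \<noteq> 0" if "z \<in> Z" for z using circle[OF that] r by auto
  have cnj: "z * cnj z = of_real (r\<^sup>2)" if "z \<in> Z" for z
    using circle[OF that] by (simp add: complex_norm_square[symmetric])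
  have m1': "(\<Sum>z\<in>Z. cnj z) = 0" using arg_cong[OF m1, of cnj] by simp
  have m2': "(\<Sum>z\<in>Z. (cnj z)\<^sup>2) = 0" using arg_cong[OF m2, of cnj] by simp
  have r2: "(of_real (r\<^sup>2) :: complex) \<noteq> 0" using r by simp
  have conclude: "\<exists>c. c \<noteq> 0 \<and> Z = {z. z ^ card Z = c}"
    if "\<And>z. z \<in> Z \<Longrightarrow> z ^ card Z = c" for c
  proof -
    have pos: "card Z > 0" using fin ne by (simp add: card_gt_0_iff)
    obtain z where "z \<in> Z" using ne by blast
    then have c0: "c \<noteq> 0" using that[of z] nz[of z] pos by auto
    have "Z \<subseteq> {z. z ^ card Z = c}" using that by blast
    moreover have card: "card {z::complex. z ^ card Z = c} = card Z"
      using card_nth_roots[OF c0 pos] .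
    moreover have "finite {z::complex. z ^ card Z = c}"
      using card pos by (metis card.infinite less_irrefl)
    ultimately have "Z = {z. z ^ card Z = c}"
      by (intro card_subset_eq) auto
    with c0 show ?thesis by blast
  qed
  have "card Z \<le> 5" using card_le_5_if_separated[OF fin r circle sep] .
  moreover have "card Z > 0" using fin ne by (simp add: card_gt_0_iff)
  ultimately consider "card Z = 1" | "card Z = 2" | "card Z = 3" | "card Z = 4" | "card Z = 5"
    by linarith
  then show ?thesis
  proof cases
    case 1
    then obtain a where "Z = {a}" by (auto simp: card_1_singleton_iff)
    then show ?thesis using m1 nz by auto
  next
    case 2
    then obtain a b where Z: "Z = {a, b}" "a \<noteq> b" by (auto simp: card_2_iff)
    have "a + b = 0" "a\<^sup>2 + b\<^sup>2 = 0" using m1 m2 Z by auto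
    then have "2 * a\<^sup>2 = 0" by algebra
    then show ?thesis using nz[of a] Z by auto
  next
    case 3
    then obtain a b c where Z: "Z = {a, b, c}" and d: "a \<noteq> b" "b \<noteq> c" "a \<noteq> c"
      by (auto simp: card_3_iff)
    have p: "a + b + c = 0" "a\<^sup>2 + b\<^sup>2 + c\<^sup>2 = 0" using m1 m2 Z d by (auto simp: add.assoc)
    have "a * b + a * c + b * c = ((a + b + c)\<^sup>2 - (a\<^sup>2 + b\<^sup>2 + c\<^sup>2)) / 2"
      by (simp add: power2_eq_square algebra_simps)
    then have e2: "a * b + a * c + b * c = 0" by (simp only: p) simp
    have "z ^ 3 = a * b * c" if "z \<in> Z" for z
    proof -
      have "(z - a) * (z - b) * (z - c) = 0" using that Z by auto
      moreover have "(z - a) * (z - b) * (z - c)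
          = z ^ 3 - (a + b + c) * z\<^sup>2 + (a * b + a * c + b * c) * z - a * b * c"
        by (simp add: power2_eq_square power3_eq_cube algebra_simps)
      ultimately show ?thesis using p e2 by simp
    qed
    then show ?thesis using 3 conclude[of "a * b * c"] by auto
  next
    case 4
    then obtain a Y where Y: "Z = insert a Y" "a \<notin> Y" "card Y = 3"
      by (metis card_Suc_eq numeral_eq_Suc pred_numeral_simps(2) semiring_norm(26) semiring_norm(27))
    then obtain b c d where Z: "Z = {a, b, c, d}" and di: "a \<noteq> b" "a \<noteq> c" "a \<noteq> d" "b \<noteq> c" "b \<noteq> d" "c \<noteq> d"
      by (auto simp: card_3_iff)
    have p: "a + b + c + d = 0" "a\<^sup>2 + b\<^sup>2 + c\<^sup>2 + d\<^sup>2 = 0" "cnj a + cnj b + cnj c + cnj d = 0"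
      using m1 m2 m1' Z di by (auto simp: add.assoc)
    have "a * b + a * c + a * d + b * c + b * d + c * d
        = ((a + b + c + d)\<^sup>2 - (a\<^sup>2 + b\<^sup>2 + c\<^sup>2 + d\<^sup>2)) / 2"
      by (simp add: power2_eq_square algebra_simps)
    then have e2: "a * b + a * c + a * d + b * c + b * d + c * d = 0" by (simp only: p) simp
    have cn: "cnj z = of_real (r\<^sup>2) / z" if "z \<in> Z" for z
      using cnj[OF that] nz[OF that] by (simp add: field_simps)
    have "of_real (r\<^sup>2) * (b * c * d + a * c * d + a * b * d + a * b * c)
        = a * b * c * d * (cnj a + cnj b + cnj c + cnj d)"
      using nz Z by (simp add: cn field_simps)
    then have e3: "b * c * d + a * c * d + a * b * d + a * b * c = 0" using p r2 by simp
    have "z ^ 4 = - (a * b * c * d)" if "z \<in> Z" for z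
    proof -
      have "(z - a) * (z - b) * (z - c) * (z - d) = 0" using that Z by auto
      moreover have "(z - a) * (z - b) * (z - c) * (z - d)
          = z ^ 4 - (a + b + c + d) * z ^ 3 + (a * b + a * c + a * d + b * c + b * d + c * d) * z\<^sup>2
            - (b * c * d + a * c * d + a * b * d + a * b * c) * z + a * b * c * d"
        by (simp add: eval_nat_numeral algebra_simps)
      ultimately show ?thesis using p e2 e3 by (simp add: eq_neg_iff_add_eq_0)
    qed
    then show ?thesis using 4 conclude[of "- (a * b * c * d)"] by auto
  next
    case 5
    then obtain a Y where Y: "Z = insert a Y" "a \<notin> Y" "card Y = 4"
      by (metis card_Suc_eq numeral_eq_Suc pred_numeral_simps(3) semiring_norm(26) semiring_norm(27))
    then obtain b W where W: "Y = insert b W" "b \<notin> W" "card W = 3"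
      by (metis card_Suc_eq numeral_eq_Suc pred_numeral_simps(2) semiring_norm(26) semiring_norm(27))
    then obtain c d e where Z: "Z = {a, b, c, d, e}"
      and di: "a \<noteq> b" "a \<noteq> c" "a \<noteq> d" "a \<noteq> e" "b \<noteq> c" "b \<noteq> d" "b \<noteq> e" "c \<noteq> d" "c \<noteq> e" "d \<noteq> e"
      using Y by (auto simp: card_3_iff)
    have p: "a + b + c + d + e = 0" "a\<^sup>2 + b\<^sup>2 + c\<^sup>2 + d\<^sup>2 + e\<^sup>2 = 0"
      "cnj a + cnj b + cnj c + cnj d + cnj e = 0"
      "(cnj a)\<^sup>2 + (cnj b)\<^sup>2 + (cnj c)\<^sup>2 + (cnj d)\<^sup>2 + (cnj e)\<^sup>2 = 0"
      using m1 m2 m1' m2' Z di by (auto simp: add.assoc)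
    have two: "a * b + a * c + a * d + a * e + b * c + b * d + b * e + c * d + c * e + d * e
        = ((a + b + c + d + e)\<^sup>2 - (a\<^sup>2 + b\<^sup>2 + c\<^sup>2 + d\<^sup>2 + e\<^sup>2)) / 2" for a b c d e :: complex
      by (simp add: power2_eq_square algebra_simps)
    have e2: "a * b + a * c + a * d + a * e + b * c + b * d + b * e + c * d + c * e + d * e = 0"
      using two[of a b c d e] by (simp only: p) simp
    define a' b' c' d' e' where "a' = cnj a" "b' = cnj b" "c' = cnj c" "d' = cnj d" "e' = cnj e"
    note cn = this
    have e2': "a' * b' + a' * c' + a' * d' + a' * e' + b' * c' + b' * d' + b' * e' + c' * d' + c' * e' + d' * e' = 0"
      using two[of a' b' c' d' e'] by (simp only: p cn) simp
    define s :: complex where "s = of_real (r\<^sup>2)"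
    have ss: "a * a' = s" "b * b' = s" "c * c' = s" "d * d' = s" "e * e' = s" "s \<noteq> 0"
      using cnj Z r2 by (auto simp: cn s_def)
    have inv: "a' = s / a" "b' = s / b" "c' = s / c" "d' = s / d" "e' = s / e"
      and nz': "a \<noteq> 0" "b \<noteq> 0" "c \<noteq> 0" "d \<noteq> 0" "e \<noteq> 0"
      using ss(1-5) nz Z by (auto simp: field_simps)
    have "s * (b * c * d * e + a * c * d * e + a * b * d * e + a * b * c * e + a * b * c * d)
        = a * b * c * d * e * (a' + b' + c' + d' + e')"
      unfolding inv using nz' by (simp add: divide_simps) (simp add: algebra_simps power2_eq_square)?
    then have e4: "b * c * d * e + a * c * d * e + a * b * d * e + a * b * c * e + a * b * c * d = 0"
      using p ss(6) by (simp add: cn)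
    have "s\<^sup>2 * (a * b * c + a * b * d + a * b * e + a * c * d + a * c * e + a * d * e
          + b * c * d + b * c * e + b * d * e + c * d * e)
        = a * b * c * d * e * (a' * b' + a' * c' + a' * d' + a' * e' + b' * c' + b' * d' + b' * e' + c' * d' + c' * e' + d' * e')"
      unfolding inv using nz' by (simp add: divide_simps) (simp add: algebra_simps power2_eq_square)?
    then have e3: "a * b * c + a * b * d + a * b * e + a * c * d + a * c * e + a * d * e
          + b * c * d + b * c * e + b * d * e + c * d * e = 0"
      using e2' ss(6) by simp
    have "z ^ 5 = a * b * c * d * e" if "z \<in> Z" for z
    proof -
      have "(z - a) * (z - b) * (z - c) * (z - d) * (z - e) = 0" using that Z by auto
      moreover have "(z - a) * (z - b) * (z - c) * (z - d) * (z - e)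
          = z ^ 5 - (a + b + c + d + e) * z ^ 4
            + (a * b + a * c + a * d + a * e + b * c + b * d + b * e + c * d + c * e + d * e) * z ^ 3
            - (a * b * c + a * b * d + a * b * e + a * c * d + a * c * e + a * d * e
               + b * c * d + b * c * e + b * d * e + c * d * e) * z\<^sup>2
            + (b * c * d * e + a * c * d * e + a * b * d * e + a * b * c * e + a * b * c * d) * z
            - a * b * c * d * e"
        by (simp add: eval_nat_numeral algebra_simps)
      ultimately show ?thesis using p e2 e3 e4 by simp
    qed
    then show ?thesis using 5 conclude[of "a * b * c * d * e"] by auto
  qed
qed

section \<open>Nearest neighbours\<close>

text \<open>
  The inner product on matrices is the Frobenius product, so \<open>A \<bullet> outer v\<close> is the value of
  the quadratic form of \<open>A\<close> at \<open>v\<close> (\<open>inner_outer\<close>).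
\<close>

definition outer :: "real ^ 3 \<Rightarrow> real ^ 3 ^ 3" where
  "outer v = (\<chi> i j. v $ i * v $ j)"

lemma inner_matrix: "A \<bullet> B = (\<Sum>i\<in>UNIV. \<Sum>j\<in>UNIV. A $ i $ j * B $ i $ j)" for A B :: "real ^ 3 ^ 3"
  by (simp add: inner_vec_def)

lemma outer_inner_outer: "outer v \<bullet> outer w = (v \<bullet> w)\<^sup>2"
  by (simp add: inner_matrix outer_def inner_vec_def power2_eq_square sum_3 algebra_simps)

lemma mat_1_inner_outer: "mat 1 \<bullet> outer v = v \<bullet> v"
  by (simp add: inner_matrix outer_def inner_vec_def mat_def sum_3)

lemma inner_outer: "A \<bullet> outer v = v \<bullet> (A *v v)"
  by (simp add: inner_matrix outer_def inner_vec_def matrix_vector_mult_def sum_3 algebra_simps)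

lemma (in tight_sphere_set) sum_outer: "(\<Sum>x\<in>X. outer x) = (real (card X) / 3) *\<^sub>R mat 1"
proof -
  have "(\<Sum>x\<in>X. outer x) $ i $ j = ((real (card X) / 3) *\<^sub>R mat 1) $ i $ j" for i j
    using sum_inner_mult[of "axis i 1" "axis j 1"]
    by (simp add: outer_def inner_axis mat_def) (simp add: axis_def)
  then show ?thesis by (simp add: vec_eq_iff)
qed

lemma poly_eq_sum_coeff:
  fixes q :: "real poly"
  assumes "degree q \<le> n"
  shows "poly q t = (\<Sum>i\<le>n. coeff q i * t ^ i)"
proof -
  have "(\<Sum>i\<le>degree q. coeff q i * t ^ i) = (\<Sum>i\<le>n. coeff q i * t ^ i)"
    using assms by (intro sum.mono_neutral_left) (auto simp: coeff_eq_0)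
  then show ?thesis by (simp add: poly_altdef)
qed

locale balanced_scheme_set = cubic_tight_set X 0 for X +
  assumes adjacency_polynomial:
    "\<exists>q. degree q \<le> degree p \<and>
       (\<forall>x\<in>X. \<forall>z\<in>X. (\<Sum>y\<in>{y \<in> X. x \<bullet> y = t}. poly p (y \<bullet> z)) = poly q (x \<bullet> z))"

lemma (in balanced_scheme_set) sum_inner_cubed: "x \<in> X \<Longrightarrow> (\<Sum>z\<in>X. (z \<bullet> x) ^ 3) = 0"
  using cubic[of x x] by (simp add: power3_eq_cube power2_eq_square)

text \<open>
  The parameter \<open>\<alpha>\<close> is the cosine of the minimal angular distance in \<open>X\<close>.
\<close>

locale nearest_neighbours = balanced_scheme_set +
  fixes \<alpha> :: real
  assumes inner_le_alpha: "x \<in> X \<Longrightarrow> y \<in> X \<Longrightarrow> x \<noteq> y \<Longrightarrow> x \<bullet> y \<le> \<alpha>"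
    and alpha_attained: "\<exists>x\<in>X. \<exists>y\<in>X. x \<noteq> y \<and> x \<bullet> y = \<alpha>"
begin

lemma alpha_less_1: "\<alpha> < 1"
proof -
  obtain x y where xy: "x \<in> X" "y \<in> X" "x \<noteq> y" "x \<bullet> y = \<alpha>"
    using alpha_attained by blast
  then show ?thesis
    using inner_le_1[of x y] inner_1_imp_eq[of x y] unit by fastforce
qed

text \<open>
  The function \<open>t * (1 - t\<^sup>2)\<close> has sum 0 over the inner products with a fixed point, since the first and the
  third moments vanish. If all inner products with other points were negative, all of them would have
  to be \<open>-1\<close>, but two antipodal points do not span the space.
\<close>

lemma alpha_nonneg: "\<alpha> \<ge> 0"
proof (rule ccontr)
  assume neg: "\<not> ?thesis"
  obtain x where x: "x \<in> X" using nonempty by blast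
  define f where "f y = - ((y \<bullet> x) * (1 - (y \<bullet> x)\<^sup>2))" for y
  have "f y = - (y \<bullet> x) + (y \<bullet> x) ^ 3" for y
    by (simp add: f_def power2_eq_square power3_eq_cube algebra_simps)
  then have "sum f X = 0"
    using sum_inner[of x] sum_inner_cubed[OF x] by (simp add: sum_subtractf)
  have lt: "y \<bullet> x < 0" if "y \<in> X" "y \<noteq> x" for y
    using inner_le_alpha[OF that(1) x that(2)] neg by simp
  have sq: "(y \<bullet> x)\<^sup>2 \<le> 1" if "y \<in> X" for y
    using inner_le_1[OF that x] inner_ge_minus_1[OF that x] by (simp add: abs_square_le_1)
  have nonneg: "f y \<ge> 0" if "y \<in> X" for y
  proof (cases "y = x")
    case True
    then show ?thesis by (simp add: f_def unit x)
  next
    case False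
    then show ?thesis
      unfolding f_def using lt[OF that] sq[OF that]
      by (simp add: mult_le_0_iff)
  qed
  have anti: "y = - x" if "y \<in> X" "y \<noteq> x" for y
  proof -
    have "f y = 0"
      using sum_nonneg_eq_0_iff[of X f] finite_X nonneg \<open>sum f X = 0\<close> that(1) by auto
    then have "(y \<bullet> x)\<^sup>2 = 1"
      using lt[OF that] by (simp add: f_def)
    then have "y \<bullet> x = - 1"
      using lt[OF that] by (simp add: power2_eq_1_iff)
    then have "- y = x"
      using inner_1_imp_eq[of "- y" x] unit x that by simp
    then show ?thesis by auto
  qed
  obtain u where "orthonormal_frame x u (cross3 x u)"
    using cross_frame_exists[OF unit[OF x]] by blast
  then have u: "x \<bullet> u = 0" "u \<bullet> u = 1" by (auto simp: orthonormal_frame_def)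
  have "y \<bullet> u = 0" if "y \<in> X" for y
    using anti[OF that] u by (cases "y = x") auto
  then have "u = 0" by (rule orthogonal_all_zero)
  then show False using u by simp
qed

definition \<sigma>2 :: real where "\<sigma>2 = 1 - \<alpha>\<^sup>2"

lemma sigma2_pos: "\<sigma>2 > 0"
  using alpha_less_1 alpha_nonneg by (simp add: \<sigma>2_def abs_square_less_1)

definition nbr :: "real ^ 3 \<Rightarrow> (real ^ 3) set" where
  "nbr x = {y \<in> X. x \<bullet> y = \<alpha>}"

lemma finite_nbr: "finite (nbr x)"
  using finite_X by (simp add: nbr_def)

lemma nbrD: "y \<in> nbr x \<Longrightarrow> y \<in> X" "y \<in> nbr x \<Longrightarrow> x \<bullet> y = \<alpha>" "y \<in> nbr x \<Longrightarrow> y \<bullet> x = \<alpha>"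
  by (simp_all add: nbr_def inner_commute)

lemma nbr_sym: "x \<in> X \<Longrightarrow> y \<in> nbr x \<Longrightarrow> x \<in> nbr y"
  by (simp add: nbr_def inner_commute)

text \<open>
  All points of \<open>X\<close> have equally many nearest neighbours (\<open>card_nbr\<close>), so the choice of the point does
  not matter.
\<close>

definition valency :: nat where
  "valency = card (nbr (SOME x. x \<in> X))"

lemma card_nbr:
  assumes x: "x \<in> X"
  shows "card (nbr x) = valency"
proof -
  obtain q where q: "degree q \<le> 0" "\<And>x z. x \<in> X \<Longrightarrow> z \<in> X \<Longrightarrow>
      (\<Sum>y\<in>nbr x. poly 1 (y \<bullet> z)) = poly q (x \<bullet> z)"
    using adjacency_polynomial[of 1 \<alpha>] by (auto simp: nbr_def)
  obtain c where "q = [:c:]" using q(1) by (meson degree_eq_zeroE le_zero_eq)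
  then have "real (card (nbr z)) = c" if "z \<in> X" for z
    using q(2)[OF that that] by simp
  moreover have "(SOME x. x \<in> X) \<in> X" using x by (rule someI)
  ultimately have "real (card (nbr x)) = real valency" using x by (simp add: valency_def)
  then show ?thesis by simp
qed

lemma nbr_nonempty: "x \<in> X \<Longrightarrow> nbr x \<noteq> {}"
proof -
  assume x: "x \<in> X"
  obtain a b where "a \<in> X" "b \<in> X" "a \<bullet> b = \<alpha>" using alpha_attained by blast
  then have "b \<in> nbr a" by (simp add: nbr_def)
  then have "card (nbr a) > 0" using finite_nbr[of a] by (auto simp: card_gt_0_iff)
  then have "card (nbr x) > 0" using card_nbr \<open>a \<in> X\<close> x by simp
  then show ?thesis by auto
qed

lemma valency_pos: "valency > 0"
proof -
  obtain x where x: "x \<in> X" using nonempty by blast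
  then show ?thesis
    using card_nbr[OF x] nbr_nonempty[OF x] finite_nbr[of x] by (metis card_gt_0_iff)
qed

text \<open>
  The identity of degree 1, tested against the points of \<open>X\<close>; its constant term vanishes because
  \<open>X\<close> is centred.
\<close>

lemma sum_nbr:
  assumes x: "x \<in> X"
  shows "(\<Sum>y\<in>nbr x. y) = (real valency * \<alpha>) *\<^sub>R x"
proof -
  obtain q where q: "degree q \<le> degree [:0, 1::real:]" "\<And>x z. x \<in> X \<Longrightarrow> z \<in> X \<Longrightarrow>
      (\<Sum>y\<in>nbr x. poly [:0, 1:] (y \<bullet> z)) = poly q (x \<bullet> z)"
    using adjacency_polynomial[of "[:0, 1:]" \<alpha>] unfolding nbr_def by blast
  define a b where "a = coeff q 0" and "b = coeff q 1"
  have "poly q t = a + b * t" for t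
    using poly_eq_sum_coeff[of q 1 t] q(1) by (simp add: a_def b_def)
  then have lin: "(\<Sum>y\<in>nbr x. y \<bullet> z) = a + b * (x \<bullet> z)" if "z \<in> X" for z
    using q(2)[OF x that] by simp
  have "(\<Sum>z\<in>X. \<Sum>y\<in>nbr x. y \<bullet> z) = (\<Sum>y\<in>nbr x. \<Sum>z\<in>X. z \<bullet> y)"
    by (subst sum.swap) (simp add: inner_commute)
  moreover have "(\<Sum>z\<in>X. a + b * (x \<bullet> z)) = real (card X) * a + b * (\<Sum>z\<in>X. z \<bullet> x)"
    by (simp add: sum.distrib sum_distrib_left inner_commute)
  ultimately have "a = 0"
    using lin card_pos by (simp add: sum_inner)
  define w where "w = (\<Sum>y\<in>nbr x. y) - b *\<^sub>R x"
  have "z \<bullet> w = 0" if "z \<in> X" for z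
    using lin[OF that] by (simp add: w_def inner_diff_right inner_sum_right \<open>a = 0\<close> inner_commute)
  then have "w = 0" by (rule orthogonal_all_zero)
  then have s: "(\<Sum>y\<in>nbr x. y) = b *\<^sub>R x" by (simp add: w_def)
  have "(\<Sum>y\<in>nbr x. x \<bullet> y) = b"
    using arg_cong[OF s, of "\<lambda>v. x \<bullet> v"] by (simp add: inner_sum_right unit x)
  moreover have "(\<Sum>y\<in>nbr x. x \<bullet> y) = real valency * \<alpha>"
    using card_nbr[OF x] by (simp add: nbrD)
  ultimately show ?thesis using s by simp
qed

text \<open>
  The identity of degree 2 gives such a formula for \<open>a\<close> in \<open>X\<close>. It extends to all \<open>a\<close> because the
  matrix \<open>W\<close> of the difference of the two quadratic forms is itself a combination of the matrices \<open>outer z\<close>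
  with \<open>z\<close> in \<open>X\<close> (for the identity matrix this is the tightness of \<open>X\<close>), to all of which it is orthogonal.
\<close>

lemma sum_nbr_square:
  assumes x: "x \<in> X"
  shows "(\<Sum>y\<in>nbr x. (y \<bullet> a)\<^sup>2) =
    real valency * (1 - \<alpha>\<^sup>2) / 2 * (a \<bullet> a) + real valency * (3 * \<alpha>\<^sup>2 - 1) / 2 * (x \<bullet> a)\<^sup>2"
proof -
  have deg: "degree [:0, 0, 1::real:] = 2" by simp
  obtain q where q: "degree q \<le> degree [:0, 0, 1::real:]" "\<And>x z. x \<in> X \<Longrightarrow> z \<in> X \<Longrightarrow>
      (\<Sum>y\<in>nbr x. poly [:0, 0, 1:] (y \<bullet> z)) = poly q (x \<bullet> z)"
    using adjacency_polynomial[of "[:0, 0, 1:]" \<alpha>] unfolding nbr_def by blast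
  define c0 c1 c2 where "c0 = coeff q 0" and "c1 = coeff q 1" and "c2 = coeff q 2"
  have "poly q t = c0 + c1 * t + c2 * t\<^sup>2" for t
    using poly_eq_sum_coeff[of q 2 t] q(1) by (simp add: c0_def c1_def c2_def numeral_2_eq_2)
  then have quad: "(\<Sum>y\<in>nbr x. (y \<bullet> z)\<^sup>2) = c0 + c1 * (x \<bullet> z) + c2 * (x \<bullet> z)\<^sup>2" if "z \<in> X" for z
    using q(2)[OF x that] by (simp add: power2_eq_square)
  have "(\<Sum>z\<in>X. (\<Sum>y\<in>nbr x. (y \<bullet> z)\<^sup>2) * (x \<bullet> z)) = (\<Sum>y\<in>nbr x. \<Sum>z\<in>X. (z \<bullet> y)\<^sup>2 * (z \<bullet> x))"
    by (simp only: sum_distrib_right, subst sum.swap) (simp add: inner_commute)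
  also have "\<dots> = 0"
    by (rule sum.neutral, rule ballI) (simp add: cubic nbrD)
  finally have "(\<Sum>z\<in>X. (c0 + c1 * (x \<bullet> z) + c2 * (x \<bullet> z)\<^sup>2) * (x \<bullet> z)) = 0"
    using quad by simp
  also have "(\<Sum>z\<in>X. (c0 + c1 * (x \<bullet> z) + c2 * (x \<bullet> z)\<^sup>2) * (x \<bullet> z))
      = c0 * (\<Sum>z\<in>X. z \<bullet> x) + c1 * (\<Sum>z\<in>X. (z \<bullet> x)\<^sup>2) + c2 * (\<Sum>z\<in>X. (z \<bullet> x) ^ 3)"
    by (simp add: sum_distrib_left sum.distrib[symmetric] inner_commute algebra_simps
        power2_eq_square power3_eq_cube)
\<comment> \<open>The linear coefficient is removed by pairing with the function \<open>z \<bullet> x\<close>: odd moments vanish.\<close>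
  also have "\<dots> = c1 * (real (card X) / 3)"
    by (simp add: sum_inner sum_inner_square sum_inner_cubed x unit)
  finally have "c1 = 0" using card_pos by simp
  define W where "W = (\<Sum>y\<in>nbr x. outer y) - c0 *\<^sub>R mat 1 - c2 *\<^sub>R outer x"
  have W: "W \<bullet> outer v = (\<Sum>y\<in>nbr x. (y \<bullet> v)\<^sup>2) - c0 * (v \<bullet> v) - c2 * (x \<bullet> v)\<^sup>2" for v
    by (simp add: W_def inner_diff_left inner_sum_left outer_inner_outer mat_1_inner_outer)
  have WX: "W \<bullet> outer z = 0" if "z \<in> X" for z
    using quad[OF that] \<open>c1 = 0\<close> by (simp add: W unit that)
  have "(real (card X) / 3) * (W \<bullet> mat 1) = (\<Sum>z\<in>X. W \<bullet> outer z)"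
    by (simp only: inner_sum_right[symmetric] sum_outer inner_scaleR_right)
  then have Wm: "W \<bullet> mat 1 = 0" using WX card_pos by simp
\<comment> \<open>\<open>W\<close> is orthogonal to each of the matrices of which it is composed.\<close>
  have "W \<bullet> W = (\<Sum>y\<in>nbr x. W \<bullet> outer y) - c0 * (W \<bullet> mat 1) - c2 * (W \<bullet> outer x)"
    by (subst (2) W_def) (simp add: inner_diff_right inner_sum_right)
  also have "\<dots> = 0"
    using Wm WX x by (simp add: nbrD)
  finally have "W = 0" by simp
  then have all: "(\<Sum>y\<in>nbr x. (y \<bullet> v)\<^sup>2) = c0 * (v \<bullet> v) + c2 * (x \<bullet> v)\<^sup>2" for v
    using W[of v] by simp
  obtain u where F: "orthonormal_frame x u (cross3 x u)"
    using cross_frame_exists[OF unit[OF x]] by blast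
  define w where "w = cross3 x u"
  note F = F[folded w_def]
  note F' = F[unfolded orthonormal_frame_def]
  have "real valency = (\<Sum>y\<in>nbr x. (y \<bullet> x)\<^sup>2 + (y \<bullet> u)\<^sup>2 + (y \<bullet> w)\<^sup>2)"
  proof -
    have "(y \<bullet> x)\<^sup>2 + (y \<bullet> u)\<^sup>2 + (y \<bullet> w)\<^sup>2 = 1" if "y \<in> nbr x" for y
      using frame_inner[OF F, of y y] unit[OF nbrD(1)[OF that]] by (simp add: power2_eq_square)
    then show ?thesis using card_nbr[OF x] by simp
  qed
  also have "\<dots> = 3 * c0 + c2"
    using all F' by (simp add: sum.distrib)
  finally have 1: "real valency = 3 * c0 + c2" .
  have "(\<Sum>y\<in>nbr x. (y \<bullet> x)\<^sup>2) = real valency * \<alpha>\<^sup>2"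
    using card_nbr[OF x] by (simp add: nbrD)
  then have 2: "real valency * \<alpha>\<^sup>2 = c0 + c2"
    using all[of x] by (simp add: unit x)
  have c: "c0 = real valency * (1 - \<alpha>\<^sup>2) / 2" "c2 = real valency * (3 * \<alpha>\<^sup>2 - 1) / 2"
    using 1 2 by (simp_all add: algebra_simps)
  show ?thesis using all[of a] unfolding c .
qed

end

section \<open>Rotations\<close>

text \<open>
  Rodrigues' formula: for a unit vector \<open>x\<close> this is the rotation about \<open>x\<close> by the angle \<open>\<theta>\<close>.
\<close>

definition rotation :: "real \<Rightarrow> real ^ 3 \<Rightarrow> real ^ 3 \<Rightarrow> real ^ 3" where
  "rotation \<theta> x y = ((1 - cos \<theta>) * (x \<bullet> y)) *\<^sub>R x + cos \<theta> *\<^sub>R y + sin \<theta> *\<^sub>R cross3 x y"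

lemma rotation_coordinates:
  assumes "orthonormal_frame x u (cross3 x u)"
  shows "rotation \<theta> x y \<bullet> x = y \<bullet> x"
    and "rotation \<theta> x y \<bullet> u = cos \<theta> * (y \<bullet> u) - sin \<theta> * (y \<bullet> cross3 x u)"
    and "rotation \<theta> x y \<bullet> cross3 x u = cos \<theta> * (y \<bullet> cross3 x u) + sin \<theta> * (y \<bullet> u)"
proof -
  note F = assms[unfolded orthonormal_frame_def]
  have "cross3 x y \<bullet> u = cross3 u x \<bullet> y" by (metis cross_triple)
  then have 1: "cross3 x y \<bullet> u = - (y \<bullet> cross3 x u)"
    by (simp add: cross_skew[of u x] inner_commute)
  have 2: "cross3 x y \<bullet> cross3 x u = y \<bullet> u"
    using F by (simp add: dot_cross)
  have 3: "cross3 x y \<bullet> x = 0" by (simp add: dot_cross_self inner_commute)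
  show "rotation \<theta> x y \<bullet> x = y \<bullet> x"
    using F 3 by (simp add: rotation_def inner_add_left inner_commute algebra_simps)
  show "rotation \<theta> x y \<bullet> u = cos \<theta> * (y \<bullet> u) - sin \<theta> * (y \<bullet> cross3 x u)"
    using F 1 by (simp add: rotation_def inner_add_left)
  show "rotation \<theta> x y \<bullet> cross3 x u = cos \<theta> * (y \<bullet> cross3 x u) + sin \<theta> * (y \<bullet> u)"
    using F 2 by (simp add: rotation_def inner_add_left)
qed

lemma eq_if_coordinates_eq:
  assumes F: "orthonormal_frame x u w" and "y \<bullet> x = z \<bullet> x"
    and "Complex (y \<bullet> u) (y \<bullet> w) = Complex (z \<bullet> u) (z \<bullet> w)"
  shows "y = z"
proof -
  have "y = (y \<bullet> x) *\<^sub>R x + (y \<bullet> u) *\<^sub>R u + (y \<bullet> w) *\<^sub>R w" by (rule frame_expansion[OF F])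
  also have "\<dots> = (z \<bullet> x) *\<^sub>R x + (z \<bullet> u) *\<^sub>R u + (z \<bullet> w) *\<^sub>R w" using assms(2,3) by simp
  also have "\<dots> = z" by (rule frame_expansion[OF F, symmetric])
  finally show ?thesis .
qed

context nearest_neighbours
begin

text \<open>
  The first and second moments of the tangent directions, read as complex numbers in the plane orthogonal
  to \<open>x\<close>, vanish by \<open>sum_nbr\<close> and \<open>sum_nbr_square\<close>. Two of them are more than 60 degrees apart because the
  neighbours are no closer to each other than to \<open>x\<close>.
\<close>

lemma tangent_regular_polygon:
  assumes x: "x \<in> X" and F: "orthonormal_frame x u w"
  defines "tc \<equiv> \<lambda>y. Complex (y \<bullet> u) (y \<bullet> w)"
  shows "valency \<in> {3, 4, 5}" and "inj_on tc (nbr x)"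
    and "\<exists>c. c \<noteq> 0 \<and> tc ` nbr x = {z. z ^ valency = c}"
proof -
  note F' = F[unfolded orthonormal_frame_def]
  have inner: "y \<bullet> z = \<alpha>\<^sup>2 + Re (tc y * cnj (tc z))" if "y \<in> nbr x" "z \<in> nbr x" for y z
    using frame_inner[OF F, of y z] nbrD(3)[OF that(1)] nbrD(3)[OF that(2)]
    by (simp add: tc_def power2_eq_square)
  have eq: "y = z" if "y \<in> nbr x" "z \<in> nbr x" "tc y = tc z" for y z
    using eq_if_coordinates_eq[OF F] nbrD(3)[OF that(1)] nbrD(3)[OF that(2)] that(3)
    unfolding tc_def by metis
  show inj: "inj_on tc (nbr x)"
    using eq by (auto simp: inj_on_def)
  let ?Z = "tc ` nbr x"
  have circle: "cmod (tc y) = sqrt \<sigma>2" if "y \<in> nbr x" for y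
  proof -
    have "(cmod (tc y))\<^sup>2 = \<sigma>2"
      using inner[OF that that] unit[OF nbrD(1)[OF that]] by (simp add: \<sigma>2_def cmod_def power2_eq_square)
    then show ?thesis using real_sqrt_unique[of "cmod (tc y)" \<sigma>2] by simp
  qed
  have sep: "Re (tc y * cnj (tc z)) < (sqrt \<sigma>2)\<^sup>2 / 2" if "y \<in> nbr x" "z \<in> nbr x" "tc y \<noteq> tc z" for y z
  proof -
    have "y \<noteq> z" using that(3) by auto
    then have "Re (tc y * cnj (tc z)) \<le> \<alpha> - \<alpha>\<^sup>2"
      using inner[OF that(1,2)] inner_le_alpha[of y z] that(1,2) by (simp add: nbrD)
    also have "\<dots> < \<sigma>2 / 2"
    proof -
      have "0 < (1 - \<alpha>)\<^sup>2" using alpha_less_1 by simp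
      then show ?thesis by (simp add: \<sigma>2_def power2_eq_square algebra_simps)
    qed
    finally show ?thesis using sigma2_pos by simp
  qed
  have m1: "(\<Sum>z\<in>?Z. z) = 0"
  proof -
    have "(\<Sum>y\<in>nbr x. y \<bullet> a) = 0" if "x \<bullet> a = 0" for a
      using arg_cong[OF sum_nbr[OF x], of "\<lambda>v. v \<bullet> a"] that by (simp add: inner_sum_left)
    then have "(\<Sum>y\<in>nbr x. tc y) = 0"
      using F' by (simp add: complex_eq_iff tc_def)
    then show ?thesis by (simp add: sum.reindex[OF inj])
  qed
  have m2: "(\<Sum>z\<in>?Z. z\<^sup>2) = 0"
  proof -
    let ?k = "real valency * (1 - \<alpha>\<^sup>2) / 2"
    have uu: "(\<Sum>y\<in>nbr x. (y \<bullet> u)\<^sup>2) = ?k" and ww: "(\<Sum>y\<in>nbr x. (y \<bullet> w)\<^sup>2) = ?k"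
      using sum_nbr_square[OF x, of u] sum_nbr_square[OF x, of w] F' by simp_all
    have "(\<Sum>y\<in>nbr x. (y \<bullet> (u + w))\<^sup>2) = 2 * ?k"
      using sum_nbr_square[OF x, of "u + w"] F' by (simp add: inner_add_left inner_add_right inner_commute)
    moreover have "(\<Sum>y\<in>nbr x. (y \<bullet> (u + w))\<^sup>2)
        = (\<Sum>y\<in>nbr x. (y \<bullet> u)\<^sup>2) + (\<Sum>y\<in>nbr x. (y \<bullet> w)\<^sup>2) + 2 * (\<Sum>y\<in>nbr x. (y \<bullet> u) * (y \<bullet> w))"
      by (simp add: inner_add_right power2_sum sum.distrib sum_distrib_left mult.assoc)
    ultimately have uw: "(\<Sum>y\<in>nbr x. (y \<bullet> u) * (y \<bullet> w)) = 0"
      using uu ww by simp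
    have "(\<Sum>y\<in>nbr x. (tc y)\<^sup>2) = 0"
      using uu ww uw
      by (simp add: complex_eq_iff tc_def power2_eq_square sum_subtractf sum.distrib mult.commute
          flip: sum_distrib_left)
    then show ?thesis by (simp add: sum.reindex[OF inj])
  qed
  have card: "card ?Z = valency" using card_image[OF inj] card_nbr[OF x] by simp
  have "card ?Z \<in> {3, 4, 5} \<and> (\<exists>c. c \<noteq> 0 \<and> ?Z = {z. z ^ card ?Z = c})"
    using finite_nbr nbr_nonempty[OF x] sigma2_pos circle sep m1 m2
    by (intro regular_polygon_if_moments_vanish[of _ "sqrt \<sigma>2"]) auto
  then show "valency \<in> {3, 4, 5}" "\<exists>c. c \<noteq> 0 \<and> ?Z = {z. z ^ valency = c}"
    unfolding card by auto
qed

lemma valency_cases: "valency \<in> {3, 4, 5}"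
proof -
  obtain x where x: "x \<in> X" using nonempty by blast
  obtain u where F: "orthonormal_frame x u (cross3 x u)"
    using cross_frame_exists[OF unit[OF x]] by blast
  show ?thesis by (rule tangent_regular_polygon(1)[OF x F])
qed

lemma tc_rotation:
  assumes F: "orthonormal_frame x u (cross3 x u)"
  shows "Complex (rotation \<theta> x y \<bullet> u) (rotation \<theta> x y \<bullet> cross3 x u)
    = Complex (y \<bullet> u) (y \<bullet> cross3 x u) * cis \<theta>"
  by (simp add: complex_eq_iff rotation_coordinates[OF F] algebra_simps)

text \<open>
  The set of roots of \<open>z ^ valency = c\<close> is invariant under multiplication by roots of unity.
\<close>

lemma rotation_nbr:
  assumes x: "x \<in> X" and y: "y \<in> nbr x"
  shows "rotation (2 * pi * of_int j / real valency) x y \<in> nbr x"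
proof -
  let ?\<theta> = "2 * pi * of_int j / real valency"
  obtain u where F: "orthonormal_frame x u (cross3 x u)"
    using cross_frame_exists[OF unit[OF x]] by blast
  let ?tc = "\<lambda>y. Complex (y \<bullet> u) (y \<bullet> cross3 x u)"
  obtain c where c: "?tc ` nbr x = {z. z ^ valency = c}"
    using tangent_regular_polygon(3)[OF x F] by blast
  have "cis ?\<theta> ^ valency = cis (2 * pi * of_int j)"
    using Complex.DeMoivre[of ?\<theta> valency] valency_pos by simp
  also have "\<dots> = 1" by (rule cis_multiple_2pi) simp
  finally have "(?tc y * cis ?\<theta>) ^ valency = ?tc y ^ valency"
    by (simp add: power_mult_distrib)
  moreover have "?tc y ^ valency = c" using c y by auto
  ultimately have "?tc (rotation ?\<theta> x y) \<in> ?tc ` nbr x"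
    unfolding c tc_rotation[OF F] by simp
  then obtain z where z: "z \<in> nbr x" "?tc (rotation ?\<theta> x y) = ?tc z" by auto
  have "rotation ?\<theta> x y = z"
    using eq_if_coordinates_eq[OF F _ z(2)] rotation_coordinates(1)[OF F, of ?\<theta> y]
      nbrD(3)[OF y] nbrD(3)[OF z(1)] by simp
  then show ?thesis using z(1) by simp
qed

lemma nbr_is_rotation:
  assumes x: "x \<in> X" and y: "y \<in> nbr x" and z: "z \<in> nbr x"
  obtains j where "j < valency" "z = rotation (2 * pi * real j / real valency) x y"
proof -
  obtain u where F: "orthonormal_frame x u (cross3 x u)"
    using cross_frame_exists[OF unit[OF x]] by blast
  let ?tc = "\<lambda>y. Complex (y \<bullet> u) (y \<bullet> cross3 x u)"
  obtain c where c: "c \<noteq> 0" "?tc ` nbr x = {z. z ^ valency = c}"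
    using tangent_regular_polygon(3)[OF x F] by blast
  have yz: "?tc y ^ valency = c" "?tc z ^ valency = c" using c y z by auto
  then have "?tc y \<noteq> 0" using c(1) valency_pos by auto
  have "(?tc z / ?tc y) ^ valency = 1"
    using yz c(1) by (simp add: power_divide)
  then have "?tc z / ?tc y \<in> (\<lambda>j. cis (2 * pi * real j / real valency)) ` {..<valency}"
    using bij_betw_imp_surj_on[OF Complex.bij_betw_roots_unity[OF valency_pos]] by blast
  then obtain j where j: "j < valency" "cis (2 * pi * real j / real valency) = ?tc z / ?tc y"
    by auto
  have "?tc z = ?tc (rotation (2 * pi * real j / real valency) x y)"
    unfolding tc_rotation[OF F] j(2) using \<open>?tc y \<noteq> 0\<close> by simp
  then have "z = rotation (2 * pi * real j / real valency) x y"
    using nbrD(3)[OF y] nbrD(3)[OF z] rotation_coordinates(1)[OF F]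
    by (intro eq_if_coordinates_eq[OF F]) auto
  then show thesis using that j(1) by blast
qed

lemma rotation_adjacent:
  assumes y: "y \<in> nbr x"
  shows "rotation \<theta> x y = (\<alpha> * (1 - cos \<theta>)) *\<^sub>R x + cos \<theta> *\<^sub>R y + sin \<theta> *\<^sub>R cross3 x y"
  using nbrD(2)[OF y] by (simp add: rotation_def mult.commute)

lemma rotation_inner:
  assumes x: "x \<in> X" and y: "y \<in> nbr x"
  shows "rotation \<theta> x y \<bullet> y = \<alpha>\<^sup>2 + \<sigma>2 * cos \<theta>"
  unfolding rotation_adjacent[OF y] using unit[OF nbrD(1)[OF y]] nbrD(2)[OF y]
  by (simp add: inner_add_left dot_cross_self \<sigma>2_def power2_eq_square algebra_simps)

lemma cross_adjacent:
  assumes x: "x \<in> X" and y: "y \<in> nbr x"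
  shows "cross3 x y \<bullet> cross3 x y = \<sigma>2"
  using unit[OF x] unit[OF nbrD(1)[OF y]] nbrD(2,3)[OF y]
  by (simp add: dot_cross \<sigma>2_def power2_eq_square)

text \<open>
  Let \<open>y'\<close> be the neighbour of \<open>x\<close> next to \<open>y\<close>, and \<open>z\<close> the neighbour of \<open>y\<close> next to \<open>x\<close> on the same side.
  In the quadrilateral \<open>y', x, y, z\<close> three sides are equal and the angles at \<open>x\<close> and \<open>y\<close> are at most 90 degrees,
  so on the sphere the fourth side is shorter. Hence \<open>y' = z\<close>, so \<open>y'\<close> is a neighbour of \<open>y\<close>; the conclusion
  is this adjacency written as an equation for \<open>\<alpha>\<close>.
\<close>

lemma consecutive_neighbours_adjacent:
  assumes c: "cos (2 * pi / real valency) \<ge> 0"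
  shows "\<alpha> * (1 - cos (2 * pi / real valency)) = cos (2 * pi / real valency)"
proof -
  let ?\<theta> = "2 * pi / real valency"
  define c s where "c = cos ?\<theta>" and "s = sin ?\<theta>"
  have cs: "c\<^sup>2 + s\<^sup>2 = 1" by (simp add: c_def s_def)
  obtain x where x: "x \<in> X" using nonempty by blast
  obtain y where y: "y \<in> nbr x" using nbr_nonempty[OF x] by blast
  note yX = nbrD(1)[OF y]
  have xy: "x \<in> nbr y" using nbr_sym[OF x y] .
  define y' z where "y' = rotation ?\<theta> x y" and "z = rotation (- ?\<theta>) y x"
  have y': "y' \<in> nbr x"
    using rotation_nbr[OF x y, of 1] by (simp add: y'_def)
  have z: "z \<in> nbr y"
    using rotation_nbr[OF yX xy, of "- 1"] by (simp add: z_def)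
  define w where "w = cross3 x y"
  have y'_eq: "y' = (\<alpha> * (1 - c)) *\<^sub>R x + c *\<^sub>R y + s *\<^sub>R w"
    by (simp add: y'_def rotation_adjacent[OF y] c_def s_def w_def)
  have z_eq: "z = (\<alpha> * (1 - c)) *\<^sub>R y + c *\<^sub>R x + s *\<^sub>R w"
    using cross_skew[of y x] by (simp add: z_def rotation_adjacent[OF xy] c_def s_def w_def)
  have ip: "x \<bullet> x = 1" "y \<bullet> y = 1" "x \<bullet> y = \<alpha>" "y \<bullet> x = \<alpha>" "x \<bullet> w = 0" "y \<bullet> w = 0" "w \<bullet> x = 0" "w \<bullet> y = 0" "w \<bullet> w = \<sigma>2"
    using unit x yX nbrD[OF y] cross_adjacent[OF x y] by (simp_all add: w_def dot_cross_self inner_commute)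
  have "y' \<bullet> z = \<alpha> * ((\<alpha> * (1 - c))\<^sup>2 + c\<^sup>2) + 2 * c * (\<alpha> * (1 - c)) + s\<^sup>2 * \<sigma>2"
    unfolding y'_eq z_eq
    by (simp add: inner_add_left inner_add_right ip power2_eq_square algebra_simps)
  also have "\<dots> = \<alpha> + \<sigma>2 * ((1 - c\<^sup>2) - \<alpha> * (1 - c)\<^sup>2)"
  proof -
    have s2: "s\<^sup>2 = 1 - c\<^sup>2" using cs by simp
    show ?thesis unfolding s2 \<sigma>2_def by (simp add: power2_eq_square algebra_simps)
  qed
  also have "(1 - c\<^sup>2) - \<alpha> * (1 - c)\<^sup>2 = (1 - c) * ((1 + c) - \<alpha> * (1 - c))"
    by (simp add: power2_eq_square algebra_simps)
  finally have "y' \<bullet> z = \<alpha> + \<sigma>2 * ((1 - c) * ((1 + c) - \<alpha> * (1 - c)))" .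
  moreover have "c < 1"
  proof -
    have "2 * pi / real valency \<le> pi"
      using valency_cases by auto
    then have "cos ?\<theta> < cos 0"
      using valency_pos by (intro cos_monotone_0_pi) auto
    then show ?thesis by (simp add: c_def)
  qed
  moreover have "\<alpha> * (1 - c) < 1 + c"
  proof -
    have "\<alpha> * (1 - c) \<le> 1 * (1 - c)"
      using alpha_less_1 \<open>c < 1\<close> by (intro mult_right_mono) auto
    show ?thesis
    proof (cases "c = 0")
      case True
      then show ?thesis using alpha_less_1 by simp
    next
      case False
      then show ?thesis using \<open>\<alpha> * (1 - c) \<le> 1 * (1 - c)\<close> assms by (simp add: c_def)
    qed
  qed
  ultimately have "y' \<bullet> z > \<alpha>"
    using sigma2_pos by simp
  then have "y' = z"
    using inner_le_alpha[OF nbrD(1)[OF y'] nbrD(1)[OF z]] by force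
  then have "y' \<bullet> y = \<alpha>" using nbrD(3)[OF z] by simp
  then have "\<alpha>\<^sup>2 + \<sigma>2 * c = \<alpha>"
    using rotation_inner[OF x y, of ?\<theta>] by (simp add: y'_def c_def)
  then have "(1 - \<alpha>) * (c - \<alpha> * (1 - c)) = 0"
    by (simp add: \<sigma>2_def power2_eq_square algebra_simps)
  then show ?thesis
    using alpha_less_1 by (simp add: c_def)
qed

end

section \<open>Three nearest neighbours\<close>

lemma cos_sin_120: "cos (pi * 2 / 3) = - 1 / 2" "sin (pi * 2 / 3) = sqrt 3 / 2"
  using cos_120 sin_120 by (simp_all add: mult.commute)

lemma matrix_vector_row: "(S *v v) $ i = S $ i \<bullet> v" for S :: "real ^ 3 ^ 3"
  by (simp add: matrix_vector_mult_def inner_vec_def)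

text \<open>
  The trace and the Frobenius norm can be computed in any orthonormal frame.
\<close>

lemma frame_trace:
  assumes F: "orthonormal_frame x u w"
  shows "S \<bullet> mat 1 = S \<bullet> outer x + S \<bullet> outer u + S \<bullet> outer w"
proof -
  have e: "S $ i $ i = (S $ i \<bullet> x) * x $ i + (S $ i \<bullet> u) * u $ i + (S $ i \<bullet> w) * w $ i" for i
    using frame_inner[OF F, of "S $ i" "axis i 1"] by (simp add: inner_axis inner_commute[of "axis i 1"])
  have "S \<bullet> mat 1 = S $ 1 $ 1 + S $ 2 $ 2 + S $ 3 $ 3"
    by (simp add: inner_matrix mat_def sum_3)
  also have "\<dots> = S \<bullet> outer x + S \<bullet> outer u + S \<bullet> outer w"
    by (subst (1 2 3) e) (simp add: inner_matrix outer_def inner_vec_def sum_3 algebra_simps)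
  finally show ?thesis .
qed

lemma frame_norm:
  fixes S :: "real ^ 3 ^ 3"
  assumes F: "orthonormal_frame x u w"
  shows "S \<bullet> S = (S *v x) \<bullet> (S *v x) + (S *v u) \<bullet> (S *v u) + (S *v w) \<bullet> (S *v w)"
proof -
  have "S \<bullet> S = (\<Sum>i\<in>UNIV. S $ i \<bullet> S $ i)" by (simp add: inner_vec_def)
  also have "\<dots> = (\<Sum>i\<in>UNIV. (S $ i \<bullet> x)\<^sup>2 + (S $ i \<bullet> u)\<^sup>2 + (S $ i \<bullet> w)\<^sup>2)"
    by (intro sum.cong refl) (simp only: power2_eq_square frame_inner[OF F, symmetric])
  finally show ?thesis
    by (simp add: sum.distrib inner_vec_def[of "S *v _"] matrix_vector_row power2_eq_square)
qed

lemma (in tight_sphere_set) sum_norm_matrix: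
  fixes S :: "real ^ 3 ^ 3"
  shows "(\<Sum>x\<in>X. (S *v x) \<bullet> (S *v x)) = real (card X) / 3 * (S \<bullet> S)"
proof -
  have "(\<Sum>x\<in>X. (S *v x) \<bullet> (S *v x)) = (\<Sum>x\<in>X. \<Sum>i\<in>UNIV. (x \<bullet> S $ i)\<^sup>2)"
    by (simp add: inner_vec_def[of "S *v _"] matrix_vector_row power2_eq_square inner_commute)
  also have "\<dots> = (\<Sum>i\<in>UNIV. real (card X) / 3 * (S $ i \<bullet> S $ i))"
    by (subst sum.swap) (simp only: sum_inner_square)
  also have "\<dots> = real (card X) / 3 * (S \<bullet> S)"
    by (simp only: sum_distrib_left[symmetric] inner_vec_def[of S S])
  finally show ?thesis .
qed

context nearest_neighbours
begin

definition \<sigma> :: real where "\<sigma> = sqrt \<sigma>2"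

lemma sigma: "\<sigma> > 0" "\<sigma>\<^sup>2 = 1 - \<alpha>\<^sup>2"
  using sigma2_pos by (simp_all add: \<sigma>_def \<sigma>2_def)

lemma nbr_frame:
  assumes x: "x \<in> X" and y: "y \<in> nbr x"
  obtains u where "orthonormal_frame x u (cross3 x u)" "y = \<alpha> *\<^sub>R x + \<sigma> *\<^sub>R u"
proof -
  define u where "u = (1 / \<sigma>) *\<^sub>R (y - \<alpha> *\<^sub>R x)"
  have "(y - \<alpha> *\<^sub>R x) \<bullet> (y - \<alpha> *\<^sub>R x) = \<sigma>\<^sup>2"
    using unit[OF x] unit[OF nbrD(1)[OF y]] nbrD(2,3)[OF y]
    using sigma(2) by (simp add: inner_diff_left inner_diff_right power2_eq_square)
  then have "u \<bullet> u = 1" using sigma(1) by (simp add: u_def power2_eq_square)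
  moreover have "x \<bullet> u = 0"
    using unit[OF x] nbrD(2)[OF y] by (simp add: u_def inner_diff_right)
  ultimately have "orthonormal_frame x u (cross3 x u)" by (intro cross_frame unit[OF x])
  moreover have "y = \<alpha> *\<^sub>R x + \<sigma> *\<^sub>R u" using sigma(1) by (simp add: u_def)
  ultimately show thesis by (rule that)
qed

lemma cross_nbr: "cross3 x (\<alpha> *\<^sub>R x + \<sigma> *\<^sub>R u) = \<sigma> *\<^sub>R cross3 x u"
  by (simp add: cross_add_right cross_mult_right)

lemma three_neighbours:
  assumes v: "valency = 3" and x: "x \<in> X" and y: "y \<in> nbr x"
    and F: "orthonormal_frame x u (cross3 x u)" and yu: "y = \<alpha> *\<^sub>R x + \<sigma> *\<^sub>R u"
  defines "y2 \<equiv> \<alpha> *\<^sub>R x + (- \<sigma> / 2) *\<^sub>R u + (sqrt 3 / 2 * \<sigma>) *\<^sub>R cross3 x u"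
    and "y3 \<equiv> \<alpha> *\<^sub>R x + (- \<sigma> / 2) *\<^sub>R u - (sqrt 3 / 2 * \<sigma>) *\<^sub>R cross3 x u"
  shows "nbr x = {y, y2, y3}" "y \<noteq> y2" "y \<noteq> y3" "y2 \<noteq> y3"
proof -
  note F' = F[unfolded orthonormal_frame_def]
  have "rotation (2 * pi * of_int 1 / real valency) x y = y2"
    "rotation (2 * pi * of_int (- 1) / real valency) x y = y3"
    unfolding rotation_adjacent[OF y]
    by (simp_all add: v yu y2_def y3_def cos_sin_120 cross_nbr vec_eq_iff algebra_simps)
  then have "y2 \<in> nbr x" "y3 \<in> nbr x"
    using rotation_nbr[OF x y, of 1] rotation_nbr[OF x y, of "- 1"] by simp_all
  moreover have w: "y \<bullet> cross3 x u = 0" "y2 \<bullet> cross3 x u = sqrt 3 / 2 * \<sigma>" "y3 \<bullet> cross3 x u = - (sqrt 3 / 2 * \<sigma>)"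
    using F' by (simp_all add: yu y2_def y3_def inner_add_left inner_diff_left)
  then show ne: "y \<noteq> y2" "y \<noteq> y3" "y2 \<noteq> y3"
    using sigma(1) by auto
  ultimately have "{y, y2, y3} \<subseteq> nbr x" "card {y, y2, y3} = card (nbr x)"
    using y card_nbr[OF x] v by auto
  then show "nbr x = {y, y2, y3}"
    using card_subset_eq[OF finite_nbr, of "{y, y2, y3}" x] by simp
qed

text \<open>
  The sign \<open>s\<close> tells on which side of the great circle through \<open>x\<close> and \<open>y\<close> the point lies.
\<close>

lemma second_neighbour:
  assumes v: "valency = 3" and x: "x \<in> X" and y: "y \<in> nbr x"
    and F: "orthonormal_frame x u (cross3 x u)" and yu: "y = \<alpha> *\<^sub>R x + \<sigma> *\<^sub>R u"
    and s: "s\<^sup>2 = 1"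
  shows "(3 / 2 * \<alpha>\<^sup>2 - 1 / 2) *\<^sub>R x + (3 / 2 * \<alpha> * \<sigma>) *\<^sub>R u + (s * (sqrt 3 / 2 * \<sigma>)) *\<^sub>R cross3 x u \<in> nbr y"
    (is "?z \<in> _")
proof -
  note yX = nbrD(1)[OF y] and xy = nbr_sym[OF x y]
  have "cross3 y x = - (\<sigma> *\<^sub>R cross3 x u)"
    using cross_nbr[of x u] cross_skew[of y x] by (simp add: yu)
  then have rot: "rotation \<theta> y x = (\<alpha> * (1 - cos \<theta>)) *\<^sub>R y + cos \<theta> *\<^sub>R x - (sin \<theta> * \<sigma>) *\<^sub>R cross3 x u" for \<theta>
    by (simp add: rotation_adjacent[OF xy])
  have "s = 1 \<or> s = - 1" using s by (simp add: power2_eq_1_iff)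
  then show ?thesis
  proof
    assume "s = 1"
    have "rotation (2 * pi * of_int (- 1) / real valency) y x = ?z"
      unfolding rot
      by (simp add: v yu cos_sin_120 vec_eq_iff \<open>s = 1\<close> power2_eq_square algebra_simps)
    then show ?thesis using rotation_nbr[OF yX xy, of "- 1"] by simp
  next
    assume "s = - 1"
    have "rotation (2 * pi * of_int 1 / real valency) y x = ?z"
      unfolding rot
      by (simp add: v yu cos_sin_120 vec_eq_iff \<open>s = - 1\<close> power2_eq_square algebra_simps)
    then show ?thesis using rotation_nbr[OF yX xy, of 1] by simp
  qed
qed

text \<open>
  The hypotheses say that \<open>X\<close> lies on the cone of a nonzero traceless quadratic form \<open>S\<close>. Its values at the
  three neighbours of \<open>x\<close> express the restriction of \<open>S\<close> to the tangent plane through the vector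
  \<open>S *v x\<close>, so the norm of \<open>S\<close> is a fixed multiple of the norm of that vector. Summed over the tight frame
  \<open>X\<close>, the squared norms of the latter have mean \<open>(S \<bullet> S) / 3\<close>, which gives an equation for \<open>\<alpha>\<close>.
\<close>

lemma cube_distance_if_quadric:
  assumes v: "valency = 3" and sym: "transpose S = S" and tr: "S \<bullet> mat 1 = 0" and S0: "S \<noteq> 0"
    and quad: "\<And>x. x \<in> X \<Longrightarrow> S \<bullet> outer x = 0"
  shows "\<alpha> = 1 / 3"
proof -
  have B_sym: "v \<bullet> (S *v w) = w \<bullet> (S *v v)" for v w
    using dot_lmul_matrix[of v S w] sym by (metis inner_commute transpose_matrix_vector)
  have Q: "v \<bullet> (S *v v) = 0" if "v \<in> X" for v
    using quad[OF that] by (simp add: inner_outer)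
  have loc: "\<sigma>\<^sup>2 * (S \<bullet> S) = (2 * \<sigma>\<^sup>2 + 8 * \<alpha>\<^sup>2) * ((S *v x) \<bullet> (S *v x))" if x: "x \<in> X" for x
  proof -
    obtain y where y: "y \<in> nbr x" using nbr_nonempty[OF x] by blast
    obtain u where F: "orthonormal_frame x u (cross3 x u)" and yu: "y = \<alpha> *\<^sub>R x + \<sigma> *\<^sub>R u"
      using nbr_frame[OF x y] by blast
    define w where "w = cross3 x u"
    note nb = three_neighbours(1)[OF v x y F yu, folded w_def]
    note F = F[folded w_def]
    define a b p q where "a = x \<bullet> (S *v u)" and "b = x \<bullet> (S *v w)" and "p = u \<bullet> (S *v u)" and "q = u \<bullet> (S *v w)"
    have e: "x \<bullet> (S *v x) = 0" "u \<bullet> (S *v x) = a" "w \<bullet> (S *v x) = b" "w \<bullet> (S *v u) = q"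
      using Q[OF x] B_sym by (simp_all add: a_def b_def q_def)
    have ww: "w \<bullet> (S *v w) = - p"
      using frame_trace[OF F, of S] tr e by (simp add: inner_outer p_def)
    have form: "(\<alpha> *\<^sub>R x + c *\<^sub>R u + d *\<^sub>R w) \<bullet> (S *v (\<alpha> *\<^sub>R x + c *\<^sub>R u + d *\<^sub>R w))
        = 2 * \<alpha> * (c * a + d * b) + (c\<^sup>2 - d\<^sup>2) * p + 2 * c * d * q" for c d
      by (simp add: matrix_vector_right_distrib matrix_vector_mult_scaleR inner_add_left inner_add_right
          e ww a_def[symmetric] b_def[symmetric] p_def[symmetric] q_def[symmetric]
          power2_eq_square algebra_simps)
    have X: "\<alpha> *\<^sub>R x + \<sigma> *\<^sub>R u + 0 *\<^sub>R w \<in> X"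
      "\<alpha> *\<^sub>R x + (- \<sigma> / 2) *\<^sub>R u + (sqrt 3 / 2 * \<sigma>) *\<^sub>R w \<in> X"
      "\<alpha> *\<^sub>R x + (- \<sigma> / 2) *\<^sub>R u + (- (sqrt 3 / 2 * \<sigma>)) *\<^sub>R w \<in> X"
      using nb nbrD(1)[of _ x] yu by auto
    have "2 * \<alpha> * (\<sigma> * a) + \<sigma>\<^sup>2 * p = 0"
      using Q[OF X(1), unfolded form] by simp
    then have "\<sigma> * (2 * \<alpha> * a + \<sigma> * p) = 0" by (simp add: power2_eq_square algebra_simps)
    then have 1: "\<sigma> * p = - 2 * \<alpha> * a" using sigma(1) by simp
    define c k where "c = - \<sigma> / 2" and "k = sqrt 3 / 2 * \<sigma>"
    have "4 * (k * (\<alpha> * b + c * q)) = 0"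
      using Q[OF X(2), unfolded form, folded c_def k_def] Q[OF X(3), unfolded form, folded c_def k_def]
      by algebra
    then have 2: "\<sigma> * q = 2 * \<alpha> * b" using sigma(1) by (simp add: c_def k_def)
    have n: "(S *v v) \<bullet> (S *v v) = (x \<bullet> (S *v v))\<^sup>2 + (u \<bullet> (S *v v))\<^sup>2 + (w \<bullet> (S *v v))\<^sup>2" for v
      unfolding inner_commute[of x "S *v v"] inner_commute[of u "S *v v"] inner_commute[of w "S *v v"]
        power2_eq_square by (rule frame_inner[OF F])
    have "(S *v x) \<bullet> (S *v x) = a\<^sup>2 + b\<^sup>2" "(S *v u) \<bullet> (S *v u) = a\<^sup>2 + p\<^sup>2 + q\<^sup>2"
      "(S *v w) \<bullet> (S *v w) = b\<^sup>2 + q\<^sup>2 + p\<^sup>2"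
      unfolding n e ww a_def[symmetric] b_def[symmetric] p_def[symmetric] q_def[symmetric] by simp_all
    then have "S \<bullet> S = 2 * (a\<^sup>2 + b\<^sup>2) + 2 * (p\<^sup>2 + q\<^sup>2)" and x2: "(S *v x) \<bullet> (S *v x) = a\<^sup>2 + b\<^sup>2"
      using frame_norm[OF F, of S] by simp_all
    then have "\<sigma>\<^sup>2 * (S \<bullet> S) = 2 * \<sigma>\<^sup>2 * (a\<^sup>2 + b\<^sup>2) + 2 * ((\<sigma> * p)\<^sup>2 + (\<sigma> * q)\<^sup>2)"
      by (simp add: algebra_simps power_mult_distrib)
    also have "\<dots> = (2 * \<sigma>\<^sup>2 + 8 * \<alpha>\<^sup>2) * (a\<^sup>2 + b\<^sup>2)"
      unfolding 1 2 by (simp add: algebra_simps power2_eq_square)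
    finally show ?thesis by (simp add: x2)
  qed
  have "(\<Sum>x\<in>X. \<sigma>\<^sup>2 * (S \<bullet> S)) = (2 * \<sigma>\<^sup>2 + 8 * \<alpha>\<^sup>2) * (\<Sum>x\<in>X. (S *v x) \<bullet> (S *v x))"
    using loc by (simp add: sum_distrib_left)
  then have "real (card X) * (\<sigma>\<^sup>2 * (S \<bullet> S)) = real (card X) * ((2 * \<sigma>\<^sup>2 + 8 * \<alpha>\<^sup>2) / 3 * (S \<bullet> S))"
    by (simp add: sum_norm_matrix)
  then have "\<sigma>\<^sup>2 = (2 * \<sigma>\<^sup>2 + 8 * \<alpha>\<^sup>2) / 3"
    using card_pos S0 by simp
  then have "(3 * \<alpha>)\<^sup>2 = 1\<^sup>2" using sigma(2) by (simp add: power_mult_distrib)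
  then have "3 * \<alpha> = 1" by (rule power2_eq_imp_eq) (use alpha_nonneg in auto)
  then show ?thesis by simp
qed

end

section \<open>Fourth moments\<close>

context balanced_scheme_set
begin

text \<open>
  The property \<open>adjacency_polynomial\<close> for all inner products \<open>t\<close> together, with weights \<open>f t\<close>.
\<close>

lemma kernel_product:
  "\<exists>q. degree q \<le> degree p \<and>
     (\<forall>x\<in>X. \<forall>y\<in>X. (\<Sum>z\<in>X. f (x \<bullet> z) * poly p (z \<bullet> y)) = poly q (x \<bullet> y))"
proof -
  have "\<forall>t. \<exists>q. degree q \<le> degree p \<and> (\<forall>x\<in>X. \<forall>y\<in>X.
      (\<Sum>z\<in>{z \<in> X. x \<bullet> z = t}. poly p (z \<bullet> y)) = poly q (x \<bullet> y))"
    using adjacency_polynomial[of p] by blast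
  from choice[OF this] obtain r where r: "\<And>t. degree (r t) \<le> degree p"
    "\<And>t x y. x \<in> X \<Longrightarrow> y \<in> X \<Longrightarrow> (\<Sum>z\<in>{z \<in> X. x \<bullet> z = t}. poly p (z \<bullet> y)) = poly (r t) (x \<bullet> y)"
    by blast
  define T where "T = (\<lambda>(x, z). x \<bullet> z) ` (X \<times> X)"
  have finT: "finite T" using finite_X by (simp add: T_def)
  define q where "q = (\<Sum>t\<in>T. smult (f t) (r t))"
  have "degree q \<le> degree p"
    unfolding q_def by (intro degree_sum_le finT) (rule order_trans[OF degree_smult_le r(1)])
  moreover have "(\<Sum>z\<in>X. f (x \<bullet> z) * poly p (z \<bullet> y)) = poly q (x \<bullet> y)" if x: "x \<in> X" and y: "y \<in> X" for x y
  proof -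
    have "(\<Sum>z\<in>X. f (x \<bullet> z) * poly p (z \<bullet> y))
        = (\<Sum>t\<in>T. \<Sum>z\<in>{z \<in> X. x \<bullet> z = t}. f (x \<bullet> z) * poly p (z \<bullet> y))"
      using x by (intro sum.group[symmetric] finite_X finT) (auto simp: T_def)
    also have "\<dots> = (\<Sum>t\<in>T. f t * poly (r t) (x \<bullet> y))"
    proof (rule sum.cong[OF refl])
      fix t
      have "(\<Sum>z\<in>{z \<in> X. x \<bullet> z = t}. f (x \<bullet> z) * poly p (z \<bullet> y))
          = f t * (\<Sum>z\<in>{z \<in> X. x \<bullet> z = t}. poly p (z \<bullet> y))"
        unfolding sum_distrib_left by (intro sum.cong) auto
      then show "(\<Sum>z\<in>{z \<in> X. x \<bullet> z = t}. f (x \<bullet> z) * poly p (z \<bullet> y)) = f t * poly (r t) (x \<bullet> y)"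
        by (simp only: r(2)[OF x y])
    qed
    also have "\<dots> = poly q (x \<bullet> y)"
      by (simp add: q_def poly_sum)
    finally show ?thesis .
  qed
  ultimately show ?thesis by blast
qed

text \<open>
  Up to scaling, the zonal spherical harmonic of degree 2.
\<close>

definition harmonic2 :: "real \<Rightarrow> real" where
  "harmonic2 t = t\<^sup>2 - 1 / 3"

text \<open>
  The Q-polynomial property in degree 2: up to a factor the kernel \<open>harmonic2 (x \<bullet> y)\<close> is the Gram
  matrix of the second idempotent. The constant and the linear term of the polynomial that \<open>kernel_product\<close>
  provides vanish because the kernel is orthogonal to the functions of degree 0 and 1.
\<close>

lemma harmonic2_reproducing:
  obtains c where "c > 0"
    "\<And>x y. x \<in> X \<Longrightarrow> y \<in> X \<Longrightarrow> (\<Sum>z\<in>X. harmonic2 (x \<bullet> z) * harmonic2 (z \<bullet> y)) = c * harmonic2 (x \<bullet> y)"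
proof -
  let ?p = "[:- 1 / 3, 0, 1::real:]"
  let ?g = "real (card X) / 3"
  obtain q where q: "degree q \<le> degree ?p" "\<And>x y. x \<in> X \<Longrightarrow> y \<in> X \<Longrightarrow>
      (\<Sum>z\<in>X. harmonic2 (x \<bullet> z) * poly ?p (z \<bullet> y)) = poly q (x \<bullet> y)"
    using kernel_product[of ?p harmonic2] by blast
  define c0 c1 c2 where "c0 = coeff q 0" and "c1 = coeff q 1" and "c2 = coeff q 2"
  have "poly q t = c0 + c1 * t + c2 * t\<^sup>2" for t
    using poly_eq_sum_coeff[of q 2 t] q(1) by (simp add: c0_def c1_def c2_def numeral_2_eq_2)
  moreover have "poly ?p t = harmonic2 t" for t by (simp add: harmonic2_def power2_eq_square)
  ultimately have K: "(\<Sum>z\<in>X. harmonic2 (x \<bullet> z) * harmonic2 (z \<bullet> y)) = c0 + c1 * (x \<bullet> y) + c2 * (x \<bullet> y)\<^sup>2"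
    if "x \<in> X" "y \<in> X" for x y
    using q(2)[OF that] by simp
  obtain x where x: "x \<in> X" using nonempty by blast
  have h0: "(\<Sum>y\<in>X. harmonic2 (z \<bullet> y)) = 0" if "z \<in> X" for z
    using sum_inner_square[of z] unit[OF that]
    by (simp add: harmonic2_def sum_subtractf inner_commute)
  have h1: "(\<Sum>y\<in>X. harmonic2 (z \<bullet> y) * (x \<bullet> y)) = 0" if "z \<in> X" for z
  proof -
    have "(\<Sum>y\<in>X. harmonic2 (z \<bullet> y) * (x \<bullet> y))
        = (\<Sum>y\<in>X. (y \<bullet> z)\<^sup>2 * (y \<bullet> x)) - (\<Sum>y\<in>X. y \<bullet> x) / 3"
      by (simp add: harmonic2_def sum_subtractf sum_divide_distrib inner_commute algebra_simps)
    then show ?thesis using cubic[OF that] by (simp add: sum_inner)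
  qed
  have "(\<Sum>y\<in>X. \<Sum>z\<in>X. harmonic2 (x \<bullet> z) * harmonic2 (z \<bullet> y))
      = (\<Sum>z\<in>X. harmonic2 (x \<bullet> z) * (\<Sum>y\<in>X. harmonic2 (z \<bullet> y)))"
    by (subst sum.swap) (simp add: sum_distrib_left)
  also have "\<dots> = 0" using h0 by simp
  finally have "(\<Sum>y\<in>X. c0 + c1 * (x \<bullet> y) + c2 * (x \<bullet> y)\<^sup>2) = 0"
    using K x by simp
  also have "(\<Sum>y\<in>X. c0 + c1 * (x \<bullet> y) + c2 * (x \<bullet> y)\<^sup>2)
      = real (card X) * c0 + c1 * (\<Sum>y\<in>X. y \<bullet> x) + c2 * (\<Sum>y\<in>X. (y \<bullet> x)\<^sup>2)"
    by (simp add: sum.distrib sum_distrib_left inner_commute)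
  also have "\<dots> = real (card X) * (c0 + c2 / 3)"
    by (simp add: sum_inner sum_inner_square unit x algebra_simps)
  finally have c0: "c0 = - c2 / 3" using card_pos by simp
  have "(\<Sum>y\<in>X. (\<Sum>z\<in>X. harmonic2 (x \<bullet> z) * harmonic2 (z \<bullet> y)) * (x \<bullet> y))
      = (\<Sum>z\<in>X. harmonic2 (x \<bullet> z) * (\<Sum>y\<in>X. harmonic2 (z \<bullet> y) * (x \<bullet> y)))"
    by (simp only: sum_distrib_right, subst sum.swap) (simp add: sum_distrib_left mult_ac)
  also have "\<dots> = 0" using h1 by simp
  finally have "(\<Sum>y\<in>X. (c0 + c1 * (x \<bullet> y) + c2 * (x \<bullet> y)\<^sup>2) * (x \<bullet> y)) = 0"
    using K x by simp
  also have "(\<Sum>y\<in>X. (c0 + c1 * (x \<bullet> y) + c2 * (x \<bullet> y)\<^sup>2) * (x \<bullet> y))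
      = c0 * (\<Sum>y\<in>X. y \<bullet> x) + c1 * (\<Sum>y\<in>X. (y \<bullet> x)\<^sup>2) + c2 * (\<Sum>y\<in>X. (y \<bullet> x) ^ 3)"
    by (simp add: sum_distrib_left sum.distrib[symmetric] inner_commute algebra_simps
        power2_eq_square power3_eq_cube)
  also have "\<dots> = c1 * ?g"
    by (simp add: sum_inner sum_inner_square sum_inner_cubed x unit)
  finally have c1: "c1 = 0" using card_pos by simp
  have K': "(\<Sum>z\<in>X. harmonic2 (x \<bullet> z) * harmonic2 (z \<bullet> y)) = c2 * harmonic2 (x \<bullet> y)"
    if "x \<in> X" "y \<in> X" for x y
    using K[OF that] by (simp add: c0 c1 harmonic2_def algebra_simps)
  have "0 < (harmonic2 (x \<bullet> x))\<^sup>2" by (simp add: harmonic2_def unit x)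
  also have "\<dots> \<le> (\<Sum>z\<in>X. (harmonic2 (x \<bullet> z))\<^sup>2)"
    by (rule member_le_sum[OF x]) (simp_all add: finite_X)
  also have "\<dots> = c2 * harmonic2 (x \<bullet> x)"
    using K'[OF x x] by (simp add: power2_eq_square inner_commute)
  also have "\<dots> = c2 * (2 / 3)" by (simp add: harmonic2_def unit x)
  finally have "c2 > 0" by simp
  then show thesis using K' that by blast
qed

text \<open>
  If no nonzero traceless quadratic form vanishes on \<open>X\<close>, then the fourth moments of \<open>X\<close> agree with those of the sphere.
  Let \<open>O' v\<close> be the traceless part of \<open>outer v\<close>, and \<open>B\<close> the operator that maps a traceless symmetric matrix \<open>S\<close> to
  \<open>(\<Sum>z\<in>X. (S \<bullet> O' z) *\<^sub>R O' z)\<close>. By \<open>harmonic2_reproducing\<close> every \<open>O' v\<close> with \<open>v\<close> in \<open>X\<close> is an eigenvector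
  of \<open>B\<close> for the eigenvalue \<open>c\<close>, so the form of \<open>c S - B S\<close> vanishes on \<open>X\<close> for each \<open>S\<close>. By hypothesis \<open>B\<close> is then
  the scalar \<open>c\<close>, which is a statement about fourth moments.
\<close>

lemma fourth_moments:
  assumes noquad: "\<nexists>S. transpose S = S \<and> S \<bullet> mat 1 = 0 \<and> S \<noteq> 0 \<and> (\<forall>x\<in>X. S \<bullet> outer x = 0)"
    and x: "x \<in> X" and F: "orthonormal_frame x u w"
  shows "(\<Sum>z\<in>X. (z \<bullet> x) ^ 4) = real (card X) / 5"
    and "(\<Sum>z\<in>X. (z \<bullet> x) ^ 3 * (z \<bullet> u)) = 0"
    and "(\<Sum>z\<in>X. (z \<bullet> x)\<^sup>2 * (z \<bullet> u)\<^sup>2) = real (card X) / 15"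
    and "(\<Sum>z\<in>X. (z \<bullet> x) * (z \<bullet> u) ^ 3) = 0"
proof -
  note F' = F[unfolded orthonormal_frame_def]
  let ?g = "real (card X) / 3"
  obtain c where c: "c > 0" and K: "\<And>x y. x \<in> X \<Longrightarrow> y \<in> X \<Longrightarrow>
      (\<Sum>z\<in>X. harmonic2 (x \<bullet> z) * harmonic2 (z \<bullet> y)) = c * harmonic2 (x \<bullet> y)"
    using harmonic2_reproducing by blast
  define O' where "O' v = outer v - (1 / 3) *\<^sub>R mat 1" for v
  have m1: "(mat 1 :: real ^ 3 ^ 3) \<bullet> mat 1 = 3" by (simp add: inner_matrix mat_def sum_3)
  have O'_tr: "O' v \<bullet> mat 1 = 0" "mat 1 \<bullet> O' v = 0" if "v \<in> X" for v
    using unit[OF that] mat_1_inner_outer[of v]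
    by (simp_all add: O'_def inner_diff_left inner_diff_right m1 inner_commute)
  have trO_O: "O' v \<bullet> outer b = (v \<bullet> b)\<^sup>2 - (b \<bullet> b) / 3" for v b
    by (simp add: O'_def inner_diff_left outer_inner_outer mat_1_inner_outer)
  have trO_trO: "O' v \<bullet> O' z = harmonic2 (v \<bullet> z)" if "v \<in> X" "z \<in> X" for v z
    using trO_O[of v z] O'_tr(1)[OF that(1)] unit[OF that(2)]
    by (simp add: O'_def[of z] inner_diff_right harmonic2_def)
  have eig: "(\<Sum>z\<in>X. harmonic2 (v \<bullet> z) *\<^sub>R O' z) = c *\<^sub>R O' v" if v: "v \<in> X" for v
  proof -
    define D where "D = (\<Sum>z\<in>X. harmonic2 (v \<bullet> z) *\<^sub>R O' z) - c *\<^sub>R O' v"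
    have D: "D \<bullet> O' y = 0" if "y \<in> X" for y
    proof -
      have "D \<bullet> O' y = (\<Sum>z\<in>X. harmonic2 (v \<bullet> z) * (O' z \<bullet> O' y)) - c * (O' v \<bullet> O' y)"
        by (simp add: D_def inner_diff_left inner_sum_left)
      also have "\<dots> = (\<Sum>z\<in>X. harmonic2 (v \<bullet> z) * harmonic2 (z \<bullet> y)) - c * harmonic2 (v \<bullet> y)"
        using trO_trO that v by simp
      finally show ?thesis using K[OF v that] by simp
    qed
    have "D \<bullet> D = (\<Sum>z\<in>X. harmonic2 (v \<bullet> z) * (D \<bullet> O' z)) - c * (D \<bullet> O' v)"
      by (subst (2) D_def) (simp add: inner_diff_right inner_sum_right)
    also have "\<dots> = 0" using D v by simp
    finally show ?thesis by (simp add: D_def)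
  qed
  have trO: "transpose (outer v) = outer v" for v
    by (simp add: transpose_def outer_def vec_eq_iff mult.commute)
  have trO': "transpose (O' v) = O' v" for v
    using trO[of v] by (simp add: O'_def transpose_def vec_eq_iff mat_def)
  have moment: "c * (S \<bullet> outer b) = (\<Sum>z\<in>X. (S \<bullet> outer z) * ((z \<bullet> b)\<^sup>2 - (b \<bullet> b) / 3))"
    if S: "transpose S = S" "S \<bullet> mat 1 = 0" for S b
  proof -
    define S' where "S' = c *\<^sub>R S - (\<Sum>z\<in>X. (S \<bullet> O' z) *\<^sub>R O' z)"
    have SO: "S \<bullet> O' z = S \<bullet> outer z" for z
      using S(2) by (simp add: O'_def inner_diff_right)
    have "transpose S' = S'"
      using S(1) trO' by (simp add: S'_def transpose_def vec_eq_iff)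
    moreover have tr: "S' \<bullet> mat 1 = 0"
      using S(2) O'_tr by (simp add: S'_def inner_diff_left inner_sum_left)
    moreover have "S' \<bullet> outer v = 0" if v: "v \<in> X" for v
    proof -
      have "S' \<bullet> outer v = S' \<bullet> O' v" using tr by (simp add: O'_def inner_diff_right)
      also have "\<dots> = c * (S \<bullet> O' v) - (\<Sum>z\<in>X. (S \<bullet> O' z) * (O' z \<bullet> O' v))"
        by (simp add: S'_def inner_diff_left inner_sum_left)
      also have "(\<Sum>z\<in>X. (S \<bullet> O' z) * (O' z \<bullet> O' v)) = (\<Sum>z\<in>X. (S \<bullet> O' z) * harmonic2 (v \<bullet> z))"
        using trO_trO v by (simp add: inner_commute[of v])
      also have "(\<Sum>z\<in>X. (S \<bullet> O' z) * harmonic2 (v \<bullet> z)) = S \<bullet> (\<Sum>z\<in>X. harmonic2 (v \<bullet> z) *\<^sub>R O' z)"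
        by (simp add: inner_sum_right mult.commute)
      also have "\<dots> = c * (S \<bullet> O' v)" using eig[OF v] by simp
      finally show ?thesis by simp
    qed
    ultimately have "S' = 0" using noquad by blast
    then have "S' \<bullet> outer b = 0" by simp
    then show ?thesis
      by (simp add: S'_def inner_diff_left inner_sum_left SO trO_O)
  qed
  have mixed: "c * ((b \<bullet> x) * (b \<bullet> a)) = (\<Sum>z\<in>X. (z \<bullet> x) * (z \<bullet> a) * (z \<bullet> b)\<^sup>2)" if xa: "x \<bullet> a = 0" for a b
  proof -
    define S :: "real ^ 3 ^ 3" where "S = (\<chi> i j. x $ i * a $ j + a $ i * x $ j)"
    have SO: "S \<bullet> outer v = 2 * ((v \<bullet> x) * (v \<bullet> a))" for v
      by (simp add: S_def inner_matrix outer_def inner_vec_def sum_3 algebra_simps)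
    have "transpose S = S" by (simp add: S_def transpose_def vec_eq_iff algebra_simps)
    moreover have "S \<bullet> mat 1 = 2 * (x \<bullet> a)"
      by (simp add: S_def inner_matrix mat_def inner_vec_def sum_3 algebra_simps)
    ultimately have "c * (S \<bullet> outer b) = (\<Sum>z\<in>X. (S \<bullet> outer z) * ((z \<bullet> b)\<^sup>2 - (b \<bullet> b) / 3))"
      using xa by (intro moment) auto
    also have "\<dots> = 2 * (\<Sum>z\<in>X. (z \<bullet> x) * (z \<bullet> a) * (z \<bullet> b)\<^sup>2) - 2 * (b \<bullet> b) / 3 * (\<Sum>z\<in>X. (z \<bullet> x) * (z \<bullet> a))"
    proof -
      have "(S \<bullet> outer z) * ((z \<bullet> b)\<^sup>2 - (b \<bullet> b) / 3) = 2 * ((z \<bullet> x) * (z \<bullet> a) * (z \<bullet> b)\<^sup>2)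
          - 2 * (b \<bullet> b) / 3 * ((z \<bullet> x) * (z \<bullet> a))" for z
        by (simp add: SO algebra_simps)
      then show ?thesis by (simp only: sum_subtractf sum_distrib_left)
    qed
    also have "(\<Sum>z\<in>X. (z \<bullet> x) * (z \<bullet> a)) = 0" by (simp add: sum_inner_mult xa)
    finally show ?thesis by (simp add: SO)
  qed
  have a3: "(\<Sum>z\<in>X. (z \<bullet> x) ^ 3 * (z \<bullet> a)) = 0" and b3: "(\<Sum>z\<in>X. (z \<bullet> x) * (z \<bullet> a) ^ 3) = 0"
    and ab: "2 * (\<Sum>z\<in>X. (z \<bullet> x)\<^sup>2 * (z \<bullet> a)\<^sup>2) = c"
    if a: "x \<bullet> a = 0" "a \<bullet> a = 1" for a
  proof -
    show a3: "(\<Sum>z\<in>X. (z \<bullet> x) ^ 3 * (z \<bullet> a)) = 0"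
      using mixed[OF a(1), of x] a by (simp add: power3_eq_cube power2_eq_square mult_ac)
    show b3: "(\<Sum>z\<in>X. (z \<bullet> x) * (z \<bullet> a) ^ 3) = 0"
      using mixed[OF a(1), of a] a by (simp add: power3_eq_cube power2_eq_square mult_ac inner_commute)
    have "c = (\<Sum>z\<in>X. (z \<bullet> x) * (z \<bullet> a) * (z \<bullet> (x + a))\<^sup>2)"
    proof -
      have "(x + a) \<bullet> x = 1" "(x + a) \<bullet> a = 1"
        using a unit[OF x] by (simp_all add: inner_add_left inner_commute[of a x])
      then show ?thesis using mixed[OF a(1), of "x + a"] by simp
    qed
    also have "\<dots> = (\<Sum>z\<in>X. (z \<bullet> x) ^ 3 * (z \<bullet> a)) + 2 * (\<Sum>z\<in>X. (z \<bullet> x)\<^sup>2 * (z \<bullet> a)\<^sup>2)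
        + (\<Sum>z\<in>X. (z \<bullet> x) * (z \<bullet> a) ^ 3)"
      by (simp add: inner_add_right sum_distrib_left sum.distrib[symmetric] algebra_simps
          power2_eq_square power3_eq_cube)
    finally show "2 * (\<Sum>z\<in>X. (z \<bullet> x)\<^sup>2 * (z \<bullet> a)\<^sup>2) = c" using a3 b3 by simp
  qed
\<comment> \<open>The value of \<open>c\<close> follows from two relations between \<open>c\<close> and the moment \<open>m\<close>.\<close>
  define m where "m = (\<Sum>z\<in>X. (z \<bullet> x) ^ 4)"
  have "?g = (\<Sum>z\<in>X. (z \<bullet> x)\<^sup>2 * ((z \<bullet> x)\<^sup>2 + (z \<bullet> u)\<^sup>2 + (z \<bullet> w)\<^sup>2))"
  proof -
    have "(z \<bullet> x)\<^sup>2 + (z \<bullet> u)\<^sup>2 + (z \<bullet> w)\<^sup>2 = 1" if "z \<in> X" for z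
      using frame_inner[OF F, of z z] unit[OF that] by (simp add: power2_eq_square)
    then show ?thesis using sum_inner_square[of x] by (simp add: unit x)
  qed
  also have "\<dots> = m + (\<Sum>z\<in>X. (z \<bullet> x)\<^sup>2 * (z \<bullet> u)\<^sup>2) + (\<Sum>z\<in>X. (z \<bullet> x)\<^sup>2 * (z \<bullet> w)\<^sup>2)"
    by (simp add: m_def sum.distrib[symmetric] algebra_simps power2_eq_square power4_eq_xxxx)
  finally have 1: "?g = m + c"
    using ab[of u] ab[of w] F' by simp
  have "c * (2 / 3) = (\<Sum>z\<in>X. (harmonic2 (z \<bullet> x))\<^sup>2)"
    using K[OF x x] by (simp add: harmonic2_def unit x power2_eq_square inner_commute)
  also have "\<dots> = m - 2 / 3 * (\<Sum>z\<in>X. (z \<bullet> x)\<^sup>2) + real (card X) / 9"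
  proof -
    have "(harmonic2 t)\<^sup>2 = t ^ 4 - 2 / 3 * t\<^sup>2 + 1 / 9" for t
      by (simp add: harmonic2_def power2_eq_square power4_eq_xxxx algebra_simps)
    then have "(\<Sum>z\<in>X. (harmonic2 (z \<bullet> x))\<^sup>2)
        = m - (\<Sum>z\<in>X. 2 / 3 * (z \<bullet> x)\<^sup>2) + (\<Sum>z\<in>X. 1 / 9)"
      by (simp only: m_def sum.distrib sum_subtractf)
    then show ?thesis by (simp add: sum_distrib_left)
  qed
  also have "\<dots> = m - 2 / 3 * ?g + ?g / 3"
    by (simp add: sum_inner_square unit x)
  finally have 2: "c * (2 / 3) = m - ?g / 3" by linarith
  show "(\<Sum>z\<in>X. (z \<bullet> x) ^ 4) = real (card X) / 5"
    using 1 2 unfolding m_def[symmetric] by linarith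
  show "(\<Sum>z\<in>X. (z \<bullet> x)\<^sup>2 * (z \<bullet> u)\<^sup>2) = real (card X) / 15"
    using 1 2 ab[of u] F' by linarith
  show "(\<Sum>z\<in>X. (z \<bullet> x) ^ 3 * (z \<bullet> u)) = 0" "(\<Sum>z\<in>X. (z \<bullet> x) * (z \<bullet> u) ^ 3) = 0"
    using a3 b3 F' by auto
qed

end

section \<open>The largest inner product\<close>

context nearest_neighbours
begin

lemma frame_combination_inner:
  assumes "orthonormal_frame x u w"
  shows "(a *\<^sub>R x + b *\<^sub>R u + c *\<^sub>R w) \<bullet> (a' *\<^sub>R x + b' *\<^sub>R u + c' *\<^sub>R w) = a * a' + b * b' + c * c'"
  using assms by (simp add: orthonormal_frame_def inner_add_left inner_add_right inner_commute)

text \<open>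
  Suppose that \<open>\<alpha>\<close> has another value. Then the fourth moments of \<open>X\<close> are those of the sphere.
  The sum of the cubes of the inner products of \<open>z\<close> with the three neighbours of \<open>x\<close> is a cubic polynomial in \<open>x \<bullet> z\<close>.
  The moments and the value at \<open>z = x\<close> determine it up to one coefficient. Its values at a neighbour
  and at a second neighbour of \<open>x\<close> then yield a polynomial equation for \<open>\<alpha>\<close>, whose only root
  in question has \<open>\<alpha>\<^sup>2 = 1/3\<close>. For this value the second neighbours reached through two different neighbours of
  \<open>x\<close> include two points that are closer than allowed.
\<close>

lemma alpha_valency_3:
  assumes v: "valency = 3"
  shows "\<alpha> = 1 / 3"
proof (rule ccontr)
  assume neq: "\<alpha> \<noteq> 1 / 3"
  have noquad: "\<nexists>S. transpose S = S \<and> S \<bullet> mat 1 = 0 \<and> S \<noteq> 0 \<and> (\<forall>x\<in>X. S \<bullet> outer x = 0)"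
    using cube_distance_if_quadric[OF v] neq by blast
  obtain x where x: "x \<in> X" using nonempty by blast
  obtain y where y: "y \<in> nbr x" using nbr_nonempty[OF x] by blast
  obtain u where F: "orthonormal_frame x u (cross3 x u)" and yu: "y = \<alpha> *\<^sub>R x + \<sigma> *\<^sub>R u"
    using nbr_frame[OF x y] by blast
  define w where "w = cross3 x u"
  note nb = three_neighbours[OF v x y F yu, folded w_def]
  note z1 = second_neighbour[OF v x y F yu, of 1, folded w_def]
  note F = F[folded w_def]
  note F' = F[unfolded orthonormal_frame_def]
  note ip = frame_combination_inner[OF F]
  define \<gamma> where "\<gamma> = 3 / 2 * \<alpha>\<^sup>2 - 1 / 2"
  define r where "r = sqrt 3 / 2"
  have r2: "r * r = 3 / 4" by (simp add: r_def)
  have s2: "\<sigma> * \<sigma> = 1 - \<alpha> * \<alpha>" using sigma(2) by (simp add: power2_eq_square)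
  define y2 y3 z where "y2 = \<alpha> *\<^sub>R x + (- \<sigma> / 2) *\<^sub>R u + (r * \<sigma>) *\<^sub>R w"
    and "y3 = \<alpha> *\<^sub>R x + (- \<sigma> / 2) *\<^sub>R u + (- (r * \<sigma>)) *\<^sub>R w"
    and "z = \<gamma> *\<^sub>R x + (3 / 2 * \<alpha> * \<sigma>) *\<^sub>R u + (r * \<sigma>) *\<^sub>R w"
  have nbx: "nbr x = {y, y2, y3}" and ne: "y \<noteq> y2" "y \<noteq> y3" "y2 \<noteq> y3"
    using nb by (simp_all add: y2_def y3_def r_def)
  have y': "y = \<alpha> *\<^sub>R x + \<sigma> *\<^sub>R u + 0 *\<^sub>R w" using yu by simp
  have x': "x = 1 *\<^sub>R x + 0 *\<^sub>R u + 0 *\<^sub>R w" by simp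
  have zX: "z \<in> X" using z1 nbrD(1)[of _ y] by (simp add: z_def \<gamma>_def r_def)
  have yX: "y \<in> X" "y2 \<in> X" "y3 \<in> X" using nbx nbrD(1)[of _ x] by auto
  have nyx: "y \<in> nbr x" "y2 \<in> nbr x" "y3 \<in> nbr x" using nbx by auto
  note M = fourth_moments[OF noquad x F]
  define g where "g = real (card X)"
  have g: "g > 0" using card_pos by (simp add: g_def)
  obtain q where q: "degree q \<le> degree [:0, 0, 0, 1::real:]" "\<And>x z. x \<in> X \<Longrightarrow> z \<in> X \<Longrightarrow>
      (\<Sum>y\<in>nbr x. poly [:0, 0, 0, 1:] (y \<bullet> z)) = poly q (x \<bullet> z)"
    using adjacency_polynomial[of "[:0, 0, 0, 1:]" \<alpha>] unfolding nbr_def by blast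
  define c0 c1 c2 c3 where "c0 = coeff q 0" and "c1 = coeff q 1" and "c2 = coeff q 2" and "c3 = coeff q 3"
  have "poly q t = c0 + c1 * t + c2 * t\<^sup>2 + c3 * t ^ 3" for t
    using poly_eq_sum_coeff[of q 3 t] q(1) by (simp add: c0_def c1_def c2_def c3_def eval_nat_numeral)
  then have "(\<Sum>y\<in>nbr x. (y \<bullet> v) ^ 3) = c0 + c1 * (x \<bullet> v) + c2 * (x \<bullet> v)\<^sup>2 + c3 * (x \<bullet> v) ^ 3" if "v \<in> X" for v
    using q(2)[OF x that] by (simp add: power3_eq_cube mult.assoc)
  then have Q: "(y \<bullet> v) ^ 3 + (y2 \<bullet> v) ^ 3 + (y3 \<bullet> v) ^ 3 = c0 + c1 * (x \<bullet> v) + c2 * (x \<bullet> v)\<^sup>2 + c3 * (x \<bullet> v) ^ 3"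
    if "v \<in> X" for v
    using that ne by (simp add: nbx add.assoc)
  have "(\<Sum>v\<in>X. (y \<bullet> v) ^ 3 + (y2 \<bullet> v) ^ 3 + (y3 \<bullet> v) ^ 3) = 0"
    using sum_inner_cubed yX
    by (simp add: sum.distrib inner_commute[of y] inner_commute[of y2] inner_commute[of y3])
  then have "(\<Sum>v\<in>X. c0 + c1 * (x \<bullet> v) + c2 * (x \<bullet> v)\<^sup>2 + c3 * (x \<bullet> v) ^ 3) = 0"
    using Q by simp
  also have "(\<Sum>v\<in>X. c0 + c1 * (x \<bullet> v) + c2 * (x \<bullet> v)\<^sup>2 + c3 * (x \<bullet> v) ^ 3)
      = g * c0 + c1 * (\<Sum>v\<in>X. v \<bullet> x) + c2 * (\<Sum>v\<in>X. (v \<bullet> x)\<^sup>2) + c3 * (\<Sum>v\<in>X. (v \<bullet> x) ^ 3)"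
    by (simp add: sum.distrib sum_distrib_left inner_commute g_def)
  also have "\<dots> = g * (c0 + c2 / 3)"
    by (simp add: sum_inner sum_inner_square sum_inner_cubed unit x algebra_simps g_def)
  finally have e0: "c0 = - c2 / 3" using g by simp
  have mixed: "(\<Sum>v\<in>X. (x \<bullet> v) * (b \<bullet> v) ^ 3) = g / 5 * \<alpha>" if b: "b \<in> nbr x" for b
  proof -
    obtain u where F: "orthonormal_frame x u (cross3 x u)" and bu: "b = \<alpha> *\<^sub>R x + \<sigma> *\<^sub>R u"
      using nbr_frame[OF x b] by blast
    note M = fourth_moments[OF noquad x F]
    have "(x \<bullet> v) * (b \<bullet> v) ^ 3 = \<alpha> ^ 3 * (v \<bullet> x) ^ 4 + 3 * \<alpha>\<^sup>2 * \<sigma> * ((v \<bullet> x) ^ 3 * (v \<bullet> u))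
        + 3 * \<alpha> * \<sigma>\<^sup>2 * ((v \<bullet> x)\<^sup>2 * (v \<bullet> u)\<^sup>2) + \<sigma> ^ 3 * ((v \<bullet> x) * (v \<bullet> u) ^ 3)" for v
      by (simp add: bu inner_add_left inner_commute[of v] eval_nat_numeral algebra_simps)
    then have "(\<Sum>v\<in>X. (x \<bullet> v) * (b \<bullet> v) ^ 3) = \<alpha> ^ 3 * (\<Sum>v\<in>X. (v \<bullet> x) ^ 4)
        + 3 * \<alpha>\<^sup>2 * \<sigma> * (\<Sum>v\<in>X. (v \<bullet> x) ^ 3 * (v \<bullet> u))
        + 3 * \<alpha> * \<sigma>\<^sup>2 * (\<Sum>v\<in>X. (v \<bullet> x)\<^sup>2 * (v \<bullet> u)\<^sup>2) + \<sigma> ^ 3 * (\<Sum>v\<in>X. (v \<bullet> x) * (v \<bullet> u) ^ 3)"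
      by (simp only: sum.distrib sum_distrib_left)
    also have "\<dots> = \<alpha> ^ 3 * (g / 5) + 3 * \<alpha> * \<sigma>\<^sup>2 * (g / 15)"
      unfolding M g_def by simp
    also have "\<dots> = g / 5 * \<alpha> * (\<alpha>\<^sup>2 + \<sigma>\<^sup>2)"
      by (simp add: algebra_simps power2_eq_square power3_eq_cube)
    finally show ?thesis by (simp add: sigma)
  qed
  have "(\<Sum>v\<in>X. (x \<bullet> v) * ((y \<bullet> v) ^ 3 + (y2 \<bullet> v) ^ 3 + (y3 \<bullet> v) ^ 3)) = 3 * (g / 5 * \<alpha>)"
    using mixed[OF nyx(1)] mixed[OF nyx(2)] mixed[OF nyx(3)] by (simp add: distrib_left sum.distrib)
  then have "3 * (g / 5 * \<alpha>) = (\<Sum>v\<in>X. (x \<bullet> v) * (c0 + c1 * (x \<bullet> v) + c2 * (x \<bullet> v)\<^sup>2 + c3 * (x \<bullet> v) ^ 3))"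
    using Q by simp
  also have "\<dots> = c0 * (\<Sum>v\<in>X. v \<bullet> x) + c1 * (\<Sum>v\<in>X. (v \<bullet> x)\<^sup>2) + c2 * (\<Sum>v\<in>X. (v \<bullet> x) ^ 3) + c3 * (\<Sum>v\<in>X. (v \<bullet> x) ^ 4)"
    by (simp add: sum_distrib_left sum.distrib[symmetric] inner_commute algebra_simps
        power2_eq_square power3_eq_cube power4_eq_xxxx)
  also have "\<dots> = g * (c1 / 3 + c3 / 5)"
    using M(1) by (simp add: sum_inner sum_inner_square sum_inner_cubed unit x algebra_simps g_def)
  finally have "g * (3 * \<alpha> / 5) = g * (c1 / 3 + c3 / 5)" by simp
  then have e1: "c1 = 9 / 5 * \<alpha> - 3 / 5 * c3" using g by simp
  have "3 * \<alpha> ^ 3 = c0 + c1 + c2 + c3"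
    using Q[OF x] nbrD(3)[OF nyx(1)] nbrD(3)[OF nyx(2)] nbrD(3)[OF nyx(3)] unit[OF x] by simp
  then have e2: "c2 = 3 / 2 * (3 * \<alpha> ^ 3 - 9 / 5 * \<alpha> - 2 / 5 * c3)"
    unfolding e0 e1 by simp
  have yy: "y \<bullet> y = 1" "y2 \<bullet> y = \<gamma>" "y3 \<bullet> y = \<gamma>" "x \<bullet> y = \<alpha>"
    using unit[OF yX(1)] nbrD(2)[OF nyx(1)]
    unfolding y2_def y3_def y' ip by (simp_all add: s2 \<gamma>_def power2_eq_square field_simps)
  have zz: "y \<bullet> z = \<alpha>" "y2 \<bullet> z = \<alpha> * \<gamma> + 3 / 4 * (1 - \<alpha>\<^sup>2) * (1 - \<alpha>)"
      "y3 \<bullet> z = \<alpha> * \<gamma> - 3 / 4 * (1 - \<alpha>\<^sup>2) * (1 + \<alpha>)" "x \<bullet> z = \<gamma>"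
  proof -
    show "y \<bullet> z = \<alpha>"
      using z1 nbrD(2)[of z y] by (simp add: z_def \<gamma>_def r_def)
    have "y2 \<bullet> z = \<alpha> * \<gamma> - 3 / 4 * \<alpha> * (\<sigma> * \<sigma>) + (r * r) * (\<sigma> * \<sigma>)"
      unfolding y2_def z_def ip by (simp add: algebra_simps)
    then show "y2 \<bullet> z = \<alpha> * \<gamma> + 3 / 4 * (1 - \<alpha>\<^sup>2) * (1 - \<alpha>)"
      unfolding s2 r2 by (simp add: field_simps power2_eq_square)
    have "y3 \<bullet> z = \<alpha> * \<gamma> - 3 / 4 * \<alpha> * (\<sigma> * \<sigma>) - (r * r) * (\<sigma> * \<sigma>)"
      unfolding y3_def z_def ip by (simp add: algebra_simps)
    then show "y3 \<bullet> z = \<alpha> * \<gamma> - 3 / 4 * (1 - \<alpha>\<^sup>2) * (1 + \<alpha>)"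
      unfolding s2 r2 by (simp add: field_simps power2_eq_square)
    show "x \<bullet> z = \<gamma>"
      unfolding z_def using F' by (simp add: inner_add_right)
  qed
\<comment> \<open>The polynomial is \<open>K t + c3 * D t\<close> with the unknown \<open>c3\<close>.\<close>
  define D where "D t = (t - 1) * (5 * t\<^sup>2 + 2 * t - 1) / 5" for t :: real
  define K where "K t = (9 / 2 * \<alpha> ^ 3 - 27 / 10 * \<alpha>) * (t\<^sup>2 - 1 / 3) + 9 / 5 * \<alpha> * t" for t :: real
  have poly_form: "c0 + c1 * t + c2 * t\<^sup>2 + c3 * t ^ 3 = K t + c3 * D t" for t
    unfolding e0 e1 e2 K_def D_def by (simp add: field_simps power2_eq_square power3_eq_cube)
  have E1: "1 + 2 * \<gamma> ^ 3 = K \<alpha> + c3 * D \<alpha>"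
    using Q[OF yX(1)] unfolding yy poly_form by simp
  define N where "N = \<alpha> ^ 3 + (\<alpha> * \<gamma> + 3 / 4 * (1 - \<alpha>\<^sup>2) * (1 - \<alpha>)) ^ 3 + (\<alpha> * \<gamma> - 3 / 4 * (1 - \<alpha>\<^sup>2) * (1 + \<alpha>)) ^ 3"
  have E2: "N = K \<gamma> + c3 * D \<gamma>"
    using Q[OF zX] unfolding zz poly_form N_def .
\<comment> \<open>Eliminating \<open>c3\<close> from the values at \<open>\<alpha>\<close> and \<open>\<gamma>\<close> leaves a product of known factors.\<close>
  have "(K \<alpha> - (1 + 2 * \<gamma> ^ 3)) * D \<gamma> = - c3 * D \<alpha> * D \<gamma>"
    "(K \<gamma> - N) * D \<alpha>
      = - c3 * D \<gamma> * D \<alpha>"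
    unfolding E1 E2 by (simp_all add: algebra_simps)
  then have "(K \<alpha> - (1 + 2 * \<gamma> ^ 3)) * D \<gamma>
    - (K \<gamma> - N) * D \<alpha> = 0"
    by simp
  moreover have "(K \<alpha> - (1 + 2 * \<gamma> ^ 3)) * D \<gamma>
    - (K \<gamma> - N) * D \<alpha>
    = 27 / 160 * (1 - \<alpha>\<^sup>2) ^ 4 * ((3 * \<alpha> + 1) * (3 * \<alpha>\<^sup>2 - 1))"
    unfolding N_def K_def D_def \<gamma>_def by (simp add: field_simps eval_nat_numeral)
  ultimately have "(1 - \<alpha>\<^sup>2) ^ 4 * ((3 * \<alpha> + 1) * (3 * \<alpha>\<^sup>2 - 1)) = 0" by simp
  moreover have "1 - \<alpha>\<^sup>2 \<noteq> 0" "3 * \<alpha> + 1 \<noteq> 0"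
    using sigma2_pos alpha_nonneg by (auto simp: \<sigma>2_def)
  ultimately have a2: "\<alpha> * \<alpha> = 1 / 3" by (simp add: power2_eq_square)
  then have "\<gamma> = 0" by (simp add: \<gamma>_def power2_eq_square)
  have ss: "\<sigma> * \<sigma> = 2 / 3" using s2 a2 by simp
\<comment> \<open>The second neighbour \<open>z\<close> was reached through \<open>y\<close>; the point \<open>z2\<close> is reached through \<open>y2\<close>
  on the side facing \<open>z\<close>.\<close>
  define u2 where "u2 = (- 1 / 2) *\<^sub>R u + r *\<^sub>R w"
  have xw: "cross3 x w = - u"
    using F' by (simp add: w_def Lagrange)
  have cu2: "cross3 x u2 = (- r) *\<^sub>R u + (- 1 / 2) *\<^sub>R w"
    unfolding u2_def cross_add_right cross_mult_right xw w_def[symmetric] by simp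
  have "u2 \<bullet> u2 = 1" "x \<bullet> u2 = 0"
    using ip[of 0 "- 1 / 2" r 0 "- 1 / 2" r] r2 F' by (simp_all add: u2_def inner_add_right inner_diff_right)
  then have F2: "orthonormal_frame x u2 (cross3 x u2)" by (intro cross_frame unit[OF x])
  have y2u: "y2 = \<alpha> *\<^sub>R x + \<sigma> *\<^sub>R u2"
    by (simp add: y2_def u2_def algebra_simps)
  define z2 where "z2 = \<gamma> *\<^sub>R x + (- (3 / 4 * \<alpha> * \<sigma>) + r * r * \<sigma>) *\<^sub>R u + (3 / 2 * \<alpha> * \<sigma> * r + r * \<sigma> / 2) *\<^sub>R w"
  have "z2 \<in> nbr y2"
  proof -
    have "z2 = (3 / 2 * \<alpha>\<^sup>2 - 1 / 2) *\<^sub>R x + (3 / 2 * \<alpha> * \<sigma>) *\<^sub>R u2 + ((- 1) * (sqrt 3 / 2 * \<sigma>)) *\<^sub>R cross3 x u2"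
      unfolding cu2 by (simp add: z2_def u2_def \<gamma>_def vec_eq_iff r_def[symmetric] algebra_simps)
    then show ?thesis
      using second_neighbour[OF v x nyx(2) F2 y2u, of "- 1"] by simp
  qed
  then have z2X: "z2 \<in> X" by (rule nbrD)
  have "z \<bullet> z2 = \<gamma> * \<gamma> + (3 / 2 * \<alpha> * \<sigma>) * (- (3 / 4 * \<alpha> * \<sigma>) + r * r * \<sigma>)
      + (r * \<sigma>) * (3 / 2 * \<alpha> * \<sigma> * r + r * \<sigma> / 2)"
    unfolding z_def z2_def ip ..
  also have "\<dots> = \<gamma> * \<gamma> - 9 / 8 * (\<alpha> * \<alpha>) * (\<sigma> * \<sigma>) + 3 * \<alpha> * (r * r) * (\<sigma> * \<sigma>) + 1 / 2 * (r * r) * (\<sigma> * \<sigma>)"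
    by (simp add: algebra_simps)
  also have "\<dots> = 3 / 2 * \<alpha>"
    unfolding \<open>\<gamma> = 0\<close> a2 ss r2 by simp
  finally have zz2: "z \<bullet> z2 = 3 / 2 * \<alpha>" .
  have "\<alpha> > 0" using a2 alpha_nonneg by (cases "\<alpha> = 0") auto
  then have "z = z2" using inner_le_alpha[OF zX z2X] zz2 by force
  then have "3 / 2 * \<alpha> = 1" using zz2 unit[OF z2X] by simp
  then have "\<alpha> = 2 / 3" by simp
  then show False using a2 unfolding \<open>\<alpha> = 2 / 3\<close> by simp
qed

lemma rotation_rotation:
  assumes x: "x \<in> X"
  shows "rotation \<theta> x (rotation \<phi> x y) = rotation (\<theta> + \<phi>) x y"
proof -
  obtain u where F: "orthonormal_frame x u (cross3 x u)"
    using cross_frame_exists[OF unit[OF x]] by blast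
  show ?thesis
    by (rule eq_if_coordinates_eq[OF F])
      (simp_all only: tc_rotation[OF F] rotation_coordinates(1)[OF F] mult.assoc cis_mult add.commute)
qed

lemma rotation_0: "rotation 0 x y = y"
  by (simp add: rotation_def)

lemma valency_4:
  assumes v: "valency = 4"
  shows "\<alpha> = 0" and "x \<in> X \<Longrightarrow> - x \<in> X"
proof -
  have c: "cos (2 * pi / real valency) = 0"
    by (simp add: v)
  show a: "\<alpha> = 0" using consecutive_neighbours_adjacent by (simp add: c)
  show "- x \<in> X" if x: "x \<in> X"
  proof -
    obtain y where y: "y \<in> nbr x" using nbr_nonempty[OF x] by blast
    note yX = nbrD(1)[OF y] and xy = nbr_sym[OF x y]
    have th: "2 * pi * of_int 2 / real valency = pi" by (simp add: v)
    have "rotation (2 * pi * of_int 2 / real valency) y x = - x"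
      unfolding th rotation_adjacent[OF xy] by (simp add: a)
    then have "- x \<in> nbr y" using rotation_nbr[OF yX xy, of 2] by simp
    then show ?thesis by (rule nbrD)
  qed
qed

text \<open>
  With \<open>c = cos (2 * pi / 5)\<close>, the equation \<open>cos (2 * \<theta>) = cos (3 * \<theta>)\<close> for \<open>\<theta> = 2 * pi / 5\<close> gives \<open>4 * c\<^sup>2 + 2 * c = 1\<close>. The point
  \<open>- x\<close> is found by rotating twice: as \<open>\<alpha> * (1 - cos (2 * \<theta>)) = - cos (2 * \<theta>)\<close>, for a neighbour \<open>z\<close> of \<open>y\<close> the
  rotation of \<open>y\<close> about \<open>z\<close> by \<open>2 * \<theta>\<close> is the antipode of the rotation of \<open>z\<close> about \<open>y\<close> by \<open>2 * \<theta>\<close>.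
\<close>

lemma valency_5:
  assumes v: "valency = 5"
  shows "\<alpha>\<^sup>2 = 1 / 5" and "\<alpha> > 0" and "\<alpha> * (1 - cos (4 * pi / 5)) = - cos (4 * pi / 5)"
    and "cos (2 * pi / 5) > 0" and "cos (4 * pi / 5) < - 1 / 2" and "x \<in> X \<Longrightarrow> - x \<in> X"
proof -
  define c c' where "c = cos (2 * pi / 5)" and "c' = cos (4 * pi / 5)"
  have pos: "c > 0"
    unfolding c_def by (rule cos_gt_zero) auto
  have "c < cos 0"
    unfolding c_def by (rule cos_monotone_0_pi) auto
  then have lt: "c < 1" by simp
  have c': "c' = 2 * c\<^sup>2 - 1"
    using cos_double_cos[of "2 * pi / 5"] by (simp add: c_def c'_def)
  have "cos (3 * (2 * pi / 5)) = cos (2 * pi - 4 * pi / 5)" by (rule arg_cong[where f = cos]) simp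
  also have "\<dots> = c'" by (simp only: cos_2pi_minus c'_def)
  finally have "c' = 4 * c ^ 3 - 3 * c"
    using cos_treble_cos[of "2 * pi / 5"] by (simp add: c_def)
  then have "(c - 1) * (4 * c\<^sup>2 + 2 * c - 1) = 0"
    unfolding c' by (simp add: algebra_simps power2_eq_square power3_eq_cube)
  then have q: "4 * c\<^sup>2 + 2 * c - 1 = 0" using lt by simp
  have a: "\<alpha> * (1 - c) = c"
    using consecutive_neighbours_adjacent pos by (simp add: v c_def)
  then have apos: "\<alpha> > 0" using pos lt alpha_nonneg by (cases "\<alpha> = 0") auto
  have "\<alpha>\<^sup>2 * (1 - c)\<^sup>2 = c\<^sup>2" using a by (metis power_mult_distrib)
  moreover have "(1 - c)\<^sup>2 = 5 * c\<^sup>2" using q by (simp add: power2_eq_square algebra_simps)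
  ultimately have "(5 * \<alpha>\<^sup>2 - 1) * c\<^sup>2 = 0" by (simp add: algebra_simps)
  then have a2: "\<alpha>\<^sup>2 = 1 / 5" using pos by simp
  have "(\<alpha> * (1 - c') + c') * (1 - c) = (\<alpha> * (1 - c)) * (1 - c') + c' * (1 - c)"
    by (simp add: algebra_simps)
  also have "\<dots> = c * (1 - c') + c' * (1 - c)" by (simp only: a)
  also have "\<dots> = 0" unfolding c' using q by algebra
  finally have ac': "\<alpha> * (1 - c') = - c'" using lt by simp
  have "c < 1 / 2"
  proof (rule ccontr)
    assume "\<not> ?thesis"
    then have "(1 / 2) * (1 / 2) \<le> c * c" by (intro mult_mono) auto
    then show False using q pos by (simp add: power2_eq_square)
  qed
  moreover have "2 * c' = - 1 - 2 * c" using c' q by (simp add: algebra_simps)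
  ultimately have "c' < - 1 / 2" using pos by simp
  show "\<alpha>\<^sup>2 = 1 / 5" "\<alpha> > 0" by fact+
  show "\<alpha> * (1 - cos (4 * pi / 5)) = - cos (4 * pi / 5)" using ac' by (simp add: c'_def)
  show "cos (2 * pi / 5) > 0" using pos by (simp add: c_def)
  show "cos (4 * pi / 5) < - 1 / 2" using \<open>c' < - 1 / 2\<close> by (simp add: c'_def)
  show "- x \<in> X" if x: "x \<in> X"
  proof -
    obtain y where y: "y \<in> nbr x" using nbr_nonempty[OF x] by blast
    note yX = nbrD(1)[OF y] and xy = nbr_sym[OF x y]
    define z where "z = rotation (2 * pi * of_int (- 2) / real valency) y x"
    have z: "z \<in> nbr y" unfolding z_def by (rule rotation_nbr[OF yX xy])
    have th: "2 * pi * real_of_int 2 / real valency = 4 * pi / 5" by (simp add: v)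
    have "rotation (2 * pi * of_int 2 / real valency) y z = x"
      unfolding z_def rotation_rotation[OF yX] by (simp add: rotation_0 flip: add_divide_distrib)
    then have "x = (\<alpha> * (1 - c')) *\<^sub>R y + c' *\<^sub>R z + sin (4 * pi / 5) *\<^sub>R cross3 y z"
      unfolding th rotation_adjacent[OF z] c'_def by simp
    moreover have "rotation (2 * pi * of_int 2 / real valency) z y
        = (\<alpha> * (1 - c')) *\<^sub>R z + c' *\<^sub>R y - sin (4 * pi / 5) *\<^sub>R cross3 y z"
      unfolding th rotation_adjacent[OF nbr_sym[OF yX z]] c'_def cross_skew[of z y] by simp
    ultimately have "rotation (2 * pi * of_int 2 / real valency) z y = - x"
      unfolding ac' by simp
    then have "- x \<in> nbr z"
      using rotation_nbr[OF nbrD(1)[OF z] nbr_sym[OF yX z], of 2] by simp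
    then show ?thesis by (rule nbrD)
  qed
qed

text \<open>
  For \<open>\<alpha> = 1/3\<close> the second neighbours of \<open>y\<close> are the antipodes of its neighbours.
\<close>

lemma valency_3_antipodal:
  assumes v: "valency = 3" and x: "x \<in> X"
  shows "- x \<in> X"
proof -
  obtain y where y: "y \<in> nbr x" using nbr_nonempty[OF x] by blast
  note yX = nbrD(1)[OF y] and xy = nbr_sym[OF x y]
  have "\<not> nbr y \<subseteq> {x}"
    using card_mono[of "{x}" "nbr y"] card_nbr[OF yX] v by auto
  then obtain z where z: "z \<in> nbr y" "z \<noteq> x" by blast
  obtain u where F: "orthonormal_frame y u (cross3 y u)" and zu: "z = \<alpha> *\<^sub>R y + \<sigma> *\<^sub>R u"
    using nbr_frame[OF yX z(1)] by blast
  have a: "3 / 2 * \<alpha>\<^sup>2 - 1 / 2 = - \<alpha>" "3 / 2 * \<alpha> * \<sigma> = \<sigma> / 2"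
    unfolding alpha_valency_3[OF v] by (simp_all add: power2_eq_square)
  note s = second_neighbour[OF v yX z(1) F zu, unfolded a]
  from xy[unfolded three_neighbours(1)[OF v yX z(1) F zu]] z(2)
  consider "x = \<alpha> *\<^sub>R y + (- \<sigma> / 2) *\<^sub>R u + (sqrt 3 / 2 * \<sigma>) *\<^sub>R cross3 y u"
    | "x = \<alpha> *\<^sub>R y + (- \<sigma> / 2) *\<^sub>R u - (sqrt 3 / 2 * \<sigma>) *\<^sub>R cross3 y u"
    by blast
  then show ?thesis
  proof cases
    case 1
    then have "- x = (- \<alpha>) *\<^sub>R y + (\<sigma> / 2) *\<^sub>R u + ((- 1) * (sqrt 3 / 2 * \<sigma>)) *\<^sub>R cross3 y u"
      by simp
    then show ?thesis using s[of "- 1"] nbrD(1)[of "- x" z] by simp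
  next
    case 2
    then have "- x = (- \<alpha>) *\<^sub>R y + (\<sigma> / 2) *\<^sub>R u + (1 * (sqrt 3 / 2 * \<sigma>)) *\<^sub>R cross3 y u"
      by simp
    then show ?thesis using s[of 1] nbrD(1)[of "- x" z] by simp
  qed
qed

lemma antipodal: "x \<in> X \<Longrightarrow> - x \<in> X"
  using valency_cases valency_3_antipodal valency_4(2) valency_5(6) by blast

text \<open>
  The points on the right form a tight frame too: \<open>real valency * (3 * \<alpha>\<^sup>2 - 1) / 2 = - 1\<close> for both values of \<open>\<alpha>\<close>.
  The squares of the inner products of a further point \<open>z\<close> with them would be at most \<open>\<alpha>\<^sup>2\<close>, because \<open>X\<close> is antipodal,
  and their sum would be too small.
\<close>

lemma X_eq_odd_valency:
  assumes v: "valency = 3 \<or> valency = 5" and x: "x \<in> X"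
  shows "X = {x, - x} \<union> nbr x \<union> uminus ` nbr x"
proof (rule equalityI; rule subsetI)
  fix z assume "z \<in> {x, - x} \<union> nbr x \<union> uminus ` nbr x"
  then show "z \<in> X" using x antipodal nbrD(1) by auto
next
  fix z assume z: "z \<in> X"
  show "z \<in> {x, - x} \<union> nbr x \<union> uminus ` nbr x"
  proof (rule ccontr)
    assume n: "z \<notin> {x, - x} \<union> nbr x \<union> uminus ` nbr x"
    have small: "(y \<bullet> z)\<^sup>2 \<le> \<alpha>\<^sup>2" if "y \<in> X" "z \<noteq> y" "z \<noteq> - y" for y
    proof -
      have "y \<bullet> z \<le> \<alpha>" "(- y) \<bullet> z \<le> \<alpha>"
        using inner_le_alpha[of y z] inner_le_alpha[of "- y" z] z that antipodal[OF that(1)] by auto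
      then show ?thesis by (simp add: abs_le_square_iff[symmetric] abs_le_iff)
    qed
    have "(\<Sum>y\<in>nbr x. (y \<bullet> z)\<^sup>2) \<le> (\<Sum>y\<in>nbr x. \<alpha>\<^sup>2)"
      using n nbrD(1) by (intro sum_mono small) auto
    then have 1: "(\<Sum>y\<in>nbr x. (y \<bullet> z)\<^sup>2) \<le> real valency * \<alpha>\<^sup>2"
      using card_nbr[OF x] by simp
    have 2: "(x \<bullet> z)\<^sup>2 \<le> \<alpha>\<^sup>2" using small[OF x] n by auto
    have 3: "(\<Sum>y\<in>nbr x. (y \<bullet> z)\<^sup>2)
        = real valency * (1 - \<alpha>\<^sup>2) / 2 + real valency * (3 * \<alpha>\<^sup>2 - 1) / 2 * (x \<bullet> z)\<^sup>2"
      using sum_nbr_square[OF x, of z] by (simp add: unit z)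
    from v show False
    proof
      assume k: "valency = 3"
      have a: "\<alpha>\<^sup>2 = 1 / 9" unfolding alpha_valency_3[OF k] by (simp add: power2_eq_square)
      show False using 1[unfolded k a] 2[unfolded a] 3[unfolded k a] by simp
    next
      assume k: "valency = 5"
      note a = valency_5(1)[OF k]
      show False using 1[unfolded k a] 2[unfolded a] 3[unfolded k a] by simp
    qed
  qed
qed

lemma X_eq_valency_4:
  assumes v: "valency = 4" and x: "x \<in> X"
  shows "X = {x, - x} \<union> nbr x"
proof -
  have "z \<in> nbr x" if "z \<in> X" "z \<noteq> x" "z \<noteq> - x" for z
  proof -
    have "x \<bullet> z \<le> 0" "(- x) \<bullet> z \<le> 0"
      using inner_le_alpha[of x z] inner_le_alpha[of "- x" z] that x antipodal[OF x] valency_4(1)[OF v] by auto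
    then have "x \<bullet> z = \<alpha>" using valency_4(1)[OF v] by simp
    then show ?thesis using that by (simp add: nbr_def)
  qed
  then show ?thesis using x antipodal[OF x] nbrD(1)[of _ x] by auto
qed

end

section \<open>Polytopes inscribed in the unit sphere\<close>

text \<open>
  A face of the convex hull of a finite set is the hull of some of its points.
\<close>

lemma convex_hull_Int_supporting_hyperplane:
  fixes A :: "'a::euclidean_space set"
  assumes fin: "finite A" and le: "\<And>x. x \<in> A \<Longrightarrow> a \<bullet> x \<le> b"
  shows "convex hull A \<inter> {x. a \<bullet> x = b} = convex hull {x \<in> A. a \<bullet> x = b}" (is "?F = convex hull ?Y")
    and "convex hull {x \<in> A. a \<bullet> x = b} face_of convex hull A"
proof -
  have "convex hull A \<subseteq> {x. a \<bullet> x \<le> b}"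
    using le by (intro hull_minimal convex_halfspace_le) auto
  then have face: "?F face_of convex hull A"
    by (intro face_of_Int_supporting_hyperplane_le convex_convex_hull) auto
  then obtain S where S: "S \<subseteq> A" "?F = convex hull S"
    using face_of_convex_hull_subset[OF finite_imp_compact[OF fin]] by metis
  have "S \<subseteq> ?F" unfolding S(2) by (rule hull_subset)
  then have "S \<subseteq> ?Y" using S(1) by auto
  then have "?F \<subseteq> convex hull ?Y" unfolding S(2) by (rule hull_mono)
  moreover have "convex hull ?Y \<subseteq> ?F"
    by (intro hull_minimal convex_Int convex_convex_hull convex_hyperplane) (auto intro: hull_inc)
  ultimately show eq: "?F = convex hull ?Y" by blast
  show "convex hull ?Y face_of convex hull A" using face unfolding eq .
qed

lemma extreme_points_of_spherical_hull:
  fixes A :: "'a::euclidean_space set"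
  assumes fin: "finite A" and unit: "\<And>x. x \<in> A \<Longrightarrow> x \<bullet> x = 1"
  shows "{v. v extreme_point_of (convex hull A)} = A"
proof (intro equalityI subsetI)
  fix v assume "v \<in> {v. v extreme_point_of (convex hull A)}"
  then show "v \<in> A" using extreme_point_of_convex_hull by blast
next
  fix v assume v: "v \<in> A"
  have le: "v \<bullet> x \<le> 1" if "x \<in> A" for x
    using norm_cauchy_schwarz[of v x] unit v that by (simp add: norm_eq_sqrt_inner)
  have "x = v" if "x \<in> A" "v \<bullet> x = 1" for x
  proof -
    have "(x - v) \<bullet> (x - v) = 0"
      using that unit v by (simp add: inner_diff_left inner_diff_right inner_commute)
    then show ?thesis by simp
  qed
  then have "{x \<in> A. v \<bullet> x = 1} = {v}" using v unit by auto
  then have "convex hull A \<inter> {x. v \<bullet> x = 1} = {v}"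
    using convex_hull_Int_supporting_hyperplane(1)[OF fin le] by simp
  moreover have "convex hull A \<subseteq> {x. v \<bullet> x \<le> 1}"
    using le by (intro hull_minimal convex_halfspace_le) auto
  ultimately show "v \<in> {v. v extreme_point_of (convex hull A)}"
    using extreme_point_of_Int_supporting_hyperplane_le[of "convex hull A" v 1 v] by auto
qed

text \<open>
  The last condition, together with \<open>centred\<close>, puts 0 in the interior of the convex hull.
\<close>

locale centred_sphere_set =
  fixes X :: "(real ^ 3) set"
  assumes finite_X: "finite X" and nonempty: "X \<noteq> {}"
    and unit: "x \<in> X \<Longrightarrow> x \<bullet> x = 1"
    and centred: "(\<Sum>x\<in>X. x) = 0"
    and spanning: "(\<And>x. x \<in> X \<Longrightarrow> x \<bullet> a = 0) \<Longrightarrow> a = 0"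
begin

lemma hyperplane_offset:
  assumes "a \<noteq> 0" and le: "\<And>x. x \<in> X \<Longrightarrow> a \<bullet> x \<le> b"
  shows "b > 0"
proof (rule ccontr)
  assume "\<not> b > 0"
  then have neg: "a \<bullet> x \<le> 0" if "x \<in> X" for x using le[OF that] by simp
  have "(\<Sum>x\<in>X. - (a \<bullet> x)) = 0"
    using arg_cong[OF centred, of "\<lambda>v. a \<bullet> v"] by (simp add: inner_sum_right sum_negf)
  then have "- (a \<bullet> x) = 0" if "x \<in> X" for x
    using sum_nonneg_eq_0_iff[OF finite_X, of "\<lambda>x. - (a \<bullet> x)"] neg that by auto
  then have "a = 0" by (intro spanning) (simp add: inner_commute)
  then show False using \<open>a \<noteq> 0\<close> by simp
qed

lemma aff_dim_X: "aff_dim X = 3"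
proof (rule ccontr)
  assume "aff_dim X \<noteq> 3"
  moreover have "aff_dim X \<le> 3" using aff_dim_le_DIM[of X] by simp
  ultimately have "aff_dim X < DIM(real ^ 3)" by simp
  then obtain a b where ab: "a \<noteq> 0" "X \<subseteq> {x. a \<bullet> x = b}"
    by (rule aff_lowdim_subset_hyperplane)
  have "b > 0" using ab by (intro hyperplane_offset[of a b]) auto
  moreover have "- b > 0" using ab by (intro hyperplane_offset[of "- a" "- b"]) auto
  ultimately show False by simp
qed

lemma convex_polyhedron_hull: "convex_polyhedron (convex hull X)"
  using finite_X by (auto simp: convex_polyhedron_def polytope_def aff_dim_convex_hull aff_dim_X)

lemma vertices_hull: "polyhedron_vertices (convex hull X) = X"
  using extreme_points_of_spherical_hull[OF finite_X unit] by (simp add: polyhedron_vertices_def)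

lemma hull_inj:
  assumes "A \<subseteq> X" "B \<subseteq> X" "convex hull A = convex hull B"
  shows "A = B"
proof -
  have "A = {v. v extreme_point_of (convex hull A)}"
    using assms(1) finite_subset[OF _ finite_X] unit
    by (intro extreme_points_of_spherical_hull[symmetric]) auto
  also have "\<dots> = {v. v extreme_point_of (convex hull B)}" using assms(3) by simp
  also have "\<dots> = B"
    using assms(2) finite_subset[OF _ finite_X] unit
    by (intro extreme_points_of_spherical_hull) auto
  finally show ?thesis .
qed

lemma X_Int_hull:
  assumes A: "A \<subseteq> X" and v: "v \<in> X"
  shows "v \<in> convex hull A \<longleftrightarrow> v \<in> A"
proof
  assume vA: "v \<in> convex hull A"
  have "v extreme_point_of (convex hull X)"
    using extreme_points_of_spherical_hull[OF finite_X unit] v by auto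
  then have "v extreme_point_of (convex hull A)"
    using vA hull_mono[OF A, of convex] by (auto simp: extreme_point_of_def)
  then show "v \<in> A" by (rule extreme_point_of_convex_hull)
qed (rule hull_inc)

lemma facet_iff:
  "F facet_of (convex hull X) \<longleftrightarrow>
     (\<exists>a b. b > 0 \<and> (\<forall>x\<in>X. a \<bullet> x \<le> b) \<and> aff_dim {x \<in> X. a \<bullet> x = b} = 2 \<and> F = convex hull {x \<in> X. a \<bullet> x = b})"
proof
  assume F: "F facet_of (convex hull X)"
  have "polyhedron (convex hull X)"
    using finite_X by (intro polytope_imp_polyhedron) (auto simp: polytope_def)
  then obtain a b where ab: "a \<noteq> 0" "convex hull X \<subseteq> {x. a \<bullet> x \<le> b}" "F = convex hull X \<inter> {x. a \<bullet> x = b}"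
    using facet_of_polyhedron F by metis
  have le: "a \<bullet> x \<le> b" if "x \<in> X" for x using ab(2) hull_inc[OF that] by auto
  have "F = convex hull {x \<in> X. a \<bullet> x = b}"
    unfolding ab(3) by (rule convex_hull_Int_supporting_hyperplane(1)[OF finite_X le])
  moreover from this have "aff_dim {x \<in> X. a \<bullet> x = b} = 2"
    using F aff_dim_X by (simp add: facet_of_def aff_dim_convex_hull)
  ultimately show "\<exists>a b. b > 0 \<and> (\<forall>x\<in>X. a \<bullet> x \<le> b) \<and> aff_dim {x \<in> X. a \<bullet> x = b} = 2 \<and> F = convex hull {x \<in> X. a \<bullet> x = b}"
    using le hyperplane_offset[OF ab(1) le] by blast
next
  assume "\<exists>a b. b > 0 \<and> (\<forall>x\<in>X. a \<bullet> x \<le> b) \<and> aff_dim {x \<in> X. a \<bullet> x = b} = 2 \<and> F = convex hull {x \<in> X. a \<bullet> x = b}"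
  then obtain a b where ab: "\<And>x. x \<in> X \<Longrightarrow> a \<bullet> x \<le> b" "aff_dim {x \<in> X. a \<bullet> x = b} = 2" "F = convex hull {x \<in> X. a \<bullet> x = b}"
    by blast
  then have "F face_of (convex hull X)"
    using convex_hull_Int_supporting_hyperplane(2)[OF finite_X ab(1)] by simp
  moreover have "F \<noteq> {}"
  proof
    assume "F = {}"
    then have "{x \<in> X. a \<bullet> x = b} = {}" unfolding ab(3) convex_hull_eq_empty .
    then show False using ab(2) by (simp only: aff_dim_empty)
  qed
  moreover have "aff_dim F = aff_dim (convex hull X) - 1"
    using ab(2,3) by (simp add: aff_dim_convex_hull aff_dim_X)
  ultimately show "F facet_of (convex hull X)" by (simp add: facet_of_def)
qed

end

text \<open>
  A linear dependence with coefficients of sum 0, paired with a point \<open>x\<close> of the set, reduces to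
  \<open>(1 - \<alpha>)\<close> times the coefficient of \<open>x\<close>.
\<close>

lemma aff_dim_equiangular:
  fixes A :: "(real ^ 3) set"
  assumes fin: "finite A" and unit: "\<And>x. x \<in> A \<Longrightarrow> x \<bullet> x = 1"
    and ang: "\<And>x y. x \<in> A \<Longrightarrow> y \<in> A \<Longrightarrow> x \<noteq> y \<Longrightarrow> x \<bullet> y = \<alpha>" and lt: "\<alpha> \<noteq> 1"
  shows "aff_dim A = int (card A) - 1"
proof -
  have "\<not> affine_dependent A"
  proof
    assume "affine_dependent A"
    then obtain U where U: "sum U A = 0" "\<exists>v\<in>A. U v \<noteq> 0" "(\<Sum>v\<in>A. U v *\<^sub>R v) = 0"
      using affine_dependent_explicit_finite[OF fin] by blast
    have "U x = 0" if x: "x \<in> A" for x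
    proof -
      have "0 = (\<Sum>v\<in>A. U v * (v \<bullet> x))"
        using arg_cong[OF U(3), of "\<lambda>v. v \<bullet> x"] by (simp add: inner_sum_left)
      also have "\<dots> = U x * (x \<bullet> x) + (\<Sum>v\<in>A - {x}. U v * (v \<bullet> x))"
        by (rule sum.remove[OF fin x])
      also have "(\<Sum>v\<in>A - {x}. U v * (v \<bullet> x)) = (\<Sum>v\<in>A - {x}. U v) * \<alpha>"
        unfolding sum_distrib_right using ang x by (intro sum.cong) auto
      also have "(\<Sum>v\<in>A - {x}. U v) = - U x"
        using U(1) sum.remove[OF fin x, of U] by simp
      finally have "U x * (1 - \<alpha>) = 0" by (simp add: unit x algebra_simps)
      then show ?thesis using lt by simp
    qed
    then show False using U(2) by blast
  qed
  then show ?thesis using aff_dim_affine_independent[of A] by simp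
qed

lemma cos_sin_240: "cos (pi * 4 / 3) = - 1 / 2" "sin (pi * 4 / 3) = - sqrt 3 / 2"
  using cos_add[of pi "pi / 3"] sin_add[of pi "pi / 3"] cos_60 sin_60
  by (simp_all add: field_simps)

text \<open>
  The frame of the polygon points to the vertex \<open>x\<close> and along the opposite side, whose length is \<open>sqrt 3 * \<rho>\<close>.
\<close>

lemma regular_triangle:
  fixes x y z :: "real ^ 3"
  assumes u: "x \<bullet> x = 1" "y \<bullet> y = 1" "z \<bullet> z = 1" and a: "x \<bullet> y = \<alpha>" "x \<bullet> z = \<alpha>" "y \<bullet> z = \<alpha>" and lt: "\<alpha> < 1"
  shows "regular_polygon 3 (sqrt ((2 - 2 * \<alpha>) / 3)) (convex hull {x, y, z})"
proof -
  define \<rho> where "\<rho> = sqrt ((2 - 2 * \<alpha>) / 3)"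
  have \<rho>: "\<rho> > 0" "\<rho> * \<rho> = (2 - 2 * \<alpha>) / 3" using lt by (simp_all add: \<rho>_def)
  define c u w where "c = (1 / 3) *\<^sub>R (x + y + z)" and "u = (1 / \<rho>) *\<^sub>R (x - c)"
    and "w = (1 / (sqrt 3 * \<rho>)) *\<^sub>R (y - z)"
  note ip = inner_add_left inner_add_right inner_diff_left inner_diff_right
  have a': "y \<bullet> x = \<alpha>" "z \<bullet> x = \<alpha>" "z \<bullet> y = \<alpha>" using a by (simp_all add: inner_commute)
  have "(x - c) \<bullet> (x - c) = \<rho> * \<rho>"
    unfolding \<rho>(2) by (simp add: c_def ip assms(1-6) a' field_simps)
  then have "norm u = 1" using \<rho>(1) by (simp add: u_def norm_eq_sqrt_inner)
  moreover have "(y - z) \<bullet> (y - z) = 3 * (\<rho> * \<rho>)"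
    unfolding \<rho>(2) by (simp add: ip assms(1-6) a')
  then have "norm w = 1" using \<rho>(1) by (simp add: w_def norm_eq_sqrt_inner real_sqrt_mult)
  moreover have "(x - c) \<bullet> (y - z) = 0"
    by (simp add: c_def ip assms(1-6) a' field_simps)
  then have "u \<bullet> w = 0" by (simp add: u_def w_def)
  moreover have "{x, y, z} = (\<lambda>k. c + (\<rho> * cos (2 * pi * real k / real 3)) *\<^sub>R u
      + (\<rho> * sin (2 * pi * real k / real 3)) *\<^sub>R w) ` {..<3}"
  proof -
    have "{..<3::nat} = {0, 1, 2}" by auto
    moreover have "c + \<rho> *\<^sub>R u = x" using \<rho>(1) by (simp add: u_def)
    moreover have "c + (\<rho> * (- 1 / 2)) *\<^sub>R u + (\<rho> * (sqrt 3 / 2)) *\<^sub>R w = y"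
      using \<rho>(1) by (simp add: u_def w_def c_def vec_eq_iff field_simps)
    moreover have "c + (\<rho> * (- 1 / 2)) *\<^sub>R u + (\<rho> * (- sqrt 3 / 2)) *\<^sub>R w = z"
      using \<rho>(1) by (simp add: u_def w_def c_def vec_eq_iff field_simps)
    moreover have "cos (2 * pi * real 1 / real 3) = - 1 / 2" "sin (2 * pi * real 1 / real 3) = sqrt 3 / 2"
      using cos_120 sin_120 by simp_all
    moreover have "cos (2 * pi * real 2 / real 3) = - 1 / 2" "sin (2 * pi * real 2 / real 3) = - sqrt 3 / 2"
      using cos_sin_240 by (simp_all add: mult.commute)
    ultimately show ?thesis by (simp only: image_insert image_empty) simp
  qed
  ultimately show ?thesis
    using \<rho>(1) unfolding regular_polygon_def \<rho>_def[symmetric] by (intro conjI exI[of _ c] exI[of _ u] exI[of _ w]) auto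
qed

text \<open>
  The triples of points that are going to be the vertices of the faces.
\<close>

definition cliques :: "real \<Rightarrow> (real ^ 3) set \<Rightarrow> (real ^ 3) set set" where
  "cliques \<alpha> X = {Y. Y \<subseteq> X \<and> card Y = 3 \<and> (\<forall>y\<in>Y. \<forall>z\<in>Y. y \<noteq> z \<longrightarrow> y \<bullet> z = \<alpha>)}"

text \<open>
  By \<open>blocked\<close>, two points of a facet are at inner product \<open>\<alpha>\<close>: otherwise \<open>z\<close> or \<open>z'\<close> would lie
  beyond its plane, since \<open>z + z'\<close> is longer than \<open>x + y\<close> in the same direction. For \<open>y = - x\<close> this reads
  \<open>0 = 0\<close>, in accordance with the fact that no facet contains antipodal points.
\<close>

locale triangular_sphere_set = centred_sphere_set +
  fixes \<alpha> :: real
  assumes alpha_less_1: "\<alpha> < 1"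
    and inner_le_alpha: "x \<in> X \<Longrightarrow> y \<in> X \<Longrightarrow> x \<noteq> y \<Longrightarrow> x \<bullet> y \<le> \<alpha>"
    and blocked: "x \<in> X \<Longrightarrow> y \<in> X \<Longrightarrow> x \<noteq> y \<Longrightarrow> x \<bullet> y \<noteq> \<alpha> \<Longrightarrow>
      \<exists>z\<in>X. \<exists>z'\<in>X. \<exists>t>1. z + z' = t *\<^sub>R (x + y)"
begin

text \<open>
  Conversely the sum of the points of a clique is a normal vector of a supporting plane: its
  inner product with them is \<open>1 + 2 * \<alpha>\<close>, and with other points it is at most \<open>3 * \<alpha>\<close>.
\<close>

lemma triangular_facet_iff: "F facet_of (convex hull X) \<longleftrightarrow> (\<exists>Y \<in> cliques \<alpha> X. F = convex hull Y)"
proof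
  assume "F facet_of (convex hull X)"
  then obtain a b where b: "b > 0" and le: "\<And>x. x \<in> X \<Longrightarrow> a \<bullet> x \<le> b"
    and dim: "aff_dim {x \<in> X. a \<bullet> x = b} = 2" and F: "F = convex hull {x \<in> X. a \<bullet> x = b}"
    by (auto simp: facet_iff)
  define Y where "Y = {x \<in> X. a \<bullet> x = b}"
  have ang: "x \<bullet> y = \<alpha>" if "x \<in> Y" "y \<in> Y" "x \<noteq> y" for x y
  proof (rule ccontr)
    assume "x \<bullet> y \<noteq> \<alpha>"
    moreover have "x \<in> X" "y \<in> X" using that by (simp_all add: Y_def)
    ultimately obtain z z' t where z: "z \<in> X" "z' \<in> X" "t > 1" "z + z' = t *\<^sub>R (x + y)"
      using blocked[of x y] \<open>x \<noteq> y\<close> by blast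
    have "a \<bullet> z + a \<bullet> z' = t * (2 * b)"
      using arg_cong[OF z(4), of "\<lambda>v. a \<bullet> v"] that by (simp add: inner_add_right Y_def)
    moreover have "a \<bullet> z + a \<bullet> z' \<le> 2 * b" using le[OF z(1)] le[OF z(2)] by simp
    ultimately show False using b z(3) by simp
  qed
  have "finite Y" "\<And>x. x \<in> Y \<Longrightarrow> x \<bullet> x = 1" using finite_X unit by (auto simp: Y_def)
  then have "aff_dim Y = int (card Y) - 1"
    using alpha_less_1 by (intro aff_dim_equiangular[OF _ _ ang]) auto
  then have "card Y = 3" using dim by (simp add: Y_def)
  moreover have "Y \<subseteq> X" by (auto simp: Y_def)
  ultimately have "Y \<in> cliques \<alpha> X" using ang unfolding cliques_def by blast
  then show "\<exists>Y \<in> cliques \<alpha> X. F = convex hull Y" using F unfolding Y_def by blast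
next
  assume "\<exists>Y \<in> cliques \<alpha> X. F = convex hull Y"
  then obtain Y where Y: "Y \<subseteq> X" "card Y = 3" "\<And>y z. y \<in> Y \<Longrightarrow> z \<in> Y \<Longrightarrow> y \<noteq> z \<Longrightarrow> y \<bullet> z = \<alpha>"
    and F: "F = convex hull Y"
    by (auto simp: cliques_def)
  obtain x y z where xyz: "Y = {x, y, z}" "x \<noteq> y" "x \<noteq> z" "y \<noteq> z"
    using Y(2) by (auto simp: card_3_iff)
  have m: "x \<in> Y" "y \<in> Y" "z \<in> Y" by (simp_all add: xyz(1))
  define a where "a = x + y + z"
  have X: "x \<in> X" "y \<in> X" "z \<in> X" using Y(1) xyz(1) by auto
  have on: "a \<bullet> v = 1 + 2 * \<alpha>" if "v \<in> Y" for v
  proof -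
    have "x \<bullet> y = \<alpha>" "x \<bullet> z = \<alpha>" "y \<bullet> z = \<alpha>" "y \<bullet> x = \<alpha>" "z \<bullet> x = \<alpha>" "z \<bullet> y = \<alpha>"
      using Y(3) m xyz(2-4) by (metis inner_commute)+
    then show ?thesis
      using that unit[OF X(1)] unit[OF X(2)] unit[OF X(3)] by (auto simp: xyz(1) a_def inner_add_left)
  qed
  have off: "a \<bullet> v < 1 + 2 * \<alpha>" if "v \<in> X" "v \<notin> Y" for v
    using that inner_le_alpha[of x v] inner_le_alpha[of y v] inner_le_alpha[of z v] X alpha_less_1
    by (auto simp: xyz(1) a_def inner_add_left)
  have YX: "{v \<in> X. a \<bullet> v = 1 + 2 * \<alpha>} = Y" using on off Y(1) by fastforce
  have le: "\<forall>v\<in>X. a \<bullet> v \<le> 1 + 2 * \<alpha>" using on off by (metis less_imp_le order_refl)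
  have "aff_dim Y = 2"
  proof -
    have "\<And>x. x \<in> Y \<Longrightarrow> x \<bullet> x = 1" using Y(1) unit by blast
    then have "aff_dim Y = int (card Y) - 1"
      using finite_subset[OF Y(1) finite_X] alpha_less_1 by (intro aff_dim_equiangular[OF _ _ Y(3)]) auto
    then show ?thesis using Y(2) by simp
  qed
  moreover have "a \<noteq> 0"
  proof
    assume "a = 0"
    then have "\<alpha> = - 1 / 2" using on[of x] xyz(1) by simp
    then have "v \<in> Y" if "v \<in> X" for v using off[OF that] \<open>a = 0\<close> by auto
    then have "X = Y" using Y(1) by blast
    then show False using aff_dim_X \<open>aff_dim Y = 2\<close> by simp
  qed
  then have "1 + 2 * \<alpha> > 0" using le by (intro hyperplane_offset[of a]) auto
  ultimately show "F facet_of (convex hull X)"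
    unfolding facet_iff using le F YX by (intro exI[of _ a] exI[of _ "1 + 2 * \<alpha>"]) auto
qed

lemma regular_polyhedron_hull:
  assumes q: "\<And>v. v \<in> X \<Longrightarrow> card {Y \<in> cliques \<alpha> X. v \<in> Y} = q"
  shows "regular_polyhedron 3 q (convex hull X)"
proof -
  have "regular_polygon 3 (sqrt ((2 - 2 * \<alpha>) / 3)) F" if F: "F facet_of (convex hull X)" for F
  proof -
    obtain Y where Y: "Y \<subseteq> X" "card Y = 3" "\<And>y z. y \<in> Y \<Longrightarrow> z \<in> Y \<Longrightarrow> y \<noteq> z \<Longrightarrow> y \<bullet> z = \<alpha>"
      and FY: "F = convex hull Y"
      using F by (auto simp: triangular_facet_iff cliques_def)
    obtain x y z where xyz: "Y = {x, y, z}" "x \<noteq> y" "x \<noteq> z" "y \<noteq> z"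
      using Y(2) by (auto simp: card_3_iff)
    have X: "x \<in> X" "y \<in> X" "z \<in> X" and m: "x \<in> Y" "y \<in> Y" "z \<in> Y" using Y(1) by (simp_all add: xyz(1))
    show ?thesis
      unfolding FY xyz(1)
      by (rule regular_triangle[OF unit[OF X(1)] unit[OF X(2)] unit[OF X(3)] Y(3)[OF m(1,2) xyz(2)]
            Y(3)[OF m(1,3) xyz(3)] Y(3)[OF m(2,3) xyz(4)] alpha_less_1])
  qed
  moreover have "card {F. F facet_of (convex hull X) \<and> v \<in> F} = q" if v: "v \<in> X" for v
  proof -
    have "{F. F facet_of (convex hull X) \<and> v \<in> F} = (\<lambda>Y. convex hull Y) ` {Y \<in> cliques \<alpha> X. v \<in> Y}"
      using X_Int_hull[OF _ v] by (auto simp: triangular_facet_iff cliques_def)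
    moreover have "inj_on (\<lambda>Y. convex hull Y) {Y \<in> cliques \<alpha> X. v \<in> Y}"
      using hull_inj by (auto simp: inj_on_def cliques_def)
    ultimately show ?thesis using q[OF v] by (simp add: card_image)
  qed
  ultimately show ?thesis
    using convex_polyhedron_hull by (auto simp: regular_polyhedron_def vertices_hull)
qed

end

section \<open>The regular tetrahedron, octahedron and icosahedron\<close>

sublocale tight_sphere_set \<subseteq> hull: centred_sphere_set X
proof
  show "a = 0" if "\<And>x. x \<in> X \<Longrightarrow> x \<bullet> a = 0" for a
    using that by (rule orthogonal_all_zero)
qed (use finite_X nonempty unit centred in auto)

lemma (in tight_sphere_set) tetrahedron:
  assumes ang: "\<And>x y. x \<in> X \<Longrightarrow> y \<in> X \<Longrightarrow> x \<noteq> y \<Longrightarrow> x \<bullet> y = - 1 / 3"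
  shows "card X = 4" and "regular_tetrahedron (convex hull X)"
proof -
  obtain x where x: "x \<in> X" using nonempty by blast
  have "0 = (\<Sum>y\<in>X. y \<bullet> x)" by (simp add: sum_inner)
  also have "\<dots> = x \<bullet> x + (\<Sum>y\<in>X - {x}. y \<bullet> x)" by (rule sum.remove[OF finite_X x])
  also have "(\<Sum>y\<in>X - {x}. y \<bullet> x) = (\<Sum>y\<in>X - {x}. - 1 / 3)"
    using ang x by (intro sum.cong) auto
  also have "\<dots> = (real (card X) - 1) * (- 1 / 3)"
    using x finite_X card_pos by (simp add: of_nat_diff)
  finally show card: "card X = 4" by (simp add: unit x)
  interpret triangular_sphere_set X "- 1 / 3"
    by unfold_locales (use ang in auto)
  show "regular_tetrahedron (convex hull X)"
  proof (rule regular_polyhedron_hull)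
    fix v assume v: "v \<in> X"
    have "{Y \<in> cliques (- 1 / 3) X. v \<in> Y} = (\<lambda>w. X - {w}) ` (X - {v})"
    proof (intro equalityI subsetI)
      fix Y assume "Y \<in> {Y \<in> cliques (- 1 / 3) X. v \<in> Y}"
      then have Y: "Y \<subseteq> X" "card Y = 3" "v \<in> Y" by (auto simp: cliques_def)
      then have "card (X - Y) = 1"
        using card finite_subset[OF Y(1) finite_X] by (simp add: card_Diff_subset)
      then obtain w where "X - Y = {w}" by (rule card_1_singletonE)
      then have "Y = X - {w}" "w \<in> X - {v}" using Y by auto
      then show "Y \<in> (\<lambda>w. X - {w}) ` (X - {v})" by blast
    next
      fix Y assume "Y \<in> (\<lambda>w. X - {w}) ` (X - {v})"
      then show "Y \<in> {Y \<in> cliques (- 1 / 3) X. v \<in> Y}"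
        using ang card v finite_X by (auto simp: cliques_def)
    qed
    moreover have "inj_on (\<lambda>w. X - {w}) (X - {v})" by (auto simp: inj_on_def)
    ultimately show "card {Y \<in> cliques (- 1 / 3) X. v \<in> Y} = 3"
      using card v finite_X by (simp add: card_image)
  qed
qed

context nearest_neighbours
begin

lemma not_in_nbr: "x \<in> X \<Longrightarrow> x \<notin> nbr x" "x \<in> X \<Longrightarrow> - x \<notin> nbr x"
  using alpha_less_1 alpha_nonneg by (auto simp: nbr_def unit)

lemma not_self_antipodal:
  assumes x: "x \<in> X"
  shows "x \<noteq> - x"
proof
  assume "x = - x"
  from arg_cong[OF this, of "\<lambda>v. x \<bullet> v"] show False using unit[OF x] by simp
qed

lemma card_X_odd_valency:
  assumes v: "valency = 3 \<or> valency = 5"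
  shows "card X = 2 + 2 * valency"
proof -
  obtain x where x: "x \<in> X" using nonempty by blast
  have apos: "\<alpha> > 0" using v alpha_valency_3 valency_5(2) by auto
  have False if "z \<in> nbr x" "- z \<in> nbr x" for z
    using nbrD(2)[OF that(1)] nbrD(2)[OF that(2)] apos by simp
  then have "nbr x \<inter> uminus ` nbr x = {}" by blast
  then have "card (nbr x \<union> uminus ` nbr x) = 2 * valency"
    using card_nbr[OF x] finite_nbr[of x] by (simp add: card_Un_disjoint card_image)
  moreover have "x \<notin> uminus ` nbr x" "- x \<notin> uminus ` nbr x"
    using not_in_nbr[OF x] by (auto simp: image_iff minus_equation_iff)
  then have "- x \<notin> nbr x \<union> uminus ` nbr x" "x \<notin> insert (- x) (nbr x \<union> uminus ` nbr x)"
    using not_in_nbr[OF x] not_self_antipodal[OF x] by blast+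
  moreover have "X = insert x (insert (- x) (nbr x \<union> uminus ` nbr x))"
    using X_eq_odd_valency[OF v x] by blast
  from arg_cong[OF this, of card] have "card X = card (insert x (insert (- x) (nbr x \<union> uminus ` nbr x)))" .
  ultimately show ?thesis
    using finite_nbr[of x] by simp
qed

lemma card_X_valency_4:
  assumes v: "valency = 4"
  shows "card X = 6"
proof -
  obtain x where x: "x \<in> X" using nonempty by blast
  have "- x \<notin> nbr x" "x \<notin> insert (- x) (nbr x)"
    using not_in_nbr[OF x] not_self_antipodal[OF x] by blast+
  moreover have "X = insert x (insert (- x) (nbr x))"
    using X_eq_valency_4[OF v x] by blast
  from arg_cong[OF this, of card] have "card X = card (insert x (insert (- x) (nbr x)))" .
  ultimately show ?thesis
    using card_nbr[OF x] finite_nbr[of x] v by simp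
qed

text \<open>
  By \<open>rotation_inner\<close> the left-hand side is the inner product of two consecutive neighbours of a point.
\<close>

lemma alpha_step: "valency \<in> {4, 5} \<Longrightarrow> \<alpha>\<^sup>2 + \<sigma>2 * cos (2 * pi / real valency) = \<alpha>"
proof -
  assume v: "valency \<in> {4, 5}"
  define c where "c = cos (2 * pi / real valency)"
  have "c \<ge> 0"
    using v valency_5(4) by (auto simp: c_def)
  then have "\<alpha> * (1 - c) = c" using consecutive_neighbours_adjacent by (simp add: c_def)
  moreover have "\<alpha>\<^sup>2 + \<sigma>2 * c - \<alpha> = (1 - \<alpha>) * (c - \<alpha> * (1 - c))"
    by (simp add: \<sigma>2_def power2_eq_square algebra_simps)
  ultimately show ?thesis by (simp add: c_def)
qed

text \<open>
  The points next to a vertex of a square or a regular pentagon are recognised by their distance.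
\<close>

lemma cos_valency_eq:
  assumes v: "valency \<in> {4, 5}" and j: "j < valency" and eq: "cos (2 * pi * real j / real valency) = cos (2 * pi / real valency)"
  shows "j = 1 \<or> j = valency - 1"
proof -
  have c5: "cos (2 * pi / 5) \<noteq> 1" "cos (4 * pi / 5) < 0" "cos (6 * pi / 5) < 0" "cos (2 * pi / 5) > 0" if "valency = 5"
  proof -
    have "cos (2 * pi / 5) < cos 0" by (rule cos_monotone_0_pi) auto
    then show "cos (2 * pi / 5) \<noteq> 1" by simp
    show *: "cos (4 * pi / 5) < 0" using valency_5(5)[OF that] by simp
    have "cos (6 * pi / 5) = cos (2 * pi - 4 * pi / 5)" by (rule arg_cong[where f = cos]) simp
    then show "cos (6 * pi / 5) < 0" using * by (simp only: cos_2pi_minus)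
    show "cos (2 * pi / 5) > 0" using valency_5(4)[OF that] .
  qed
  from v consider "valency = 4" | "valency = 5" by auto
  then show ?thesis
  proof cases
    case 1
    then have "j = 0 \<or> j = 1 \<or> j = 2 \<or> j = 3" using j by auto
    then show ?thesis using eq 1 by auto
  next
    case 2
    then have "j = 0 \<or> j = 1 \<or> j = 2 \<or> j = 3 \<or> j = 4" using j by auto
    then show ?thesis using eq 2 c5[OF 2] by auto
  qed
qed

text \<open>
  The cliques at \<open>x\<close> correspond to the sides \<open>{y, \<rho> y}\<close> of the polygon of its neighbours, where \<open>\<rho>\<close> rotates by one step.
\<close>

lemma card_cliques:
  assumes v: "valency \<in> {4, 5}" and x: "x \<in> X"
  shows "card {Y \<in> cliques \<alpha> X. x \<in> Y} = valency"
proof -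
  define \<rho> where "\<rho> = rotation (2 * pi / real valency) x"
  have \<rho>_nbr: "\<rho> y \<in> nbr x" if "y \<in> nbr x" for y
    using rotation_nbr[OF x that, of 1] by (simp add: \<rho>_def)
  have \<rho>_inner: "\<rho> y \<bullet> y = \<alpha>" if "y \<in> nbr x" for y
    using rotation_inner[OF x that] alpha_step[OF v] by (simp add: \<rho>_def)
  have adj: "z = \<rho> y \<or> y = \<rho> z" if y: "y \<in> nbr x" and z: "z \<in> nbr x" and yz: "z \<bullet> y = \<alpha>" for y z
  proof -
    obtain j where j: "j < valency" "z = rotation (2 * pi * real j / real valency) x y"
      by (rule nbr_is_rotation[OF x y z])
    have "\<alpha>\<^sup>2 + \<sigma>2 * cos (2 * pi * real j / real valency) = \<alpha>\<^sup>2 + \<sigma>2 * cos (2 * pi / real valency)"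
      using yz rotation_inner[OF x y] alpha_step[OF v] by (simp add: j(2))
    then have "cos (2 * pi * real j / real valency) = cos (2 * pi / real valency)"
      using sigma2_pos by simp
    then have "j = 1 \<or> j = valency - 1" by (rule cos_valency_eq[OF v j(1)])
    then show ?thesis
    proof
      assume "j = 1"
      then show ?thesis using j(2) by (simp add: \<rho>_def)
    next
      assume "j = valency - 1"
      then have "2 * pi / real valency + 2 * pi * real j / real valency = 2 * pi"
        using v by auto
      then have "\<rho> z = rotation (2 * pi) x y"
        by (simp only: \<rho>_def j(2) rotation_rotation[OF x])
      then show ?thesis by (simp add: rotation_def)
    qed
  qed
  have step2: "\<rho> (\<rho> y) \<noteq> y" if y: "y \<in> nbr x" for y
  proof
    assume "\<rho> (\<rho> y) = y"
    then have "rotation (4 * pi / real valency) x y \<bullet> y = 1"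
      using unit[OF nbrD(1)[OF y]] by (simp add: \<rho>_def rotation_rotation[OF x])
    then have "\<alpha>\<^sup>2 + \<sigma>2 * cos (4 * pi / real valency) = 1"
      using rotation_inner[OF x y, of "4 * pi / real valency"] by simp
    then have "\<sigma>2 * cos (4 * pi / real valency) = \<sigma>2 * 1"
      using \<sigma>2_def by linarith
    then have "cos (4 * pi / real valency) = 1" using sigma2_pos by simp
    then show False using v valency_5(5) by auto
  qed
  have ne: "y \<noteq> x" "\<rho> y \<noteq> x" "y \<noteq> \<rho> y" if "y \<in> nbr x" for y
    using that \<rho>_nbr[OF that] \<rho>_inner[OF that] not_in_nbr(1)[OF x] unit[OF nbrD(1)[OF that]] alpha_less_1
    by (metis less_irrefl)+
  let ?T = "\<lambda>y. {x, y, \<rho> y}"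
  have "{Y \<in> cliques \<alpha> X. x \<in> Y} = ?T ` nbr x"
  proof (intro equalityI subsetI)
    fix Y assume "Y \<in> {Y \<in> cliques \<alpha> X. x \<in> Y}"
    then have Y: "Y \<subseteq> X" "card Y = 3" "\<And>y z. y \<in> Y \<Longrightarrow> z \<in> Y \<Longrightarrow> y \<noteq> z \<Longrightarrow> y \<bullet> z = \<alpha>" "x \<in> Y"
      by (auto simp: cliques_def)
    have "card (Y - {x}) = 2" using Y(2,4) by simp
    then obtain y z where yz: "Y - {x} = {y, z}" "y \<noteq> z" by (auto simp: card_2_iff)
    then have mem: "y \<in> Y" "z \<in> Y" "y \<noteq> x" "z \<noteq> x" by auto
    then have "y \<in> nbr x" "z \<in> nbr x" using Y(1) Y(3)[OF Y(4)] by (auto simp: nbr_def)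
    moreover have "z \<bullet> y = \<alpha>" using Y(3)[OF mem(2,1)] yz(2) by simp
    ultimately have "z = \<rho> y \<or> y = \<rho> z" by (rule adj)
    moreover have "Y = {x, y, z}" "Y = {x, z, y}" using yz(1) Y(4) by auto
    ultimately show "Y \<in> ?T ` nbr x" using \<open>y \<in> nbr x\<close> \<open>z \<in> nbr x\<close> by blast
  next
    fix Y assume "Y \<in> ?T ` nbr x"
    then obtain y where y: "y \<in> nbr x" and Y: "Y = {x, y, \<rho> y}" by blast
    have "y \<bullet> \<rho> y = \<alpha>" "x \<bullet> y = \<alpha>" "y \<bullet> x = \<alpha>" "x \<bullet> \<rho> y = \<alpha>" "\<rho> y \<bullet> x = \<alpha>"
      using \<rho>_inner[OF y] nbrD[OF y] nbrD[OF \<rho>_nbr[OF y]] by (simp_all add: inner_commute)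
    then show "Y \<in> {Y \<in> cliques \<alpha> X. x \<in> Y}"
      using ne[OF y] \<rho>_inner[OF y] x nbrD(1)[OF y] nbrD(1)[OF \<rho>_nbr[OF y]]
      by (auto simp: cliques_def Y)
  qed
  moreover have "inj_on ?T (nbr x)"
  proof (rule inj_onI, rule ccontr)
    fix y z assume y: "y \<in> nbr x" and z: "z \<in> nbr x" and eq: "?T y = ?T z" and "y \<noteq> z"
    then have "y = \<rho> z" "z = \<rho> y" using ne[OF y] ne[OF z] by (metis insert_iff singletonD)+
    then show False using step2[OF y] by simp
  qed
  ultimately show ?thesis using card_nbr[OF x] by (simp add: card_image)
qed

text \<open>
  In the icosahedron, if \<open>x\<close> and \<open>y\<close> are at distance two, then \<open>- y\<close> is a neighbour of \<open>x\<close>. Rotating it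
  about \<open>x\<close> by \<open>4 * pi / 5\<close> in both directions gives the two common neighbours of \<open>x\<close> and \<open>y\<close>; the factor \<open>t\<close>
  is the golden ratio.
\<close>

lemma blocked_pair:
  assumes v: "valency \<in> {4, 5}" and x: "x \<in> X" and y: "y \<in> X" and ne: "x \<noteq> y" "x \<bullet> y \<noteq> \<alpha>"
  shows "\<exists>z\<in>X. \<exists>z'\<in>X. \<exists>t>1. z + z' = t *\<^sub>R (x + y)"
proof (cases "y = - x")
  case True
  have "x + - x = 2 *\<^sub>R (x + y)" "(2::real) > 1" by (simp_all add: True)
  then show ?thesis using x antipodal[OF x] by blast
next
  case False
  have "y \<notin> nbr x" using ne by (simp add: nbr_def)
  then have v5: "valency = 5"
    using v X_eq_valency_4[of x] x y ne(1) False by auto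
  then have "y \<in> uminus ` nbr x"
    using X_eq_odd_valency[of x] x y ne(1) False \<open>y \<notin> nbr x\<close> by auto
  then obtain w where w: "w \<in> nbr x" "y = - w" by blast
  define \<theta> where "\<theta> = 4 * pi / 5"
  have th: "2 * pi * of_int 2 / real valency = \<theta>" "2 * pi * of_int (- 2) / real valency = - \<theta>"
    by (simp_all add: v5 \<theta>_def)
  have mem: "rotation \<theta> x w \<in> X" "rotation (- \<theta>) x w \<in> X"
    using rotation_nbr[OF x w(1), of 2] rotation_nbr[OF x w(1), of "- 2"] unfolding th by (simp_all add: nbrD)
  have a: "\<alpha> * (1 - cos \<theta>) = - cos \<theta>" using valency_5(3)[OF v5] by (simp add: \<theta>_def)
  have "rotation \<theta> x w + rotation (- \<theta>) x w = (- 2 * cos \<theta>) *\<^sub>R (x + y)"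
    unfolding rotation_adjacent[OF w(1)] cos_minus sin_minus a w(2) by (simp add: algebra_simps vec_eq_iff)
  moreover have "- 2 * cos \<theta> > 1" using valency_5(5)[OF v5] by (simp add: \<theta>_def)
  ultimately show ?thesis using mem by blast
qed

lemma octahedron_or_icosahedron:
  assumes v: "valency \<in> {4, 5}"
  shows "regular_polyhedron 3 valency (convex hull X)"
proof -
  interpret tri: triangular_sphere_set X \<alpha>
    by unfold_locales (use alpha_less_1 inner_le_alpha blocked_pair[OF v] in auto)
  show ?thesis by (rule tri.regular_polyhedron_hull) (rule card_cliques[OF v])
qed

end

section \<open>The cube\<close>

abbreviation signs :: "real set" where
  "signs \<equiv> {1 / sqrt 3, - (1 / sqrt 3)}"

definition cube_vertices :: "(real ^ 3) set" where
  "cube_vertices = {v. \<forall>i. v $ i \<in> signs}"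

text \<open>
  Reflecting one coordinate maps the cube to itself and moves a vertex along an edge.
\<close>

definition flip :: "3 \<Rightarrow> real ^ 3 \<Rightarrow> real ^ 3" where
  "flip i v = (\<chi> j. if j = i then - v $ j else v $ j)"

definition cube_face :: "3 \<Rightarrow> real \<Rightarrow> (real ^ 3) set" where
  "cube_face i e = {v \<in> cube_vertices. v $ i = e}"

lemma sqrt3_inverse: "1 / sqrt 3 > (0::real)" "(1 / sqrt 3) * (1 / sqrt 3) = (1 / 3 :: real)"
  by simp_all

lemma flip_nth: "flip i v $ j = (if j = i then - v $ j else v $ j)"
  by (simp add: flip_def)

lemma flip_cube: "v \<in> cube_vertices \<Longrightarrow> flip i v \<in> cube_vertices"
  by (auto simp: cube_vertices_def flip_nth)

lemma flip_inner: "flip i v \<bullet> a = v \<bullet> a - 2 * (v $ i * a $ i)"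
  using exhaust_3[of i] by (auto simp: inner_vec_def sum_3 flip_nth)

lemma cube_vertices_subset:
  "cube_vertices \<subseteq> (\<lambda>(a, b, c). vector [a, b, c]) `
     (signs \<times> signs \<times> signs)"
proof
  fix v assume v: "v \<in> cube_vertices"
  have S: "v $ i \<in> signs" for i
    using v by (simp add: cube_vertices_def)
  show "v \<in> (\<lambda>(a, b, c). vector [a, b, c]) `
     (signs \<times> signs \<times> signs)"
  proof (rule image_eqI[of _ _ "(v $ 1, v $ 2, v $ 3)"])
    show "v = (case (v $ 1, v $ 2, v $ 3) of (a, b, c) \<Rightarrow> vector [a, b, c])"
      by (simp add: vec_eq_iff forall_3 vector_3)
  qed (intro SigmaI S)
qed

lemma finite_cube_vertices: "finite cube_vertices"
  by (rule finite_subset[OF cube_vertices_subset]) simp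

lemma card_cube_vertices_le: "card cube_vertices \<le> 8"
proof -
    have "card cube_vertices \<le> card ((\<lambda>(a, b, c). vector [a, b, c] :: real ^ 3) ` (signs \<times> signs \<times> signs))"
    by (rule card_mono[OF _ cube_vertices_subset]) simp
  also have "\<dots> \<le> card (signs \<times> signs \<times> signs)" by (rule card_image_le) simp
  also have "\<dots> \<le> 8" by (simp add: card_cartesian_product card_insert_if)
  finally show ?thesis .
qed

lemma cube_vertex_nonzero: "v \<in> cube_vertices \<Longrightarrow> v $ i \<noteq> 0"
proof -
  assume "v \<in> cube_vertices"
  then have "v $ i \<in> signs" by (simp add: cube_vertices_def)
  then show ?thesis by auto
qed

lemma other_index:
  fixes i :: 3
  obtains j where "i \<noteq> j"
proof (rule ccontr)
  assume "\<not> thesis"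
  then have "j \<in> {i}" for j using that[of j] by blast
  then have "UNIV = {i}" by blast
  then have "CARD(3) = card {i}" by simp
  then show False by simp
qed

lemma third_index:
  fixes i j :: 3
  assumes "i \<noteq> j"
  obtains k where "k \<noteq> i" "k \<noteq> j" "\<And>l. l = i \<or> l = j \<or> l = k"
proof -
  have "card (UNIV - {i, j}) = 1" using assms by (simp add: card_Diff_subset)
  then obtain k where "UNIV - {i, j} = {k}" by (rule card_1_singletonE)
  then show thesis using that[of k] by blast
qed

lemma cube_vertexI:
  assumes "\<And>i. e i \<in> signs"
  shows "(\<chi> i. e i) \<in> cube_vertices"
  using assms by (simp add: cube_vertices_def)

interpretation cube: centred_sphere_set cube_vertices
proof
  let ?c = "(\<chi> i. 1 / sqrt 3) :: real ^ 3"
  have c: "?c \<in> cube_vertices" by (rule cube_vertexI) simp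
  show "finite cube_vertices" by (rule finite_cube_vertices)
  show "cube_vertices \<noteq> {}" using c by blast
  show "x \<bullet> x = 1" if "x \<in> cube_vertices" for x
  proof -
    have "x $ i * x $ i = 1 / 3" for i
    proof -
      have "x $ i \<in> signs" using that by (simp add: cube_vertices_def)
      then show ?thesis by auto
    qed
    then have "x \<bullet> x = (\<Sum>i\<in>(UNIV :: 3 set). 1 / 3)" by (simp only: inner_vec_def inner_real_def)
    then show ?thesis by simp
  qed
  have "(\<Sum>x\<in>cube_vertices. x) = (\<Sum>x\<in>cube_vertices. - x)"
    by (rule sum.reindex_bij_witness[of _ uminus uminus]) (auto simp: cube_vertices_def minus_equation_iff)
  then have neg: "(\<Sum>x\<in>cube_vertices. x) = - (\<Sum>x\<in>cube_vertices. x)" by (simp only: sum_negf)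
  have "S = 0" if "S = - S" for S :: "real ^ 3"
  proof -
    have "S $ i = 0" for i using arg_cong[OF that, of "\<lambda>v. v $ i"] by simp
    then show ?thesis by (simp add: vec_eq_iff)
  qed
  then show "(\<Sum>x\<in>cube_vertices. x) = 0" using neg by blast
  show "a = 0" if a: "\<And>x. x \<in> cube_vertices \<Longrightarrow> x \<bullet> a = 0" for a
  proof -
    have "a $ i = 0" for i
      using a[OF c] a[OF flip_cube[OF c, of i]] unfolding flip_inner by simp
    then show ?thesis by (simp add: vec_eq_iff)
  qed
qed

text \<open>
  Of three collinear points one lies between the others, but every vertex is an extreme point.
\<close>

lemma aff_dim_ge_2_if_three_vertices:
  assumes "A \<subseteq> cube_vertices" and "a \<in> A" "b \<in> A" "c \<in> A" and ne: "a \<noteq> b" "a \<noteq> c" "b \<noteq> c"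
  shows "aff_dim A \<ge> 2"
proof (rule ccontr)
  assume "\<not> aff_dim A \<ge> 2"
  then have "aff_dim {a, b, c} \<le> 1"
    using aff_dim_subset[of "{a, b, c}" A] assms by auto
  then have "collinear {a, b, c}" by (simp add: collinear_aff_dim)
  then have "a \<in> closed_segment b c \<or> b \<in> closed_segment c a \<or> c \<in> closed_segment a b"
    by (simp add: collinear_between_cases between_mem_segment)
  moreover have "x \<in> {y, z}" if "x \<in> closed_segment y z" "x \<in> A" "y \<in> A" "z \<in> A" for x y z
    using cube.X_Int_hull[of "{y, z}" x] that assms(1) by (auto simp: segment_convex_hull)
  ultimately show False using assms by blast
qed

lemma cube_face_signs:
  assumes "e \<in> signs" and ij: "i \<noteq> j" and ik: "i \<noteq> k" and jk: "j \<noteq> k"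
    and all: "\<And>l. l = i \<or> l = j \<or> l = k"
  shows "cube_face i e = (\<lambda>(p, q). e *\<^sub>R axis i 1 + p *\<^sub>R axis j 1 + q *\<^sub>R axis k 1) `
    (signs \<times> signs)"
proof (intro equalityI subsetI)
  fix v assume "v \<in> cube_face i e"
  then have v: "v $ i = e" "v $ j \<in> signs" "v $ k \<in> signs"
    by (auto simp: cube_face_def cube_vertices_def)
  have "v $ l = (e *\<^sub>R axis i 1 + v $ j *\<^sub>R axis j 1 + v $ k *\<^sub>R axis k 1) $ l" for l
    using all[of l] ij ik jk v(1) by (auto simp: axis_def)
  then have "v = e *\<^sub>R axis i 1 + v $ j *\<^sub>R axis j 1 + v $ k *\<^sub>R axis k 1" by (subst vec_eq_iff) blast
  then show "v \<in> (\<lambda>(p, q). e *\<^sub>R axis i 1 + p *\<^sub>R axis j 1 + q *\<^sub>R axis k 1) `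
    (signs \<times> signs)"
    using v(2,3) by (intro image_eqI[of _ _ "(v $ j, v $ k)"]) auto
next
  fix v :: "real ^ 3"
  assume "v \<in> (\<lambda>(p, q). e *\<^sub>R axis i 1 + p *\<^sub>R axis j 1 + q *\<^sub>R axis k 1) `
    (signs \<times> signs)"
  then obtain t where t: "t \<in> signs \<times> signs"
    and vt: "v = (case t of (p, q) \<Rightarrow> e *\<^sub>R axis i 1 + p *\<^sub>R axis j 1 + q *\<^sub>R axis k 1)" by (rule imageE)
  obtain p q where tpq: "t = (p, q)" by (cases t)
  have pq: "p \<in> signs" "q \<in> signs"
    using t unfolding tpq by blast+
  have v: "v = e *\<^sub>R axis i 1 + p *\<^sub>R axis j 1 + q *\<^sub>R axis k 1" using vt unfolding tpq by simp
  have "v $ i = e" "v $ j = p" "v $ k = q" using ij ik jk by (auto simp: v axis_def)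
  then have "v $ l \<in> signs" for l using all[of l] assms(1) pq by blast
  then show "v \<in> cube_face i e" using \<open>v $ i = e\<close> by (simp add: cube_face_def cube_vertices_def)
qed

lemma cube_face_square:
  assumes e: "e \<in> signs"
  shows "regular_polygon 4 (sqrt 2 / sqrt 3) (convex hull (cube_face i e))"
proof -
  obtain j :: 3 where ij: "i \<noteq> j" by (rule other_index)
  obtain k where k: "k \<noteq> i" "k \<noteq> j" and all: "\<And>l. l = i \<or> l = j \<or> l = k"
    using third_index[OF ij] by blast
  define s :: real where "s = 1 / sqrt 3"
  define u w where "u = (1 / sqrt 2) *\<^sub>R (axis j 1 + axis k 1 :: real ^ 3)"
    and "w = (1 / sqrt 2) *\<^sub>R (axis j 1 - axis k 1 :: real ^ 3)"
  have "norm u = 1" "norm w = 1" "u \<bullet> w = 0"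
    using k(2) by (simp_all add: u_def w_def norm_eq_sqrt_inner inner_add_left inner_add_right
        inner_diff_left inner_diff_right inner_axis_axis)
  moreover have "cube_face i e = (\<lambda>n. e *\<^sub>R axis i 1 + (sqrt 2 / sqrt 3 * cos (2 * pi * real n / real 4)) *\<^sub>R u
      + (sqrt 2 / sqrt 3 * sin (2 * pi * real n / real 4)) *\<^sub>R w) ` {..<4}"
  proof -
    have four: "{..<4::nat} = {0, 1, 2, 3}" by auto
    have trig: "cos (pi * 3 / 2) = 0" "sin (pi * 3 / 2) = - 1"
      using cos_3over2_pi sin_3over2_pi by (simp_all add: mult.commute)
    have su: "(sqrt 2 / sqrt 3) *\<^sub>R u = s *\<^sub>R axis j 1 + s *\<^sub>R axis k 1"
      "(sqrt 2 / sqrt 3) *\<^sub>R w = s *\<^sub>R axis j 1 - s *\<^sub>R axis k 1"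
      by (simp_all add: u_def w_def s_def scaleR_add_right scaleR_diff_right)
    have "cube_face i e = {e *\<^sub>R axis i 1 + s *\<^sub>R axis j 1 + s *\<^sub>R axis k 1, e *\<^sub>R axis i 1 + s *\<^sub>R axis j 1 - s *\<^sub>R axis k 1,
       e *\<^sub>R axis i 1 - s *\<^sub>R axis j 1 - s *\<^sub>R axis k 1, e *\<^sub>R axis i 1 - s *\<^sub>R axis j 1 + s *\<^sub>R axis k 1}"
      unfolding cube_face_signs[OF e ij k(1)[symmetric] k(2)[symmetric] all] s_def[symmetric] by auto
    also have "\<dots> = {e *\<^sub>R axis i 1 + (sqrt 2 / sqrt 3) *\<^sub>R u, e *\<^sub>R axis i 1 + (sqrt 2 / sqrt 3) *\<^sub>R w,
        e *\<^sub>R axis i 1 - (sqrt 2 / sqrt 3) *\<^sub>R u, e *\<^sub>R axis i 1 - (sqrt 2 / sqrt 3) *\<^sub>R w}"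
      unfolding su by (simp add: algebra_simps)
    also have "\<dots> = (\<lambda>n. e *\<^sub>R axis i 1 + (sqrt 2 / sqrt 3 * cos (2 * pi * real n / real 4)) *\<^sub>R u
      + (sqrt 2 / sqrt 3 * sin (2 * pi * real n / real 4)) *\<^sub>R w) ` {..<4}"
      unfolding four using trig by simp
    finally show ?thesis .
  qed
  ultimately show ?thesis
    unfolding regular_polygon_def by (intro conjI exI[of _ "e *\<^sub>R axis i 1"] exI[of _ u] exI[of _ w]) auto
qed

text \<open>
  If a linear form \<open>a\<close> is maximal at a vertex, then flipping a coordinate does not increase it; so the sign of
  each coordinate with \<open>a $ i \<noteq> 0\<close> is determined. With two such coordinates at most two vertices would
  remain, which do not span a plane.
\<close>

lemma cube_facet_iff:
  "F facet_of (convex hull cube_vertices) \<longleftrightarrow>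
     (\<exists>i. \<exists>e\<in>signs. F = convex hull (cube_face i e))"
proof
  assume "F facet_of (convex hull cube_vertices)"
  then obtain a b where b: "b > 0" and le: "\<And>x. x \<in> cube_vertices \<Longrightarrow> a \<bullet> x \<le> b"
    and dim: "aff_dim {x \<in> cube_vertices. a \<bullet> x = b} = 2" and F: "F = convex hull {x \<in> cube_vertices. a \<bullet> x = b}"
    by (auto simp: cube.facet_iff)
  define Y where "Y = {x \<in> cube_vertices. a \<bullet> x = b}"
  have Yc: "Y \<subseteq> cube_vertices" by (auto simp: Y_def)
  have "Y \<noteq> {}" using dim by (auto simp: Y_def[symmetric])
  then obtain y where y: "y \<in> Y" by blast
  have same: "x $ i = y $ i" if x: "x \<in> Y" and ai: "a $ i \<noteq> 0" for x i
  proof -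
    have pos: "v $ i * a $ i > 0" if v: "v \<in> Y" for v
    proof -
      have "a \<bullet> flip i v \<le> a \<bullet> v" using le[OF flip_cube, of v i] v by (auto simp: Y_def)
      then have "v $ i * a $ i \<ge> 0" using flip_inner[of i v a] inner_commute[of a v] inner_commute[of a "flip i v"] by linarith
      moreover have "v $ i \<noteq> 0" using v Yc cube_vertex_nonzero by blast
      ultimately show ?thesis using ai by (metis less_eq_real_def mult_eq_0_iff)
    qed
    have "x $ i \<in> signs" "y $ i \<in> signs"
      using x y by (auto simp: Y_def cube_vertices_def)
    moreover have "0 < (x $ i * a $ i) * (y $ i * a $ i)" using pos[OF x] pos[OF y] by simp
    then have "0 < (x $ i * y $ i) * (a $ i)\<^sup>2" by (simp add: power2_eq_square mult_ac)
    then have "0 < x $ i * y $ i" by (simp add: zero_less_mult_iff)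
    ultimately show ?thesis by auto
  qed
  have "a \<noteq> 0" using b y by (auto simp: Y_def)
  then obtain i where ai: "a $ i \<noteq> 0" by (auto simp: vec_eq_iff)
  have zero: "a $ j = 0" if ij: "j \<noteq> i" for j
  proof (rule ccontr)
    assume aj: "a $ j \<noteq> 0"
    obtain k where k: "\<And>l. l = j \<or> l = i \<or> l = k" using third_index[OF ij] by blast
    have "inj_on (\<lambda>x. x $ k) Y"
    proof (rule inj_onI)
      fix u v assume "u \<in> Y" "v \<in> Y" "u $ k = v $ k"
      then have "u $ l = v $ l" for l
        using k[of l] same[OF _ ai, of u] same[OF _ ai, of v] same[OF _ aj, of u] same[OF _ aj, of v] by auto
      then show "u = v" by (simp add: vec_eq_iff)
    qed
    then have "card Y = card ((\<lambda>x. x $ k) ` Y)" by (simp add: card_image)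
    also have "\<dots> \<le> card signs"
      using Yc by (intro card_mono) (auto simp: cube_vertices_def)
    also have "\<dots> \<le> 2" by (simp add: card_insert_if)
    finally have "card Y \<le> 2" .
    moreover have "aff_dim Y \<le> int (card Y) - 1"
      using finite_subset[OF Yc finite_cube_vertices] by (rule aff_dim_le_card)
    ultimately show False using dim by (simp add: Y_def[symmetric])
  qed
  have a: "a = a $ i *\<^sub>R axis i 1" using zero by (auto simp: vec_eq_iff axis_def)
  have inner: "a \<bullet> v = a $ i * v $ i" for v
    by (subst a) (simp add: inner_axis inner_commute[of "axis i 1"])
  have "Y = cube_face i (y $ i)"
  proof (intro equalityI subsetI)
    fix v assume "v \<in> Y"
    then show "v \<in> cube_face i (y $ i)" using same[OF _ ai] Yc by (auto simp: cube_face_def)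
  next
    fix v assume "v \<in> cube_face i (y $ i)"
    then show "v \<in> Y" using y by (auto simp: cube_face_def Y_def inner)
  qed
  moreover have "y $ i \<in> signs" using y by (auto simp: Y_def cube_vertices_def)
  ultimately show "\<exists>i. \<exists>e\<in>signs. F = convex hull (cube_face i e)"
    using F unfolding Y_def[symmetric] by blast
next
  assume "\<exists>i. \<exists>e\<in>signs. F = convex hull (cube_face i e)"
  then obtain i e where e: "e \<in> signs" and F: "F = convex hull (cube_face i e)" by blast
  define a :: "real ^ 3" where "a = e *\<^sub>R axis i 1"
  have inner: "a \<bullet> v = e * v $ i" for v by (simp add: a_def inner_axis inner_commute[of "axis i 1"])
  have ee: "e * e = 1 / 3" using e sqrt3_inverse by auto
  have le: "a \<bullet> v \<le> 1 / 3" if "v \<in> cube_vertices" for v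
  proof -
    have "v $ i \<in> signs" using that by (simp add: cube_vertices_def)
    then have "v $ i = e \<or> v $ i = - e" using e by auto
    then show ?thesis using ee by (auto simp: inner)
  qed
  have eq: "{v \<in> cube_vertices. a \<bullet> v = 1 / 3} = cube_face i e"
  proof -
    have "e \<noteq> 0" using e sqrt3_inverse by auto
    then have "e * t = 1 / 3 \<longleftrightarrow> t = e" for t unfolding ee[symmetric] by simp
    then show ?thesis by (simp add: cube_face_def inner)
  qed
  have "aff_dim (cube_face i e) \<le> aff_dim {x. a \<bullet> x = 1 / 3}"
    unfolding eq[symmetric] by (intro aff_dim_subset) auto
  moreover have "a \<noteq> 0" using ee inner[of a] by (auto simp: a_def)
  then have "aff_dim {x. a \<bullet> x = 1 / 3} = 2" using aff_dim_hyperplane[of a "1 / 3"] by simp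
  ultimately have "aff_dim (cube_face i e) \<le> 2" by linarith
  moreover have "aff_dim (cube_face i e) \<ge> 2"
  proof -
    define v :: "real ^ 3" where "v = (\<chi> l. e)"
    have v: "v \<in> cube_face i e" using e by (auto simp: v_def cube_face_def cube_vertices_def)
    obtain j :: 3 where ij: "i \<noteq> j" by (rule other_index)
    obtain k where k: "k \<noteq> i" "k \<noteq> j" using third_index[OF ij] by blast
    have fl: "flip l v \<in> cube_face i e" if "l \<noteq> i" for l
      using v that flip_cube by (auto simp: cube_face_def flip_nth)
    have "e \<noteq> 0" using e sqrt3_inverse by auto
    then have "v $ j \<noteq> flip j v $ j" "v $ k \<noteq> flip k v $ k" "flip j v $ j \<noteq> flip k v $ j"
      using k by (auto simp: flip_nth v_def)
    then have "v \<noteq> flip j v" "v \<noteq> flip k v" "flip j v \<noteq> flip k v" by metis+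
    then show ?thesis
      using v fl[OF ij[symmetric]] fl[OF k(1)]
      by (intro aff_dim_ge_2_if_three_vertices[of _ v "flip j v" "flip k v"]) (auto simp: cube_face_def)
  qed
  ultimately have "aff_dim {v \<in> cube_vertices. a \<bullet> v = 1 / 3} = 2" unfolding eq by simp
  then show "F facet_of (convex hull cube_vertices)"
    unfolding cube.facet_iff F eq[symmetric] using le by (intro exI[of _ a] exI[of _ "1 / 3"]) auto
qed

lemma regular_cube: "regular_cube (convex hull cube_vertices)"
proof -
  have "card {F. F facet_of (convex hull cube_vertices) \<and> v \<in> F} = 3" if v: "v \<in> cube_vertices" for v
  proof -
    have sub: "cube_face i e \<subseteq> cube_vertices" for i e by (auto simp: cube_face_def)
    have vi: "v $ i \<in> signs" for i using v by (simp add: cube_vertices_def)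
    have "v \<in> convex hull (cube_face i e) \<longleftrightarrow> e = v $ i" for i e
      using cube.X_Int_hull[OF sub v] v by (auto simp: cube_face_def)
    note on_face = this
    have "{F. F facet_of (convex hull cube_vertices) \<and> v \<in> F} = range (\<lambda>i. convex hull (cube_face i (v $ i)))"
    proof (intro equalityI subsetI)
      fix F assume "F \<in> {F. F facet_of (convex hull cube_vertices) \<and> v \<in> F}"
      then obtain i e where "F = convex hull (cube_face i e)" "v \<in> F"
        by (auto simp only: cube_facet_iff mem_Collect_eq)
      moreover from this have "e = v $ i" using on_face[of i e] by simp
      ultimately show "F \<in> range (\<lambda>i. convex hull (cube_face i (v $ i)))" by blast
    next
      fix F assume "F \<in> range (\<lambda>i. convex hull (cube_face i (v $ i)))"
      then obtain i where F: "F = convex hull (cube_face i (v $ i))" by blast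
      then have "v \<in> F" by (simp only: on_face)
      then show "F \<in> {F. F facet_of (convex hull cube_vertices) \<and> v \<in> F}"
        using F vi[of i] unfolding cube_facet_iff by blast
    qed
    moreover have "inj (\<lambda>i. convex hull (cube_face i (v $ i)))"
    proof (rule injI, rule ccontr)
      fix i j assume eq: "convex hull (cube_face i (v $ i)) = convex hull (cube_face j (v $ j))" and "i \<noteq> j"
      have "cube_face i (v $ i) = cube_face j (v $ j)" by (rule cube.hull_inj[OF sub sub eq])
      moreover have "flip j v \<in> cube_face i (v $ i)"
        using flip_cube[OF v] \<open>i \<noteq> j\<close> by (simp add: cube_face_def flip_nth)
      moreover have "flip j v \<notin> cube_face j (v $ j)"
        using cube_vertex_nonzero[OF v, of j] by (simp add: cube_face_def flip_nth)
      ultimately show False by blast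
    qed
    ultimately show ?thesis by (simp add: card_image)
  qed
  then show ?thesis
    using cube_face_square cube.convex_polyhedron_hull
    unfolding regular_polyhedron_def cube.vertices_hull cube_facet_iff by blast
qed

context nearest_neighbours
begin

text \<open>
  The differences between \<open>x\<close> and its three neighbours are pairwise orthogonal: they are the edges at \<open>x\<close>.
  The frame \<open>g y1, g y2, g y3\<close> points along them, and its coordinate map takes \<open>X\<close> to the standard cube.
\<close>

lemma cube_image:
  assumes v: "valency = 3"
  shows "\<exists>f. orthogonal_transformation f \<and> f ` X = cube_vertices"
proof -
  note a = alpha_valency_3[OF v]
  obtain x where x: "x \<in> X" using nonempty by blast
  have "card (nbr x) = 3" using card_nbr[OF x] v by simp
  then obtain y1 y2 y3 where nb: "nbr x = {y1, y2, y3}" and ne: "y1 \<noteq> y2" "y1 \<noteq> y3" "y2 \<noteq> y3"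
    by (auto simp: card_3_iff)
  have a2: "\<alpha>\<^sup>2 = 1 / 9" unfolding a by (simp add: power2_eq_square)
  then have s2: "\<sigma>2 = 8 / 9" using \<sigma>2_def by linarith
  have far: "z \<bullet> y = - 1 / 3" if y: "y \<in> nbr x" and z: "z \<in> nbr x" and "y \<noteq> z" for y z
  proof -
    obtain j where j: "j < valency" "z = rotation (2 * pi * real j / real valency) x y"
      by (rule nbr_is_rotation[OF x y z])
    have "j \<noteq> 0"
    proof
      assume "j = 0"
      then show False using j(2) \<open>y \<noteq> z\<close> by (simp add: rotation_0)
    qed
    then have "j = 1 \<or> j = 2" using j(1) v by auto
    then have "cos (2 * pi * real j / real valency) = - 1 / 2"
      using cos_sin_120 cos_sin_240 v by (auto simp: mult.commute)
    then show ?thesis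
      unfolding j(2) rotation_inner[OF x y] s2 a2 by simp
  qed
  have mem: "y1 \<in> nbr x" "y2 \<in> nbr x" "y3 \<in> nbr x" using nb by auto
  have ip: "x \<bullet> x = 1" "y1 \<bullet> y1 = 1" "y2 \<bullet> y2 = 1" "y3 \<bullet> y3 = 1"
    "x \<bullet> y1 = 1 / 3" "x \<bullet> y2 = 1 / 3" "x \<bullet> y3 = 1 / 3"
    "y1 \<bullet> x = 1 / 3" "y2 \<bullet> x = 1 / 3" "y3 \<bullet> x = 1 / 3"
    "y1 \<bullet> y2 = - 1 / 3" "y1 \<bullet> y3 = - 1 / 3" "y2 \<bullet> y3 = - 1 / 3"
    "y2 \<bullet> y1 = - 1 / 3" "y3 \<bullet> y1 = - 1 / 3" "y3 \<bullet> y2 = - 1 / 3"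
    using unit[OF x] unit[OF nbrD(1)[OF mem(1)]] unit[OF nbrD(1)[OF mem(2)]] unit[OF nbrD(1)[OF mem(3)]]
      nbrD(2,3)[OF mem(1)] nbrD(2,3)[OF mem(2)] nbrD(2,3)[OF mem(3)]
      far[OF mem(2,1)] far[OF mem(3,1)] far[OF mem(3,2)] far[OF mem(1,2)] far[OF mem(1,3)] far[OF mem(2,3)] ne
    unfolding a by simp_all
  define r where "r = sqrt 3 / 2"
  have r: "r * r = 3 / 4" "r * (2 / 3) = 1 / sqrt 3"
    by (simp_all add: r_def real_div_sqrt field_simps)
  define g where "g y = r *\<^sub>R (x - y)" for y
  have gg: "g y \<bullet> g z = (r * r) * (1 - y \<bullet> x - x \<bullet> z + y \<bullet> z)" for y z
    by (simp add: g_def inner_diff_left inner_diff_right ip algebra_simps)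
  have F: "orthonormal_frame (g y1) (g y2) (g y3)"
    unfolding orthonormal_frame_def gg r by (simp add: ip)
  define f :: "real ^ 3 \<Rightarrow> real ^ 3" where "f v = vector [v \<bullet> g y1, v \<bullet> g y2, v \<bullet> g y3]" for v
  have f_nth: "f v $ 1 = v \<bullet> g y1" "f v $ 2 = v \<bullet> g y2" "f v $ 3 = v \<bullet> g y3" for v
    by (simp_all add: f_def vector_3)
  have f_inner: "f v \<bullet> f w = v \<bullet> w" for v w
    unfolding frame_inner[OF F, of v w] by (simp add: inner_vec_def[of "f v"] sum_3 f_nth)
  have "linear f"
    by (intro linearI) (simp_all add: vec_eq_iff forall_3 f_nth inner_add_left)
  then have orth: "orthogonal_transformation f"
    using f_inner by (simp add: orthogonal_transformation_def)
    have vg: "w \<bullet> g y = r * (w \<bullet> x - w \<bullet> y)" for w y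
    by (simp add: g_def inner_diff_right)
  have base: "f w \<in> cube_vertices" if "w \<in> {x, y1, y2, y3}" for w
  proof -
    have "w \<bullet> g y1 \<in> signs" "w \<bullet> g y2 \<in> signs" "w \<bullet> g y3 \<in> signs"
      using that r(2) by (auto simp: vg ip)
    then show ?thesis by (simp only: cube_vertices_def mem_Collect_eq forall_3 f_nth)
  qed
  have neg: "f (- w) \<in> cube_vertices" if "f w \<in> cube_vertices" for w
  proof -
    have "f (- w) = - f w" by (simp add: vec_eq_iff forall_3 f_nth)
    then show ?thesis using that by (auto simp: cube_vertices_def minus_equation_iff)
  qed
  have "f ` X \<subseteq> cube_vertices"
    using X_eq_odd_valency[OF disjI1[OF v] x] base neg unfolding nb by blast
  moreover have "inj f" using orth by (rule orthogonal_transformation_inj)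
  then have "card (f ` X) = 8"
    using card_X_odd_valency[OF disjI1[OF v]] v by (simp add: card_image inj_on_subset)
  ultimately have "f ` X = cube_vertices"
    using card_cube_vertices_le by (intro card_seteq[OF finite_cube_vertices]) auto
  with orth show ?thesis by blast
qed

end

section \<open>The Bose-Mesner algebra\<close>

lemma linear_matrix_mult_left: "linear (\<lambda>M :: real ^ 'n ^ 'n. A ** M)" for A :: "real ^ 'n ^ 'n::finite"
  by (rule linearI) (simp_all add: vec_eq_iff matrix_matrix_mult_def algebra_simps sum.distrib sum_distrib_left)

lemma linear_matrix_mult_right: "linear (\<lambda>M :: real ^ 'n ^ 'n. M ** A)" for A :: "real ^ 'n ^ 'n::finite"
  by (rule linearI) (simp_all add: vec_eq_iff matrix_matrix_mult_def algebra_simps sum.distrib sum_distrib_left)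

locale association_scheme =
  fixes d :: nat and R :: "nat \<Rightarrow> ('x::finite \<times> 'x) set"
  assumes scheme: "symmetric_association_scheme d R"
begin

abbreviation BM :: "(real ^ 'x ^ 'x) set" where
  "BM \<equiv> bose_mesner_algebra d R"

lemma class_exists: "\<exists>i\<le>d. (x, y) \<in> R i"
proof -
  have "(x, y) \<in> (\<Union>i\<le>d. R i)" using scheme by (simp add: symmetric_association_scheme_def)
  then show ?thesis by auto
qed

lemma class_unique: "i \<le> d \<Longrightarrow> j \<le> d \<Longrightarrow> (x, y) \<in> R i \<Longrightarrow> (x, y) \<in> R j \<Longrightarrow> i = j"
  using scheme unfolding symmetric_association_scheme_def disjoint_family_on_def by blast

lemma class_sym: "i \<le> d \<Longrightarrow> (x, y) \<in> R i \<Longrightarrow> (y, x) \<in> R i"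
  using scheme unfolding symmetric_association_scheme_def by (meson symD)

lemma class_0: "(x, y) \<in> R 0 \<longleftrightarrow> x = y"
  using scheme by (simp add: symmetric_association_scheme_def)

lemma sum_classes:
  fixes c :: "nat \<Rightarrow> real"
  assumes "k \<le> d" "(x, y) \<in> R k"
  shows "(\<Sum>i\<le>d. c i * (if (x, y) \<in> R i then 1 else 0)) = c k"
proof -
  have "(\<Sum>i\<le>d. c i * (if (x, y) \<in> R i then 1 else 0)) = (\<Sum>i\<le>d. if i = k then c i else 0)"
  proof (rule sum.cong[OF refl])
    fix i assume "i \<in> {..d}"
    then have "(x, y) \<in> R i \<longleftrightarrow> i = k" using class_unique[of i k x y] assms by auto
    then show "c i * (if (x, y) \<in> R i then 1 else 0) = (if i = k then c i else 0)" by simp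
  qed
  then show ?thesis using assms(1) by simp
qed

lemma algebra_iff: "M \<in> BM \<longleftrightarrow> (\<exists>c. \<forall>i\<le>d. \<forall>x y. (x, y) \<in> R i \<longrightarrow> M $ x $ y = c i)"
proof
  let ?W = "{M :: real ^ 'x ^ 'x. \<exists>c. \<forall>i\<le>d. \<forall>x y. (x, y) \<in> R i \<longrightarrow> M $ x $ y = c i}"
  assume "M \<in> BM"
  moreover have "BM \<subseteq> ?W"
    unfolding bose_mesner_algebra_def
  proof (rule span_minimal)
    show "(\<lambda>i. adjacency_matrix (R i)) ` {..d} \<subseteq> ?W"
    proof
      fix M assume "M \<in> (\<lambda>i. adjacency_matrix (R i)) ` {..d}"
      then obtain j where j: "j \<le> d" "M = adjacency_matrix (R j)" by auto
      have "M $ x $ y = (if i = j then 1 else 0)" if "i \<le> d" "(x, y) \<in> R i" for i x y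
        using class_unique[of i j x y] that j by (auto simp: adjacency_matrix_def)
      then show "M \<in> ?W"
        by (intro CollectI exI[of _ "\<lambda>i. if i = j then 1 else 0"]) blast
    qed
    show "subspace ?W"
    proof (rule subspaceI)
      show "0 \<in> ?W"
        by (auto intro: exI[of _ "\<lambda>_. 0"])
      show "M + N \<in> ?W"
        if MN: "M \<in> ?W"
          "N \<in> ?W" for M N
      proof -
        obtain c c' where "\<forall>i\<le>d. \<forall>x y. (x, y) \<in> R i \<longrightarrow> M $ x $ y = c i"
          "\<forall>i\<le>d. \<forall>x y. (x, y) \<in> R i \<longrightarrow> N $ x $ y = c' i" using MN by blast
        then show ?thesis by (auto intro: exI[of _ "\<lambda>i. c i + c' i"])
      qed
      show "a *\<^sub>R M \<in> ?W"
        if M: "M \<in> ?W" for a M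
      proof -
        obtain c where "\<forall>i\<le>d. \<forall>x y. (x, y) \<in> R i \<longrightarrow> M $ x $ y = c i" using M by blast
        then show ?thesis by (auto intro: exI[of _ "\<lambda>i. a * c i"])
      qed
    qed
  qed
  ultimately show "\<exists>c. \<forall>i\<le>d. \<forall>x y. (x, y) \<in> R i \<longrightarrow> M $ x $ y = c i" by blast
next
  assume "\<exists>c. \<forall>i\<le>d. \<forall>x y. (x, y) \<in> R i \<longrightarrow> M $ x $ y = c i"
  then obtain c where c: "\<And>i x y. i \<le> d \<Longrightarrow> (x, y) \<in> R i \<Longrightarrow> M $ x $ y = c i" by blast
  have "M $ x $ y = (\<Sum>i\<le>d. c i *\<^sub>R adjacency_matrix (R i)) $ x $ y" for x y
  proof -
    obtain k where k: "k \<le> d" "(x, y) \<in> R k" using class_exists by blast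
    show ?thesis using c[OF k] sum_classes[OF k, of c] by (simp add: adjacency_matrix_def)
  qed
  then have "M = (\<Sum>i\<le>d. c i *\<^sub>R adjacency_matrix (R i))" by (subst vec_eq_iff, subst vec_eq_iff) blast
  also have "\<dots> \<in> BM"
    unfolding bose_mesner_algebra_def by (intro span_sum span_scale span_base) auto
  finally show "M \<in> BM" .
qed

lemma algebra_sym:
  assumes "M \<in> BM"
  shows "M $ x $ y = M $ y $ x"
proof -
  obtain c where c: "\<And>i x y. i \<le> d \<Longrightarrow> (x, y) \<in> R i \<Longrightarrow> M $ x $ y = c i"
    using assms unfolding algebra_iff by blast
  obtain k where k: "k \<le> d" "(x, y) \<in> R k" using class_exists by blast
  show ?thesis using c[OF k] c[OF k(1) class_sym[OF k]] by simp
qed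

lemma algebra_transpose: "M \<in> BM \<Longrightarrow> transpose M = M"
  using algebra_sym by (simp add: transpose_def vec_eq_iff)

lemma algebra_mult:
  assumes M: "M \<in> BM" and N: "N \<in> BM"
  shows "M ** N \<in> BM"
proof -
  obtain c where c: "\<And>i x y. i \<le> d \<Longrightarrow> (x, y) \<in> R i \<Longrightarrow> M $ x $ y = c i"
    using M unfolding algebra_iff by blast
  obtain c' where c': "\<And>i x y. i \<le> d \<Longrightarrow> (x, y) \<in> R i \<Longrightarrow> N $ x $ y = c' i"
    using N unfolding algebra_iff by blast
  let ?p = "\<lambda>i j x y. card {z. (x, z) \<in> R i \<and> (z, y) \<in> R j}"
  have MN: "(M ** N) $ x $ y = (\<Sum>i\<le>d. \<Sum>j\<le>d. c i * c' j * real (?p i j x y))" for x y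
  proof -
    have Mx: "M $ x $ z = (\<Sum>i\<le>d. c i * (if (x, z) \<in> R i then 1 else 0))" for x z
      using class_exists[of x z] c sum_classes by metis
    have Nx: "N $ z $ y = (\<Sum>j\<le>d. c' j * (if (z, y) \<in> R j then 1 else 0))" for z y
      using class_exists[of z y] c' sum_classes by metis
    have "(M ** N) $ x $ y = (\<Sum>z\<in>UNIV. \<Sum>i\<le>d. \<Sum>j\<le>d. c i * c' j * (if (x, z) \<in> R i \<and> (z, y) \<in> R j then 1 else 0))"
      unfolding matrix_matrix_mult_def
      by (simp add: Mx Nx sum_product if_distrib cong: if_cong) (intro sum.cong refl, auto)
    also have "\<dots> = (\<Sum>i\<le>d. \<Sum>j\<le>d. \<Sum>z\<in>UNIV. c i * c' j * (if (x, z) \<in> R i \<and> (z, y) \<in> R j then 1 else 0))"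
      by (subst sum.swap, intro sum.cong refl, subst sum.swap) simp
    also have "\<dots> = (\<Sum>i\<le>d. \<Sum>j\<le>d. c i * c' j * real (?p i j x y))"
      by (intro sum.cong refl) (simp add: sum_distrib_left[symmetric] sum.If_cases)
    finally show ?thesis .
  qed
  have "\<exists>e. \<forall>x y. (x, y) \<in> R k \<longrightarrow> (M ** N) $ x $ y = e" if k: "k \<le> d" for k
  proof -
    have "\<exists>p. \<forall>(x, y) \<in> R k. ?p i j x y = p" if "i \<le> d" "j \<le> d" for i j
      using scheme k that unfolding symmetric_association_scheme_def by blast
    note ex = this
    define p where "p i j = (SOME p. \<forall>(x, y) \<in> R k. ?p i j x y = p)" for i j
    have p: "?p i j x y = p i j" if "i \<le> d" "j \<le> d" "(x, y) \<in> R k" for i j x y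
      using someI_ex[OF ex[OF that(1,2)]] that(3) unfolding p_def by blast
    have "(M ** N) $ x $ y = (\<Sum>i\<le>d. \<Sum>j\<le>d. c i * c' j * real (p i j))" if "(x, y) \<in> R k" for x y
      unfolding MN using p[OF _ _ that] by (intro sum.cong refl) simp
    then show ?thesis by blast
  qed
  then have "\<forall>k. \<exists>e. k \<le> d \<longrightarrow> (\<forall>x y. (x, y) \<in> R k \<longrightarrow> (M ** N) $ x $ y = e)" by blast
  from choice[OF this] show ?thesis unfolding algebra_iff by blast
qed

lemma algebra_commute:
  assumes "M \<in> BM" "N \<in> BM"
  shows "M ** N = N ** M"
proof -
  have "M ** N = transpose (M ** N)" by (rule algebra_transpose[OF algebra_mult[OF assms], symmetric])
  also have "\<dots> = N ** M" using assms by (simp add: matrix_transpose_mul algebra_transpose)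
  finally show ?thesis .
qed

lemma algebra_subspace: "subspace BM"
  by (simp add: bose_mesner_algebra_def)

lemma entrywise_in_algebra:
  assumes "M \<in> BM"
  shows "(\<chi> x y. f (M $ x $ y)) \<in> BM"
proof -
  obtain c where "\<And>i x y. i \<le> d \<Longrightarrow> (x, y) \<in> R i \<Longrightarrow> M $ x $ y = c i"
    using assms unfolding algebra_iff by blast
  then show ?thesis unfolding algebra_iff by (intro exI[of _ "\<lambda>i. f (c i)"]) simp
qed

lemma mat_1_in_algebra: "mat 1 \<in> BM"
proof -
  have "mat 1 $ x $ y = (if i = 0 then 1 else 0)" if "i \<le> d" "(x, y) \<in> R i" for i x y
    using that class_unique[of i 0 x y] class_0[of x y] by (auto simp: mat_def)
  then show ?thesis
    unfolding algebra_iff by (intro exI[of _ "\<lambda>i. if i = 0 then 1 else 0"]) blast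
qed

text \<open>
  The product of the two is an idempotent below both of them, so it is 0 or equal to each.
\<close>

lemma primitive_idempotents_orthogonal:
  assumes E: "primitive_idempotent_in BM E" and F: "primitive_idempotent_in BM F" and ne: "E \<noteq> F"
  shows "E ** F = 0"
proof (rule ccontr)
  assume nz: "E ** F \<noteq> 0"
  have absorb: "G = E ** F" if G: "primitive_idempotent_in BM G" and GE: "G = E \<or> G = F" for G
  proof -
    have mem: "E \<in> BM" "F \<in> BM" "G \<in> BM" and id: "E ** E = E" "F ** F = F"
      and prim: "\<And>A B. A \<in> BM \<Longrightarrow> B \<in> BM \<Longrightarrow> A ** A = A \<Longrightarrow> B ** B = B \<Longrightarrow> A ** B = 0 \<Longrightarrow> B ** A = 0
        \<Longrightarrow> G = A + B \<Longrightarrow> A = 0 \<or> B = 0"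
      using E F G unfolding primitive_idempotent_in_def by blast+
    let ?H = "E ** F"
    have H: "?H \<in> BM" using mem by (simp add: algebra_mult)
    have comm: "F ** E = E ** F" using algebra_commute mem by blast
    have EH: "E ** ?H = ?H" by (simp add: matrix_mul_assoc id)
    have HE: "?H ** E = ?H" by (metis comm matrix_mul_assoc id(1))
    have HF: "?H ** F = ?H" by (simp add: matrix_mul_assoc[symmetric] id)
    have FH: "F ** ?H = ?H" by (metis comm matrix_mul_assoc id(2))
    have HH: "?H ** ?H = ?H" by (simp add: matrix_mul_assoc[symmetric] FH EH)
    have GH: "G ** ?H = ?H" "?H ** G = ?H" "G ** G = G" using GE by (elim disjE; simp add: EH FH HE HF id)+
    note sub = linear_diff[OF linear_matrix_mult_left] linear_diff[OF linear_matrix_mult_right]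
    have D: "G - ?H \<in> BM" using mem(3) H by (intro subspace_diff[OF algebra_subspace])
    have DD: "(G - ?H) ** (G - ?H) = G - ?H" by (simp add: sub GH HH)
    have HD: "?H ** (G - ?H) = 0" "(G - ?H) ** ?H = 0" by (simp_all add: sub GH HH)
    have "G = ?H + (G - ?H)" by simp
    from prim[OF H D HH DD HD this] have "?H = 0 \<or> G - ?H = 0" .
    then show ?thesis using nz by simp
  qed
  show False using absorb[OF E] absorb[OF F] ne by simp
qed

end

locale q_polynomial_scheme = association_scheme d R for d and R :: "nat \<Rightarrow> ('x::finite \<times> 'x) set" +
  fixes E :: "nat \<Rightarrow> real ^ 'x ^ 'x"
  assumes idempotents: "primitive_idempotent_ordering d R E"
    and q_polynomial: "Q_polynomial_ordering d E"
begin

lemma E_primitive: "i \<le> d \<Longrightarrow> primitive_idempotent_in BM (E i)"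
  using idempotents unfolding primitive_idempotent_ordering_def bij_betw_def by blast

lemma E_in_algebra: "i \<le> d \<Longrightarrow> E i \<in> BM"
  and E_idem: "i \<le> d \<Longrightarrow> E i ** E i = E i"
  and E_nonzero: "i \<le> d \<Longrightarrow> E i \<noteq> 0"
  using E_primitive unfolding primitive_idempotent_in_def by blast+

lemma E_inj: "inj_on E {..d}"
  using idempotents unfolding primitive_idempotent_ordering_def bij_betw_def by blast

lemma E_orthogonal:
  assumes "i \<le> d" "j \<le> d" "i \<noteq> j"
  shows "E i ** E j = 0"
  using primitive_idempotents_orthogonal[OF E_primitive E_primitive] assms E_inj
  by (meson atMost_iff inj_on_contraD)

lemma sum_E_mult:
  assumes "j \<le> d"
  shows "(\<Sum>i\<le>d. c i *\<^sub>R E i) ** E j = c j *\<^sub>R E j"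
proof -
  have "(\<Sum>i\<le>d. c i *\<^sub>R E i) ** E j = (\<Sum>i\<le>d. c i *\<^sub>R (E i ** E j))"
    by (simp add: linear_sum[OF linear_matrix_mult_right] linear_scale[OF linear_matrix_mult_right])
  also have "\<dots> = (\<Sum>i\<le>d. if i = j then c j *\<^sub>R E j else 0)"
    using assms E_orthogonal E_idem by (intro sum.cong) auto
  finally show ?thesis using assms by simp
qed

text \<open>
  Pairwise orthogonal nonzero idempotents are linearly independent, and there are \<open>d + 1\<close> of them, as many as
  adjacency matrices. Therefore they form a basis, which diagonalises the algebra.
\<close>

lemma algebra_eq_span: "BM = span (E ` {..d})"
proof
  have fin: "finite (E ` {..d})" by simp
  have "independent (E ` {..d})"
  proof
    assume "dependent (E ` {..d})"
    then obtain u where u: "\<exists>M\<in>E ` {..d}. u M \<noteq> 0" "(\<Sum>M\<in>E ` {..d}. u M *\<^sub>R M) = 0"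
      using dependent_finite[OF fin] by auto
    then obtain j where j: "j \<le> d" "u (E j) \<noteq> 0" by auto
    have "(\<Sum>i\<le>d. u (E i) *\<^sub>R E i) = 0" using u(2) by (simp add: sum.reindex[OF E_inj])
    then have "u (E j) *\<^sub>R E j = 0"
      using sum_E_mult[OF j(1), of "\<lambda>i. u (E i)"] linear_0[OF linear_matrix_mult_right] by simp
    then show False using j E_nonzero by simp
  qed
  moreover have "dim BM \<le> card (E ` {..d})"
  proof -
    have "dim BM \<le> card ((\<lambda>i. adjacency_matrix (R i)) ` {..d})"
      unfolding bose_mesner_algebra_def by (rule dim_le_card) simp_all
    also have "\<dots> \<le> card {..d}" by (rule card_image_le) simp
    finally show ?thesis by (simp add: card_image[OF E_inj])
  qed
  moreover have "E ` {..d} \<subseteq> BM" using E_in_algebra by auto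
  ultimately show "BM \<subseteq> span (E ` {..d})" by (intro card_ge_dim_independent)
  show "span (E ` {..d}) \<subseteq> BM"
    using E_in_algebra by (intro span_minimal algebra_subspace) auto
qed

lemma eigenvalue:
  assumes M: "M \<in> BM" and j: "j \<le> d"
  obtains c where "M ** E j = c *\<^sub>R E j"
proof -
  have "finite (E ` {..d})" by simp
  then obtain u where "M = (\<Sum>N\<in>E ` {..d}. u N *\<^sub>R N)"
    using M unfolding algebra_eq_span span_finite[OF \<open>finite (E ` {..d})\<close>] by auto
  then have "M = (\<Sum>i\<le>d. u (E i) *\<^sub>R E i)" by (simp add: sum.reindex[OF E_inj])
  then have "M ** E j = u (E j) *\<^sub>R E j" using sum_E_mult[OF j, of "\<lambda>i. u (E i)"] by simp
  then show thesis by (rule that)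
qed

text \<open>
  The scaling of the argument is that of the Q-polynomial property.
\<close>

definition entrywise :: "real poly \<Rightarrow> real ^ 'x ^ 'x" where
  "entrywise p = (\<chi> x y. poly p (real CARD('x) * E 1 $ x $ y))"

lemma entrywise_linear: "entrywise (p + q) = entrywise p + entrywise q" "entrywise (smult c p) = c *\<^sub>R entrywise p"
  by (simp_all add: entrywise_def vec_eq_iff)

lemma E_entrywise:
  assumes "i \<le> d"
  obtains v where "degree v = i" "entrywise v = real CARD('x) *\<^sub>R E i"
proof -
  obtain v :: "real poly" where "degree v = i"
    "\<And>x y. real CARD('x) * E i $ x $ y = poly v (real CARD('x) * E 1 $ x $ y)"
    using q_polynomial assms unfolding Q_polynomial_ordering_def by blast
  then show thesis by (intro that[of v]) (simp_all add: entrywise_def vec_eq_iff)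
qed

lemma entrywise_in_span:
  assumes "m \<le> d" "degree p \<le> m"
  shows "entrywise p \<in> span (E ` {..m})"
  using assms
proof (induction m arbitrary: p)
  case 0
  then obtain c where "p = [:c:]" by (meson degree_eq_zeroE le_zero_eq)
  moreover have "E 0 = (1 / real CARD('x)) *\<^sub>R (\<chi> x y. 1)"
    using idempotents by (simp add: primitive_idempotent_ordering_def)
  ultimately have "entrywise p = (c * real CARD('x)) *\<^sub>R E 0"
    by (simp add: entrywise_def vec_eq_iff)
  then show ?case by (simp add: span_scale span_base)
next
  case (Suc m)
  obtain v where v: "degree v = Suc m" "entrywise v = real CARD('x) *\<^sub>R E (Suc m)"
    using E_entrywise Suc.prems(1) by blast
  define a where "a = coeff p (Suc m) / lead_coeff v"
  have lead: "coeff v (Suc m) \<noteq> 0" using v(1) by (metis degree_0 leading_coeff_0_iff nat.distinct(1))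
  define r where "r = p + smult (- a) v"
  have "coeff r i = 0" if "i > m" for i
  proof (cases "i = Suc m")
    case True
    then show ?thesis using lead v(1) by (simp add: r_def a_def)
  next
    case False
    then have "i > Suc m" using that by simp
    then show ?thesis using v(1) Suc.prems(2) by (simp add: r_def coeff_eq_0)
  qed
  then have "degree r \<le> m" by (simp add: degree_le)
  then have "entrywise r \<in> span (E ` {..m})" using Suc by simp
  then have "entrywise r \<in> span (E ` {..Suc m})" by (rule span_mono[THEN subsetD, rotated]) auto
  moreover have "entrywise (smult a v) \<in> span (E ` {..Suc m})"
    by (simp add: entrywise_linear v(2) span_scale span_base)
  ultimately have "entrywise (r + smult a v) \<in> span (E ` {..Suc m})"
    unfolding entrywise_linear(1) by (rule span_add)
  then show ?case by (simp add: r_def)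
qed

lemma span_entrywise:
  assumes m: "m \<le> d" and M: "M \<in> span (E ` {..m})"
  obtains q where "degree q \<le> m" "M = entrywise q"
proof -
  have "span (E ` {..m}) \<subseteq> {entrywise q | q. degree q \<le> m}"
  proof (rule span_minimal)
    show "E ` {..m} \<subseteq> {entrywise q | q. degree q \<le> m}"
    proof (rule image_subsetI)
      fix i assume i: "i \<in> {..m}"
      then obtain v where "degree v = i" "entrywise v = real CARD('x) *\<^sub>R E i"
        using E_entrywise m by (metis atMost_iff le_trans)
      then have "E i = entrywise (smult (1 / real CARD('x)) v)" "degree (smult (1 / real CARD('x)) v) \<le> m"
        using i by (simp_all add: entrywise_linear)
      then show "E i \<in> {entrywise q | q. degree q \<le> m}" by blast
    qed
    show "subspace {entrywise q | q. degree q \<le> m}"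
    proof (rule subspaceI)
      have "0 = entrywise 0" by (simp add: entrywise_def vec_eq_iff)
      then show "0 \<in> {entrywise q | q. degree q \<le> m}" by force
      show "x + y \<in> {entrywise q | q. degree q \<le> m}"
        if "x \<in> {entrywise q | q. degree q \<le> m}" "y \<in> {entrywise q | q. degree q \<le> m}" for x y
        using that by (auto simp flip: entrywise_linear intro: degree_add_le)
      show "c *\<^sub>R x \<in> {entrywise q | q. degree q \<le> m}"
        if "x \<in> {entrywise q | q. degree q \<le> m}" for c x
        using that by (auto simp flip: entrywise_linear intro: order_trans[OF degree_smult_le])
    qed
  qed
  then show thesis using M that by blast
qed

text \<open>
  The polynomials of degree at most \<open>m\<close> correspond to the span of \<open>E 0, \<dots>, E m\<close>, which every element of
  the algebra maps to itself because each \<open>E i\<close> is an eigenvector. For \<open>m = d\<close> this span is the whole algebra.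
\<close>

lemma mult_entrywise:
  assumes E1: "E 1 \<in> BM" and A: "A \<in> BM"
  obtains q where "degree q \<le> degree p" "A ** entrywise p = entrywise q"
proof -
  define m where "m = min (degree p) d"
  have m: "m \<le> d" by (simp add: m_def)
  have "entrywise p \<in> span (E ` {..m})"
  proof (cases "degree p \<le> d")
    case True
    then show ?thesis using entrywise_in_span[of m p] by (simp add: m_def)
  next
    case False
    then have "m = d" by (simp add: m_def)
    then show ?thesis
      using entrywise_in_algebra[OF E1, of "\<lambda>t. poly p (real CARD('x) * t)"]
      by (simp add: entrywise_def algebra_eq_span)
  qed
  moreover have "span (E ` {..m}) \<subseteq> {M. A ** M \<in> span (E ` {..m})}"
  proof (rule span_minimal)
    show "E ` {..m} \<subseteq> {M. A ** M \<in> span (E ` {..m})}"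
    proof (rule image_subsetI)
      fix i assume i: "i \<in> {..m}"
      then obtain c where "A ** E i = c *\<^sub>R E i" using eigenvalue[OF A, of i] m by auto
      then show "E i \<in> {M. A ** M \<in> span (E ` {..m})}" using i by (simp add: span_scale span_base)
    qed
    show "subspace {M. A ** M \<in> span (E ` {..m})}"
      using linear_subspace_vimage[OF linear_matrix_mult_left[of A] subspace_span] by (simp add: vimage_def)
  qed
  ultimately have "A ** entrywise p \<in> span (E ` {..m})" by blast
  then obtain q where "degree q \<le> m" "A ** entrywise p = entrywise q"
    by (rule span_entrywise[OF m])
  then show thesis by (intro that[of q]) (simp_all add: m_def)
qed

end

section \<open>The embedded scheme\<close>

(* The numeral in E 1 would otherwise be rewritten to Suc 0 and no longer match the definitions. *)
declare One_nat_def [simp del]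

lemma isometric_identification_inner:
  assumes T: "isometric_identification V T" and V: "subspace V" and u: "u \<in> V" and v: "v \<in> V"
  shows "T u \<bullet> T v = u \<bullet> v"
proof -
  have lin: "linear T" and n: "\<And>w. w \<in> V \<Longrightarrow> norm (T w) = norm w"
    using T by (auto simp: isometric_identification_def)
  have sq: "T w \<bullet> T w = w \<bullet> w" if "w \<in> V" for w
    using n[OF that] by (simp add: norm_eq_sqrt_inner)
  have "T (u + v) \<bullet> T (u + v) = (u + v) \<bullet> (u + v)"
    by (rule sq[OF subspace_add[OF V u v]])
  then show ?thesis
    using sq[OF u] sq[OF v]
    by (simp add: linear_add[OF lin] inner_add_left inner_add_right inner_commute)
qed

locale embedded_scheme = q_polynomial_scheme d R E
  for d and R :: "nat \<Rightarrow> ('x::finite \<times> 'x) set" and E :: "nat \<Rightarrow> real ^ 'x ^ 'x" +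
  fixes T :: "real ^ 'x \<Rightarrow> real ^ 3"
  assumes rank_3: "rank (E 1) = 3"
    and identification: "isometric_identification (column_space (E 1)) T"
begin

definition embedding :: "'x \<Rightarrow> real ^ 3" where
  "embedding x = T (spherical_embedding (E 1) x)"

lemma d_pos: "1 \<le> d"
proof (rule ccontr)
  assume "\<not> 1 \<le> d"
  then have "d = 0" by simp
  then have "x = y" for x y :: 'x
    using class_exists[of x y] class_0[of x y] by simp
  then have "UNIV = {undefined :: 'x}" by blast
  then have "CARD('x) = card {undefined :: 'x}" by (rule arg_cong)
  then have "CARD('x) = 1" by simp
  then show False using rank_bound[of "E 1"] rank_3 by simp
qed

lemma E1: "E 1 \<in> BM" "E 1 ** E 1 = E 1"
  using E_in_algebra E_idem d_pos by auto

lemma E1_sym: "E 1 $ x $ y = E 1 $ y $ x"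
  by (rule algebra_sym[OF E1(1)])

lemma embedding_inner: "embedding x \<bullet> embedding y = real CARD('x) / 3 * E 1 $ x $ y"
proof -
  have col: "E 1 *v axis x 1 \<in> column_space (E 1)" for x
    unfolding column_space_def matrix_vector_mult_basis by (rule span_base) (auto simp: columns_def)
  have sub: "subspace (column_space (E 1))" by (simp add: column_space_def)
  have lin: "linear T" using identification by (simp add: isometric_identification_def)
  have "(E 1 *v axis x 1) \<bullet> (E 1 *v axis y 1) = (\<Sum>z\<in>UNIV. E 1 $ x $ z * E 1 $ z $ y)"
    unfolding matrix_vector_mult_basis by (simp add: inner_vec_def column_def E1_sym[of x])
  also have "\<dots> = (E 1 ** E 1) $ x $ y" by (simp add: matrix_matrix_mult_def)
  finally have "(E 1 *v axis x 1) \<bullet> (E 1 *v axis y 1) = E 1 $ x $ y" by (simp add: E1)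
  moreover have "embedding x = sqrt (real CARD('x) / 3) *\<^sub>R T (E 1 *v axis x 1)" for x
    by (simp add: embedding_def spherical_embedding_def rank_3 linear_scale[OF lin])
  ultimately have "embedding x \<bullet> embedding y
      = (sqrt (real CARD('x) / 3) * sqrt (real CARD('x) / 3)) * E 1 $ x $ y"
    using isometric_identification_inner[OF identification sub col col, of x y]
    by (simp only: inner_scaleR_left inner_scaleR_right mult.assoc)
  then show ?thesis by simp
qed

lemma span_embedding: "span (range embedding) = UNIV"
proof -
  have lin: "linear T" and onto: "T ` column_space (E 1) = UNIV"
    using identification by (auto simp: isometric_identification_def)
  have "columns (E 1) = range (\<lambda>x. E 1 *v axis x 1)"
    by (auto simp: columns_def matrix_vector_mult_basis)
  then have "span (range (\<lambda>x. T (E 1 *v axis x 1))) = UNIV"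
    using onto unfolding column_space_def by (simp add: linear_span_image[OF lin, symmetric] image_image)
  moreover have "T (E 1 *v axis x 1) \<in> span (range embedding)" for x
  proof -
    have c: "sqrt (real CARD('x) / 3) \<noteq> 0" by simp
    have "embedding x = sqrt (real CARD('x) / 3) *\<^sub>R T (E 1 *v axis x 1)"
      by (simp add: embedding_def spherical_embedding_def rank_3 linear_scale[OF lin])
    then have "T (E 1 *v axis x 1) = (1 / sqrt (real CARD('x) / 3)) *\<^sub>R embedding x"
      using c by simp
    then show ?thesis by (simp add: span_scale span_base)
  qed
  then have "span (range (\<lambda>x. T (E 1 *v axis x 1))) \<subseteq> span (range embedding)"
    by (intro span_minimal subspace_span) auto
  ultimately show ?thesis by auto
qed

lemma embedding_orthogonal_zero:
  assumes "\<And>x. embedding x \<bullet> a = 0"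
  shows "a = 0"
proof -
  have "a \<in> span (range embedding)" by (simp add: span_embedding)
  moreover have "orthogonal a v" if "v \<in> range embedding" for v
    using assms that by (auto simp: orthogonal_def inner_commute)
  ultimately have "orthogonal a a" by (rule orthogonal_to_span)
  then show ?thesis by (simp add: orthogonal_def)
qed

lemma embedding_tight: "(\<Sum>x\<in>UNIV. (embedding x \<bullet> a) *\<^sub>R embedding x) = (real CARD('x) / 3) *\<^sub>R a"
proof -
  let ?g = "real CARD('x) / 3"
  define L where "L a = (\<Sum>x\<in>UNIV. (embedding x \<bullet> a) *\<^sub>R embedding x) - ?g *\<^sub>R a" for a
  have "L (embedding y) = 0" for y
  proof (rule embedding_orthogonal_zero)
    fix z
    have "embedding z \<bullet> L (embedding y) = (\<Sum>x\<in>UNIV. (embedding x \<bullet> embedding y) * (embedding z \<bullet> embedding x))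
        - ?g * (embedding z \<bullet> embedding y)"
      by (simp add: L_def inner_diff_right inner_sum_right)
    also have "\<dots> = ?g * ?g * (\<Sum>x\<in>UNIV. E 1 $ z $ x * E 1 $ x $ y) - ?g * ?g * E 1 $ z $ y"
      by (simp add: embedding_inner sum_distrib_left mult_ac)
    also have "(\<Sum>x\<in>UNIV. E 1 $ z $ x * E 1 $ x $ y) = (E 1 ** E 1) $ z $ y"
      by (simp add: matrix_matrix_mult_def)
    finally show "embedding z \<bullet> L (embedding y) = 0" by (simp add: E1)
  qed
  moreover have "linear L"
    by (rule linearI)
      (simp_all add: L_def inner_add_right algebra_simps sum.distrib scaleR_sum_right)
  ultimately have "L a = 0"
    using linear_eq_0_on_span[of L "range embedding" a] span_embedding by auto
  then show ?thesis by (simp add: L_def)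
qed

text \<open>
  The diagonal of \<open>E 1\<close> is constant, and tightness gives the sum of the squared norms.
\<close>

lemma embedding_unit: "embedding x \<bullet> embedding x = 1"
proof -
  let ?g = "real CARD('x) / 3"
  obtain c where c: "\<And>i x y. i \<le> d \<Longrightarrow> (x, y) \<in> R i \<Longrightarrow> E 1 $ x $ y = c i"
    using E1(1) unfolding algebra_iff by blast
  have diag: "E 1 $ x $ x = c 0" for x using c[of 0 x x] class_0 by simp
  have "(\<Sum>y\<in>UNIV. embedding y \<bullet> embedding y) = (\<Sum>y\<in>UNIV. \<Sum>i\<in>UNIV. (embedding y \<bullet> axis i 1) * (embedding y \<bullet> axis i 1))"
    by (simp add: inner_vec_def[of "embedding _" "embedding _"] inner_axis)
  also have "\<dots> = (\<Sum>i\<in>UNIV. (\<Sum>y\<in>UNIV. (embedding y \<bullet> axis i 1) *\<^sub>R embedding y) \<bullet> axis i 1)"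
    by (subst sum.swap) (simp add: inner_sum_left)
  also have "\<dots> = real CARD('x)"
    unfolding embedding_tight by (simp add: inner_axis_axis)
  finally have "real CARD('x) * (?g * c 0) = real CARD('x)"
    by (simp add: embedding_inner diag)
  then have "?g * c 0 = 1" by simp
  then show ?thesis by (simp add: embedding_inner diag)
qed

text \<open>
  Two points with the same image would have equal rows in every matrix of the algebra, in
  particular in the identity matrix, which is an entrywise polynomial in \<open>E 1\<close>.
\<close>

lemma inj_embedding: "inj embedding"
proof (rule injI)
  fix x y assume eq: "embedding x = embedding y"
  have row: "E 1 $ x $ z = E 1 $ y $ z" for z
  proof -
    have "real CARD('x) / 3 * E 1 $ x $ z = real CARD('x) / 3 * E 1 $ y $ z"
      unfolding embedding_inner[symmetric] eq ..
    then show ?thesis by simp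
  qed
  obtain q where q: "mat 1 = entrywise q"
    using span_entrywise[of d "mat 1"] mat_1_in_algebra unfolding algebra_eq_span by auto
  have "(mat 1 :: real ^ 'x ^ 'x) $ x $ y = mat 1 $ y $ y"
    unfolding q entrywise_def by (simp add: row)
  then show "x = y" by (simp add: mat_def split: if_splits)
qed

lemma sum_range_embedding: "(\<Sum>v\<in>range embedding. f v) = (\<Sum>x\<in>UNIV. f (embedding x))"
  by (simp add: sum.reindex[OF inj_embedding])

lemma card_range_embedding: "card (range embedding) = CARD('x)"
  by (rule card_image[OF inj_embedding])

lemma embedding_centred: "(\<Sum>x\<in>UNIV. embedding x) = 0"
proof (rule embedding_orthogonal_zero)
  fix y
  have "E 1 ** E 0 = 0" using E_orthogonal[of 1 0] d_pos by simp
  then have "(E 1 ** E 0) $ y $ y = 0" by simp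
  moreover have "E 0 = (1 / real CARD('x)) *\<^sub>R (\<chi> x y. 1)"
    using idempotents by (simp add: primitive_idempotent_ordering_def)
  ultimately have "(\<Sum>x\<in>UNIV. E 1 $ y $ x) = 0"
    by (simp add: matrix_matrix_mult_def flip: sum_divide_distrib)
  then show "embedding y \<bullet> (\<Sum>x\<in>UNIV. embedding x) = 0"
    by (simp add: inner_sum_right embedding_inner flip: sum_distrib_left sum_divide_distrib)
qed

sublocale tight_sphere_set "range embedding"
proof
  show "(\<Sum>x\<in>range embedding. (x \<bullet> a) *\<^sub>R x) = (real (card (range embedding)) / 3) *\<^sub>R a" for a
    unfolding sum_range_embedding card_range_embedding by (rule embedding_tight)
  show "(\<Sum>x\<in>range embedding. x) = 0"
    unfolding sum_range_embedding by (rule embedding_centred)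
qed (use embedding_unit in auto)

lemma entrywise_embedding:
  "entrywise p $ x $ y = poly (pcompose p [:0, 3:]) (embedding x \<bullet> embedding y)"
  by (simp add: entrywise_def embedding_inner poly_pcompose)

lemma cubic_constant:
  obtains \<beta> where "cubic_tight_set (range embedding) \<beta>"
proof -
  let ?g = "real CARD('x) / 3"
  let ?p = "[:0, 0, 1 / 9:] :: real poly"
  have p: "entrywise ?p $ x $ y = (embedding x \<bullet> embedding y)\<^sup>2" for x y
    by (simp add: entrywise_embedding poly_pcompose power2_eq_square)
  have "entrywise ?p \<in> BM"
    using entrywise_in_algebra[OF E1(1), of "\<lambda>t. poly ?p (real CARD('x) * t)"] by (simp only: entrywise_def)
  then obtain c where c: "entrywise ?p ** E 1 = c *\<^sub>R E 1" using eigenvalue d_pos by blast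
  have g: "?g \<noteq> 0" by simp
  have "cubic_tight_set (range embedding) (c / ?g)"
  proof
    fix u v assume "u \<in> range embedding" "v \<in> range embedding"
    then obtain x z where xz: "u = embedding x" "v = embedding z" by blast
    have "(\<Sum>y\<in>UNIV. (embedding y \<bullet> u)\<^sup>2 * (embedding y \<bullet> v)) = (\<Sum>y\<in>UNIV. entrywise ?p $ x $ y * (?g * E 1 $ y $ z))"
      unfolding xz p embedding_inner[symmetric] by (simp add: inner_commute)
    also have "\<dots> = ?g * (entrywise ?p ** E 1) $ x $ z"
      by (simp add: matrix_matrix_mult_def sum_distrib_left mult_ac)
    also have "\<dots> = c * (u \<bullet> v)"
      unfolding c xz embedding_inner by simp
    finally show "(\<Sum>y\<in>range embedding. (y \<bullet> u)\<^sup>2 * (y \<bullet> v))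
        = c / ?g * (real (card (range embedding)) / 3) * (u \<bullet> v)"
      unfolding sum_range_embedding card_range_embedding using g by simp
  qed
  then show thesis by (rule that)
qed

text \<open>
  The points at inner product \<open>t\<close> are described by a matrix of the algebra, and \<open>mult_entrywise\<close> applies to it.
  The substitutions by \<open>3 * t\<close> and \<open>t / 3\<close> convert between inner products and scaled entries of \<open>E 1\<close>.
\<close>

lemma embedding_adjacency_polynomial:
  "\<exists>q. degree q \<le> degree p \<and> (\<forall>u\<in>range embedding. \<forall>v\<in>range embedding.
     (\<Sum>y\<in>{y \<in> range embedding. u \<bullet> y = t}. poly p (y \<bullet> v)) = poly q (u \<bullet> v))"
proof -
  define A :: "real ^ 'x ^ 'x" where
    "A = (\<chi> x y. (\<lambda>s. if real CARD('x) / 3 * s = t then 1 else 0) (E 1 $ x $ y))"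
  have A: "A \<in> BM" unfolding A_def by (rule entrywise_in_algebra[OF E1(1)])
  define p' where "p' = pcompose p [:0, 1 / 3:]"
  have p': "entrywise p' $ x $ y = poly p (embedding x \<bullet> embedding y)" for x y
    by (simp add: entrywise_embedding p'_def poly_pcompose)
  obtain q where q: "degree q \<le> degree p'" "A ** entrywise p' = entrywise q"
    by (rule mult_entrywise[OF E1(1) A])
  have "degree (pcompose q [:0, 3:]) \<le> degree p"
    using q(1) by (simp add: p'_def degree_pcompose)
  moreover have "(\<Sum>y\<in>{y \<in> range embedding. u \<bullet> y = t}. poly p (y \<bullet> v)) = poly (pcompose q [:0, 3:]) (u \<bullet> v)"
    if "u \<in> range embedding" "v \<in> range embedding" for u v
  proof -
    from that obtain x z where xz: "u = embedding x" "v = embedding z" by blast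
    have "(\<Sum>y\<in>{y \<in> range embedding. u \<bullet> y = t}. poly p (y \<bullet> v))
        = (\<Sum>y\<in>range embedding. if u \<bullet> y = t then poly p (y \<bullet> v) else 0)"
      using finite_X by (simp add: sum.inter_filter)
    also have "\<dots> = (\<Sum>y\<in>UNIV. A $ x $ y * entrywise p' $ y $ z)"
      unfolding sum_range_embedding p' xz A_def by (intro sum.cong refl) (simp add: embedding_inner)
    also have "\<dots> = entrywise q $ x $ z"
      unfolding q(2)[symmetric] by (simp add: matrix_matrix_mult_def)
    finally show ?thesis by (simp only: entrywise_embedding xz)
  qed
  ultimately show ?thesis by blast
qed

end

lemma (in tight_sphere_set) largest_inner_product:
  "\<exists>\<alpha>. (\<forall>x\<in>X. \<forall>y\<in>X. x \<noteq> y \<longrightarrow> x \<bullet> y \<le> \<alpha>) \<and> (\<exists>x\<in>X. \<exists>y\<in>X. x \<noteq> y \<and> x \<bullet> y = \<alpha>)"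
proof -
  define S where "S = {x \<bullet> y | x y. x \<in> X \<and> y \<in> X \<and> x \<noteq> y}"
  have "S \<subseteq> (\<lambda>(x, y). x \<bullet> y) ` (X \<times> X)" by (auto simp: S_def)
  then have fin: "finite S" by (rule finite_subset) (use finite_X in simp)
  obtain x where x: "x \<in> X" using nonempty by blast
  have "X \<noteq> {x}"
  proof
    assume X: "X = {x}"
    then have "x = 0" using centred by simp
    then show False using unit[OF x] by simp
  qed
  then obtain y where "y \<in> X" "y \<noteq> x" using x by blast
  then have "y \<bullet> x \<in> S" using x unfolding S_def by blast
  then have "Max S \<in> S" using fin by (intro Max_in) auto
  moreover have "\<exists>x\<in>X. \<exists>y\<in>X. x \<noteq> y \<and> x \<bullet> y = t" if "t \<in> S" for t
    using that unfolding S_def by blast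
  moreover have "x \<bullet> y \<le> Max S" if "x \<in> X" "y \<in> X" "x \<noteq> y" for x y
  proof (rule Max_ge[OF fin])
    show "x \<bullet> y \<in> S" using that unfolding S_def by blast
  qed
  ultimately show ?thesis by blast
qed

theorem corollary2:
  fixes d :: nat
    and R :: "nat \<Rightarrow> ('x::finite \<times> 'x) set"
    and E :: "nat \<Rightarrow> real ^ 'x ^ 'x"
    and T :: "real ^ 'x \<Rightarrow> real ^ 3"
  assumes "symmetric_association_scheme d R"
    and "primitive_idempotent_ordering d R E"
    and "Q_polynomial_ordering d E"
    and "rank (E 1) = 3"
    and "isometric_identification (column_space (E 1)) T"
  shows "\<exists>f P. orthogonal_transformation f \<and>
           f ` range (\<lambda>x. T (spherical_embedding (E 1) x)) = polyhedron_vertices P \<and>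
           polyhedron_vertices P \<subseteq> sphere 0 1 \<and>
           (regular_tetrahedron P \<and> CARD('x) = 4 \<or>
            regular_octahedron P \<and> CARD('x) = 6 \<or>
            regular_cube P \<and> CARD('x) = 8 \<or>
            regular_icosahedron P \<and> CARD('x) = 12 \<or>
            cuboctahedron P \<and> CARD('x) = 12 \<or>
            regular_dodecahedron P \<and> CARD('x) = 20 \<or>
            icosidodecahedron P \<and> CARD('x) = 30)"
proof -
  interpret embedded_scheme d R E T
    using assms by unfold_locales
  let ?X = "range embedding"
  have X: "range (\<lambda>x. T (spherical_embedding (E 1) x)) = ?X"
    by (simp add: embedding_def)
  have sphere: "?X \<subseteq> sphere 0 1"
    using embedding_unit by (auto simp: norm_eq_sqrt_inner)
  have id: "orthogonal_transformation (\<lambda>v :: real ^ 3. v)" by (rule orthogonal_transformation_id)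
  obtain \<beta> where "cubic_tight_set ?X \<beta>" by (rule cubic_constant)
  then interpret cub: cubic_tight_set ?X \<beta> .
  show ?thesis
  proof (cases "\<beta> = 0")
    case False
    note ang = cub.simplex_if_cubic_nonzero[OF False]
    show ?thesis
      using tetrahedron[OF ang] id sphere hull.vertices_hull unfolding X card_range_embedding
      by (intro exI[of _ "\<lambda>v. v"] exI[of _ "convex hull ?X"]) simp
  next
    case True
    obtain \<alpha> where \<alpha>: "\<And>x y. x \<in> ?X \<Longrightarrow> y \<in> ?X \<Longrightarrow> x \<noteq> y \<Longrightarrow> x \<bullet> y \<le> \<alpha>"
      "\<exists>x\<in>?X. \<exists>y\<in>?X. x \<noteq> y \<and> x \<bullet> y = \<alpha>"
      using largest_inner_product by blast
    have "balanced_scheme_set ?X"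
      using \<open>cubic_tight_set ?X \<beta>\<close> embedding_adjacency_polynomial
      unfolding True balanced_scheme_set_def balanced_scheme_set_axioms_def by blast
    then interpret nn: nearest_neighbours ?X \<alpha>
      using \<alpha> unfolding nearest_neighbours_def nearest_neighbours_axioms_def by blast
    from nn.valency_cases consider "nn.valency = 3" | "nn.valency = 4" | "nn.valency = 5" by blast
    then show ?thesis
    proof cases
      case 1
      then obtain f where f: "orthogonal_transformation f" "f ` ?X = cube_vertices"
        using nn.cube_image by blast
      have "cube_vertices \<subseteq> sphere 0 1" using cube.unit by (auto simp: norm_eq_sqrt_inner)
      moreover have "CARD('x) = 8" using nn.card_X_odd_valency 1 card_range_embedding by simp
      ultimately show ?thesis
        using f regular_cube cube.vertices_hull unfolding X
        by (intro exI[of _ f] exI[of _ "convex hull cube_vertices"]) simp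
    next
      case 2
      then have "regular_octahedron (convex hull ?X)" "CARD('x) = 6"
        using nn.octahedron_or_icosahedron nn.card_X_valency_4 card_range_embedding by simp_all
      then show ?thesis
        using id sphere hull.vertices_hull unfolding X
        by (intro exI[of _ "\<lambda>v. v"] exI[of _ "convex hull ?X"]) simp
    next
      case 3
      then have "regular_icosahedron (convex hull ?X)" "CARD('x) = 12"
        using nn.octahedron_or_icosahedron nn.card_X_odd_valency card_range_embedding by simp_all
      then show ?thesis
        using id sphere hull.vertices_hull unfolding X
        by (intro exI[of _ "\<lambda>v. v"] exI[of _ "convex hull ?X"]) simp
    qed
  qed
qed

end
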